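(* Assume the following. (1) (Separation) There exists $\Delta>0$ such that for all $n\ge 1$ and all $1\le i\ne j\le n$, $\|f_i-f_j\|\ge 2\Delta$. (2) (Projection control) There exist an integer $J_0\ge 1$ and non-negative numbers $(s_j)_{j\ge J_0}$ with $\sum_{j\ge J_0}s_j^2<\infty$ such that for all $n\ge1$, $1\le i\le n$ and $j\ge J_0$, $|\langle f_i,e_j\rangle|\le s_j$. Let $d_0\ge J_0$ be the associated integer described in the context. (3) (Stationarity and decay) The covariance functions are stationary, $K_\theta(f,g)=K_\theta(f-g)$ for all $\theta\in\Theta$, $f,g\in\mathcal H$, and there are a fixed $\gamma_0>d_0$ and a constant $C>0$ with $\sup_{\theta\in\Theta}|K_\theta(f)|\le \frac{C}{1+\|f\|^{\gamma_0}}$ for all $f\in\mathcal H$. (4) There is a fixed $c>0$ such that $\lambda_{\min}(R_\theta)\ge c$ for all $n\ge1$ and all $\theta\in\Theta$, where $\lambda_{\min}$ denotes the smallest eigenvalue. (5) For all $\alpha>0$, $\displaystyle\liminf_{n\to\infty}\inf_{\theta\in\Theta,\ \|\theta-\theta_0\|\ge\alpha}\frac1n\sum_{i,j=1}^n[K_\theta(f_i,f_j)-K_{\theta_0}(f_i,f_j)]^2>0$. (6) For every $f\in\mathcal H$, $K_\theta(f)$ is continuously differentiable with respect to $\theta$ and, for some $\gamma_1>d_0$ and $C_1>0$, $\sup_{\theta\in\Theta}\max_{i=1,\dots,p}\left|\frac{\partial K_\theta}{\partial\theta_i}(f)\right|\le\frac{C_1}{1+\|f\|^{\gamma_1}}$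 for all $f\in\mathcal H$. Let $\widehat\theta_n\in\operatorname{argmin}_{\theta\in\Theta}\mathcal L_n(\theta)$ be the maximum likelihood estimator. Then $\widehat\theta_n\to\theta_0$ in probability as $n\to\infty$.
   Context: $\mathcal H$ is a separable Hilbert space (not necessarily real, finite- or infinite-dimensional) with inner product $\langle\cdot,\cdot\rangle$ and norm $\|\cdot\|$; $(e_j)_{j\ge1}$ is a fixed orthonormal basis of $\mathcal H$ (with the convention $e_j=0$ for $j>\dim\mathcal H$ if $\dim\mathcal H<\infty$). $\Theta\subset\mathbb R^p$ is compact, $\theta_0$ lies in the interior of $\Theta$, and $\{K_\theta:\theta\in\Theta\}$ is a parametric family of real covariance functions on $\mathcal H\times\mathcal H$. $Y$ is a real Gaussian process indexed by $\mathcal H$ with zero mean and covariance function $K_{\theta_0}$. For stationary kernels the same symbol $K_\theta$ is used for the function of one variable. For each $n\ge1$, $f_1,\dots,f_n\in\mathcal H$ are deterministic inputs which may depend on $n$ (triangular array $f_i=f_i^{n}$, the superscript being omitted). Put $y=[Y(f_1),\dots,Y(f_n)]^\top$, $R_\theta=R(\theta)=(K_\theta(f_i,f_j))_{1\le i,j\le n}$, $|R_\theta|$ its determinant, and $$\mathcal L_n(\theta)=\frac1n\ln|R_\theta|+\frac1n y^\top R_\theta^{-1}y .$$ For $d\ge1$ let $f_{i,d}=\sum_{j=1}^d\langle f_i,e_j\rangle e_j$. When the separation and projection-control hypotheses hold with $\Delta,J_0,(s_j)$, $d_0$ denotes a fixed integer $d_0\ge J_0$, independent of $n$, such that $\|f_{i,d_0}-f_{j,d_0}\|\ge\Delta$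 for all $n$ and all $1\le i<j\le n$, and $\sum_{k=d_0+1}^\infty s_k^2<\Delta^2/16$ (such an integer exists).
   Formalization: Condition (6), the derivatives and their bound, is required on a set V that contains Θ and the segments between nearby points of Θ (V = Θ if Θ is convex; any open neighbourhood is allowed); with the bound on Θ only, the claim fails for some compact Θ. *)

theory Defs
  imports
    "HOL-Probability.Probability"
    "Jordan_Normal_Form.Determinant"
    "Jordan_Normal_Form.Gauss_Jordan_Elimination"
    "Jordan_Normal_Form.Char_Poly"
    "Jordan_Normal_Form.Spectral_Radius"
begin

text \<open>The library has real inner product spaces only.  Here the scalar field is a parameter
  \<open>S\<close>, either \<open>\<real>\<close> or all of the complex numbers, and \<open>smul a x\<close> is meaningful for \<open>a \<in> S\<close>.
  The vector space operations over the reals, the norm and completeness come from the class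
  \<open>banach\<close>; the axioms make \<open>smul\<close> extend the real scaling and \<open>ip\<close> an inner product with values
  in \<open>S\<close>, linear in its first argument, that induces the norm.\<close>

locale hilbert_space =
  fixes S :: "complex set"
    and smul :: "complex \<Rightarrow> 'h::banach \<Rightarrow> 'h"
    and ip :: "'h \<Rightarrow> 'h \<Rightarrow> complex"
  assumes scalars: "S = \<real> \<or> S = UNIV"
    and smul_add_right: "a \<in> S \<Longrightarrow> smul a (x + y) = smul a x + smul a y"
    and smul_add_left: "a \<in> S \<Longrightarrow> b \<in> S \<Longrightarrow> smul (a + b) x = smul a x + smul b x"
    and smul_smul: "a \<in> S \<Longrightarrow> b \<in> S \<Longrightarrow> smul a (smul b x) = smul (a * b) x"
    and smul_of_real: "smul (of_real r) x = r *\<^sub>R x"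
    and ip_scalar: "ip x y \<in> S"
    and ip_cnj: "ip y x = cnj (ip x y)"
    and ip_add_left: "ip (x + y) z = ip x z + ip y z"
    and ip_smul_left: "a \<in> S \<Longrightarrow> ip (smul a x) y = a * ip x y"
    and ip_self: "ip x x = of_real ((norm x)\<^sup>2)"

lemma hilbert_space_real:
  "hilbert_space \<real> (\<lambda>a x. Re a *\<^sub>R x)
     (\<lambda>x y::'h::{real_inner,banach}. of_real (inner x y) :: complex)"
  by unfold_locales (auto simp: scaleR_right_distrib scaleR_left_distrib inner_add_left
      power2_norm_eq_inner intro: inner_commute elim!: Reals_cases)

lemma hilbert_space_complex: "hilbert_space UNIV (*) (\<lambda>x y. x * cnj y)"
  by unfold_locales
    (auto simp: algebra_simps scaleR_conv_of_real complex_norm_square[symmetric])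

definition partial_sum ::
  "(complex \<Rightarrow> 'h \<Rightarrow> 'h) \<Rightarrow> ('h \<Rightarrow> 'h \<Rightarrow> complex) \<Rightarrow> (nat \<Rightarrow> 'h) \<Rightarrow> nat \<Rightarrow> 'h \<Rightarrow> 'h::real_normed_vector"
  where "partial_sum smul ip e d x = (\<Sum>j = 1..d. smul (ip x (e j)) (e j))"

text \<open>Orthonormal basis indexed by \<open>j \<ge> 1\<close> (the value \<open>e 0\<close> plays no role).  \<open>D\<close> is the Hilbert
  dimension; beyond it the sequence is padded by zero.  Separability is a consequence.\<close>

definition orthonormal_basis ::
  "(complex \<Rightarrow> 'h \<Rightarrow> 'h) \<Rightarrow> ('h \<Rightarrow> 'h \<Rightarrow> complex) \<Rightarrow> (nat \<Rightarrow> 'h::real_normed_vector) \<Rightarrow> bool"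
  where "orthonormal_basis smul ip e \<longleftrightarrow>
    (\<exists>D::enat.
       (\<forall>i\<ge>1. \<forall>j\<ge>1. enat i \<le> D \<longrightarrow> enat j \<le> D \<longrightarrow> ip (e i) (e j) = (if i = j then 1 else 0)) \<and>
       (\<forall>j\<ge>1. D < enat j \<longrightarrow> e j = 0)) \<and>
    (\<forall>x. (\<lambda>d. partial_sum smul ip e d x) \<longlonglongrightarrow> x)"

definition covariance_function :: "('h \<Rightarrow> 'h \<Rightarrow> real) \<Rightarrow> bool"
  where "covariance_function K \<longleftrightarrow>
    (\<forall>f g. K f g = K g f) \<and>
    (\<forall>F a. finite F \<longrightarrow> (\<Sum>f\<in>F. \<Sum>g\<in>F. a f * a g * K f g) \<ge> 0)"

text \<open>Degenerate normal laws are included: positive semidefinite covariances may be singular.\<close>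

definition gaussian_variable :: "'w measure \<Rightarrow> ('w \<Rightarrow> real) \<Rightarrow> bool"
  where "gaussian_variable M X \<longleftrightarrow> X \<in> borel_measurable M \<and>
    (\<exists>\<mu>. (AE \<omega> in M. X \<omega> = \<mu>) \<or>
         (\<exists>\<sigma>>0. distributed M lborel X (\<lambda>x. ennreal (normal_density \<mu> \<sigma> x))))"

definition centered_gaussian_process ::
  "'w measure \<Rightarrow> ('h \<Rightarrow> 'w \<Rightarrow> real) \<Rightarrow> ('h \<Rightarrow> 'h \<Rightarrow> real) \<Rightarrow> bool"
  where "centered_gaussian_process M Y K \<longleftrightarrow>
    (\<forall>F a. finite F \<longrightarrow> gaussian_variable M (\<lambda>\<omega>. \<Sum>f\<in>F. a f * Y f \<omega>)) \<and>
    (\<forall>f. integral\<^sup>L M (Y f) = 0) \<and>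
    (\<forall>f g. integral\<^sup>L M (\<lambda>\<omega>. Y f \<omega> * Y g \<omega>) = K f g)"

text \<open>Inputs \<open>f n i\<close> are used for \<open>1 \<le> i \<le> n\<close>, whereas matrix and vector entries are numbered
  from 0; hence the shift by \<open>Suc\<close>.\<close>

definition cov_matrix :: "('h \<Rightarrow> 'h \<Rightarrow> real) \<Rightarrow> (nat \<Rightarrow> nat \<Rightarrow> 'h) \<Rightarrow> nat \<Rightarrow> real mat"
  where "cov_matrix K f n = mat n n (\<lambda>(i, j). K (f n (Suc i)) (f n (Suc j)))"

definition obs_vec :: "('h \<Rightarrow> 'w \<Rightarrow> real) \<Rightarrow> (nat \<Rightarrow> nat \<Rightarrow> 'h) \<Rightarrow> nat \<Rightarrow> 'w \<Rightarrow> real Matrix.vec"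
  where "obs_vec Y f n \<omega> = Matrix.vec n (\<lambda>i. Y (f n (Suc i)) \<omega>)"

definition lambda_min :: "real mat \<Rightarrow> real"
  where "lambda_min A = Min (spectrum A)"

definition neg_log_lik ::
  "('t \<Rightarrow> 'h \<Rightarrow> 'h \<Rightarrow> real) \<Rightarrow> (nat \<Rightarrow> nat \<Rightarrow> 'h) \<Rightarrow> ('h \<Rightarrow> 'w \<Rightarrow> real) \<Rightarrow> nat \<Rightarrow> 'w \<Rightarrow> 't \<Rightarrow> real"
  where "neg_log_lik K f Y n \<omega> \<theta> =
    (let R = cov_matrix (K \<theta>) f n; y = obs_vec Y f n \<omega> in
       1 / real n * ln (Determinant.det R) +
       1 / real n * scalar_prod y (mult_mat_vec (the (mat_inverse R)) y))"

text \<open>Derivatives at boundary points of a compact set \<open>\<Theta>\<close> need a set \<open>V \<supseteq> \<Theta>\<close> within which they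
  are taken.  \<open>V\<close> has to contain the segments between nearby points of \<open>\<Theta>\<close>, so that a bound on
  the gradient controls increments.  As the two lemmas show, one can take \<open>V = \<Theta>\<close> for convex
  \<open>\<Theta>\<close>, and any open neighbourhood of \<open>\<Theta>\<close> in general.  Some such requirement is indispensable:
  on isolated points of \<open>\<Theta>\<close>, for instance, a condition on derivatives within \<open>\<Theta>\<close> is void.\<close>

definition differentiability_domain :: "'t::real_normed_vector set \<Rightarrow> 't set \<Rightarrow> bool"
  where "differentiability_domain \<Theta> V \<longleftrightarrow> \<Theta> \<subseteq> V \<and>
    (\<exists>r>0. \<forall>\<theta>\<in>\<Theta>. \<forall>\<theta>'\<in>\<Theta>. dist \<theta> \<theta>' < r \<longrightarrow> closed_segment \<theta> \<theta>' \<subseteq> V)"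

lemma differentiability_domain_convex: "convex \<Theta> \<Longrightarrow> differentiability_domain \<Theta> \<Theta>"
  unfolding differentiability_domain_def
  by (auto simp: convex_contains_segment intro!: exI[of _ 1])

lemma differentiability_domain_open:
  fixes \<Theta> :: "'t::{real_normed_vector,heine_borel} set"
  assumes "compact \<Theta>" "open V" "\<Theta> \<subseteq> V"
  shows "differentiability_domain \<Theta> V"
proof -
  obtain r where r: "r > 0" "(\<Union>\<theta>\<in>\<Theta>. ball \<theta> r) \<subseteq> V"
    using compact_subset_open_imp_ball_epsilon_subset[OF assms] by blast
  have "closed_segment \<theta> \<theta>' \<subseteq> V" if "\<theta> \<in> \<Theta>" "dist \<theta> \<theta>' < r" for \<theta> \<theta>'
  proof -
    have "closed_segment \<theta> \<theta>' \<subseteq> ball \<theta> r"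
      using that r(1) by (intro closed_segment_subset) auto
    with r(2) that(1) show ?thesis by blast
  qed
  with assms(3) r(1) show ?thesis
    unfolding differentiability_domain_def by blast
qed

end

theory Submission
  imports Defs "HOL-Real_Asymp.Real_Asymp"
begin

text \<open>
  Write \<open>R\<^sub>\<theta>\<close> for the covariance matrix of the observations and let
  \<open>\<Lambda>\<^sub>n(\<theta>) = n (L\<^sub>n(\<theta>) - L\<^sub>n(\<theta>\<^sub>0))\<close>, which is minus twice a log-likelihood ratio.  If the estimator is
  at distance at least \<open>\<epsilon>\<close> from \<open>\<theta>\<^sub>0\<close>, then \<open>\<Lambda>\<^sub>n \<le> 0\<close> there.  The proof excludes this by a union bound
  over a fine net of the parameters at distance at least \<open>\<epsilon>\<close> from \<open>\<theta>\<^sub>0\<close>, which needs an exponentially small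
  probability at each single parameter.

  Single parameters: the expectation of \<open>exp (- \<Lambda>\<^sub>n(\<theta>) / 4)\<close> is the Hellinger affinity of the two
  Gaussian laws.  In coordinates that turn \<open>R\<^sub>\<theta>\<^sub>0\<close> into the identity and \<open>R\<^sub>\<theta>\<close> into a diagonal matrix
  with entries \<open>\<mu>\<^sub>k\<close> (\<open>whitening\<close>), the observations become uncorrelated standard
  normal variables and the affinity factorizes; it is at most
  \<open>exp (- (\<Sum>k. m\<^sub>k\<^sup>2) / 4)\<close> with \<open>m\<^sub>k = (\<mu>\<^sub>k - 1) / (\<mu>\<^sub>k + 1)\<close>, so that Markov's inequality gives
  \<open>likelihood_ratio_tail\<close>.

  The exponent grows linearly in \<open>n\<close> (\<open>uniform_affinity_exponent\<close>).  With
  \<open>S = R\<^sub>\<theta>\<^sub>0 + R\<^sub>\<theta>\<close> and \<open>D = R\<^sub>\<theta> - R\<^sub>\<theta>\<^sub>0\<close>, the sum of the \<open>m\<^sub>k\<^sup>2\<close> is the squared Frobenius norm of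
  \<open>S\<^sup>-\<^sup>1\<^sup>/\<^sup>2 D S\<^sup>-\<^sup>1\<^sup>/\<^sup>2\<close>, and by duality it is at least \<open>\<langle>D, T\<rangle>\<^sup>2 / \<parallel>S T\<parallel>\<^sup>2\<close> for every symmetric \<open>T\<close>.  For \<open>T\<close>
  one takes \<open>D\<close> with all entries of far apart inputs deleted.  Identifiability says that the
  squared Frobenius norm of \<open>D\<close> is at least of order \<open>n\<close>, and deleting far entries costs little of it;
  \<open>T\<close> has bounded row sums, and the squared Frobenius norm of \<open>S\<close> is of order at most \<open>n\<close>.

  The estimates work with squares of the kernel rather than with row sums of absolute values because of
  complex scalars: separation in \<open>d\<^sub>0\<close> complex, that is, \<open>2 d\<^sub>0\<close> real coordinates bounds the number of
  inputs in a ball of radius \<open>\<rho>\<close> by a multiple of \<open>(1 + \<rho>) ^ (2 d\<^sub>0)\<close>.  With the decay exponent \<open>\<gamma>\<^sub>0 > d\<^sub>0\<close>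
  the row sums of squares are bounded uniformly in \<open>n\<close>, but for \<open>\<gamma>\<^sub>0 \<le> 2 d\<^sub>0\<close> no such bound follows for the row
  sums of absolute values, and so none for the operator norms of the \<open>R\<^sub>\<theta>\<close>.

  Between the points of the net, the crude bound that one gets from the entrywise Lipschitz estimate
  for \<open>R\<^sub>\<theta>\<close> suffices (\<open>likelihood_increment_lower_bound\<close>), since the mesh \<open>n\<^sup>-\<^sup>3\<close> still gives a net of
  polynomial size (\<open>polynomial_net\<close>), which the exponential bound outweighs.
\<close>


section \<open>Simultaneous diagonalization of two positive definite forms\<close>

definition bform :: "nat \<Rightarrow> (nat \<Rightarrow> nat \<Rightarrow> real) \<Rightarrow> (nat \<Rightarrow> real) \<Rightarrow> (nat \<Rightarrow> real) \<Rightarrow> real"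
  where "bform n A x y = (\<Sum>i<n. \<Sum>j<n. A i j * x i * y j)"

text \<open>Positive definiteness, with a quantitative constant, of the matrix of the entries with indices below \<open>n\<close>.\<close>

definition coercive :: "nat \<Rightarrow> real \<Rightarrow> (nat \<Rightarrow> nat \<Rightarrow> real) \<Rightarrow> bool"
  where "coercive n c A \<longleftrightarrow> c > 0 \<and> (\<forall>i<n. \<forall>j<n. A i j = A j i) \<and>
    (\<forall>x. c * (\<Sum>i<n. (x i)\<^sup>2) \<le> bform n A x x)"

lemma bform_add_left: "bform n A (\<lambda>i. x i + y i) z = bform n A x z + bform n A y z"
  and bform_add_right: "bform n A z (\<lambda>i. x i + y i) = bform n A z x + bform n A z y"
  and bform_scale_left: "bform n A (\<lambda>i. t * x i) z = t * bform n A x z"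
  and bform_scale_right: "bform n A z (\<lambda>i. t * x i) = t * bform n A z x"
  unfolding bform_def by (simp_all add: sum.distrib sum_distrib_left algebra_simps)

lemma bform_sum_right: "finite I \<Longrightarrow> bform n A z (\<lambda>i. \<Sum>k\<in>I. t k * x k i) = (\<Sum>k\<in>I. t k * bform n A z (x k))"
proof (induction I rule: finite_induct)
  case empty
  then show ?case by (simp add: bform_def)
next
  case (insert a F)
  then show ?case by (simp add: bform_add_right bform_scale_right)
qed

lemma bform_sum_left: "finite I \<Longrightarrow> bform n A (\<lambda>i. \<Sum>k\<in>I. t k * x k i) z = (\<Sum>k\<in>I. t k * bform n A (x k) z)"
proof (induction I rule: finite_induct)
  case empty
  then show ?case by (simp add: bform_def)
next
  case (insert a F)
  then show ?case by (simp add: bform_add_left bform_scale_left)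
qed

lemma bform_commute:
  assumes "\<forall>i<n. \<forall>j<n. A i j = A j i"
  shows "bform n A x y = bform n A y x"
proof -
  have "bform n A x y = (\<Sum>j<n. \<Sum>i<n. A i j * x i * y j)"
    unfolding bform_def by (rule sum.swap)
  also have "\<dots> = bform n A y x"
    unfolding bform_def using assms by (intro sum.cong refl) (simp add: mult_ac)
  finally show ?thesis .
qed

text \<open>Fewer than \<open>n\<close> homogeneous linear equations in \<open>n\<close> unknowns: filled up with zero rows, the system has
determinant zero.\<close>

lemma exists_orthogonal_vector:
  fixes u :: "nat \<Rightarrow> nat \<Rightarrow> real"
  assumes "k < n"
  shows "\<exists>x. (\<exists>i<n. x i \<noteq> 0) \<and> (\<forall>i\<ge>n. x i = 0) \<and> (\<forall>l<k. (\<Sum>i<n. u l i * x i) = 0)"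
proof -
  define U where "U = mat n n (\<lambda>(l, i). if l < k then u l i else 0)"
  have U: "U \<in> carrier_mat n n" by (simp add: U_def)
  \<comment> \<open>Row \<open>k\<close> of \<open>U\<close> is one of the padding rows.\<close>
  have "U = mat\<^sub>r n n (\<lambda>l. if l = k then 0\<^sub>v n else row U l)"
    by (intro eq_matI) (auto simp: U_def)
  moreover have "Determinant.det (mat\<^sub>r n n (\<lambda>l. if l = k then 0\<^sub>v n else row U l)) = 0"
    using U by (intro det_row_0[OF assms]) auto
  ultimately have "Determinant.det U = 0" by simp
  then obtain v where v: "v \<in> carrier_vec n" "v \<noteq> 0\<^sub>v n" "U *\<^sub>v v = 0\<^sub>v n"
    using det_0_iff_vec_prod_zero[OF U] by auto
  define x where "x i = (if i < n then vec_index v i else 0)" for i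
  have "\<exists>i<n. x i \<noteq> 0" using v(1,2) unfolding x_def by (auto simp: vec_eq_iff)
  moreover have "(\<Sum>i<n. u l i * x i) = 0" if "l < k" for l
  proof -
    have "vec_index (U *\<^sub>v v) l = (\<Sum>i<n. u l i * x i)"
      using that assms v(1) by (simp add: U_def x_def scalar_prod_def atLeast0LessThan)
    then show ?thesis using v(3) that assms by simp
  qed
  ultimately show ?thesis by (intro exI[of _ x]) (auto simp: x_def)
qed

text \<open>Vectors of length \<open>n\<close> are functions on the natural numbers that vanish from \<open>n\<close> on, so that \<open>n\<close> can vary.
Compactness then comes from Tychonoff's theorem, coercivity giving the bounding box.\<close>

lemma compact_ellipsoid_section:
  assumes A: "coercive n c A"
  shows "compact {x. (\<forall>i\<ge>n. x i = 0) \<and> bform n A x x = 1 \<and> (\<forall>l<k. bform n A (v l) x = 0)}"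
    (is "compact ?E")
proof -
  have cont: "continuous_on UNIV (\<lambda>x::nat \<Rightarrow> real. bform n A x x)" 
    unfolding bform_def by (intro continuous_intros continuous_on_product_coordinates)
  have cont2: "continuous_on UNIV (\<lambda>x::nat \<Rightarrow> real. bform n A (v l) x)" for l
    unfolding bform_def by (intro continuous_intros continuous_on_product_coordinates)
  have "closed {x::nat\<Rightarrow>real. x i = 0}" for i
    by (intro closed_Collect_eq continuous_intros continuous_on_product_coordinates)
  moreover have "closed {x::nat\<Rightarrow>real. bform n A x x = 1}" 
    by (intro closed_Collect_eq cont continuous_intros)
  moreover have "closed {x::nat\<Rightarrow>real. bform n A (v l) x = 0}" for l
    by (intro closed_Collect_eq cont2 continuous_intros)
  ultimately have "closed ((\<Inter>i\<in>{n..}. {x::nat\<Rightarrow>real. x i = 0}) \<inter> {x. bform n A x x = 1} \<inter>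
      (\<Inter>l\<in>{..<k}. {x. bform n A (v l) x = 0}))"
    by (intro closed_Int closed_INT ballI)
  also have "((\<Inter>i\<in>{n..}. {x::nat\<Rightarrow>real. x i = 0}) \<inter> {x. bform n A x x = 1} \<inter>
      (\<Inter>l\<in>{..<k}. {x. bform n A (v l) x = 0})) = ?E" by auto
  finally have cl: "closed ?E" .
  define r where "r = sqrt (1 / c)"
  have c: "c > 0" using A by (simp add: coercive_def)
  have box: "compact (PiE UNIV (\<lambda>i::nat. {-r..r}))"
    using compactin_PiE[of "\<lambda>_. euclidean" UNIV "\<lambda>i::nat. {-r..r}"]
    by (simp add: euclidean_product_topology)
  have "?E \<subseteq> PiE UNIV (\<lambda>i::nat. {-r..r})"
  proof (intro subsetI PiE_I)
    fix x i assume x: "x \<in> ?E"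
    have "(x i)\<^sup>2 \<le> 1 / c"
    proof (cases "i < n")
      case True
      have "c * (x i)\<^sup>2 \<le> c * (\<Sum>i<n. (x i)\<^sup>2)"
        using True c by (intro mult_left_mono member_le_sum) auto
      also have "\<dots> \<le> bform n A x x" using A by (simp add: coercive_def)
      also have "\<dots> = 1" using x by simp
      finally show ?thesis using c by (simp add: field_simps)
    qed (use x c in auto)
    then have "\<bar>x i\<bar> \<le> r" unfolding r_def using real_le_rsqrt by fastforce
    then show "x i \<in> {-r..r}" by auto
  qed auto
  then have "PiE UNIV (\<lambda>i::nat. {-r..r}) \<inter> ?E = ?E" by (rule Int_absorb1)
  with compact_Int_closed[OF box cl] show ?thesis by (simp only:)
qed

text \<open>The Rayleigh quotient of \<open>B\<close> relative to \<open>A\<close> attains its minimum \<open>\<mu>\<close> on the \<open>A\<close>-orthogonal complement of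
the vectors found so far; at a minimizer \<open>x\<close> the first variation vanishes, which is the eigenvector
equation tested against the vectors of that complement.\<close>

lemma next_generalized_eigenvector:
  assumes A: "coercive n c A" and B: "\<forall>i<n. \<forall>j<n. B i j = B j i" and k: "k < n"
  shows "\<exists>x \<mu>. bform n A x x = 1 \<and> (\<forall>l<k. bform n A (v l) x = 0) \<and>
    (\<forall>w. (\<forall>l<k. bform n A (v l) w = 0) \<longrightarrow>
      bform n B x w = \<mu> * bform n A x w \<and> \<mu> * bform n A w w \<le> bform n B w w)"
proof -
  let ?E = "{x. (\<forall>i\<ge>n. x i = 0) \<and> bform n A x x = 1 \<and> (\<forall>l<k. bform n A (v l) x = 0)}"
  have c: "c > 0" and sA: "\<forall>i<n. \<forall>j<n. A i j = A j i"
    and co: "c * (\<Sum>i<n. (x i)\<^sup>2) \<le> bform n A x x" for x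
    using A by (auto simp: coercive_def)
  have pos: "bform n A x x > 0" if "\<exists>i<n. x i \<noteq> 0" for x
  proof -
    have "(\<Sum>i<n. (x i)\<^sup>2) > 0" using that by (auto intro!: sum_pos2)
    then show ?thesis using co[of x] c by (smt (verit) mult_pos_pos)
  qed
  have norm: "\<exists>t>0. (\<lambda>i. t * x i) \<in> ?E \<and> t\<^sup>2 * bform n A x x = 1"
    if "bform n A x x > 0" "\<forall>i\<ge>n. x i = 0" "\<forall>l<k. bform n A (v l) x = 0" for x
  proof -
    define t where "t = 1 / sqrt (bform n A x x)"
    have t: "t > 0" "t\<^sup>2 * bform n A x x = 1"
      using that(1) by (auto simp: t_def power_divide)
    then show ?thesis using that(2,3)
      by (intro exI[of _ t])
        (simp add: bform_scale_left bform_scale_right power2_eq_square mult.assoc)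
  qed
  have "\<exists>x0. (\<exists>i<n. x0 i \<noteq> 0) \<and> (\<forall>i\<ge>n. x0 i = 0) \<and> (\<forall>l<k. bform n A (v l) x0 = 0)"
  proof -
    have eq: "bform n A (v l) x = (\<Sum>j<n. (\<Sum>i<n. A i j * v l i) * x j)" for l x
      unfolding bform_def by (subst sum.swap) (simp add: sum_distrib_right)
    show ?thesis unfolding eq by (rule exists_orthogonal_vector[OF k])
  qed
  then obtain x0 where x0: "\<exists>i<n. x0 i \<noteq> 0" "\<forall>i\<ge>n. x0 i = 0"
      "\<forall>l<k. bform n A (v l) x0 = 0" by blast
  obtain t0 where "(\<lambda>i. t0 * x0 i) \<in> ?E"
    using norm[OF pos[OF x0(1)] x0(2,3)] by auto
  then have ne: "?E \<noteq> {}" by auto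
  have cont: "continuous_on ?E (\<lambda>x. bform n B x x)"
    unfolding bform_def
    by (intro continuous_intros continuous_on_subset[OF continuous_on_product_coordinates]) auto
  obtain x where x: "x \<in> ?E" and min: "\<forall>y\<in>?E. bform n B x x \<le> bform n B y y"
    using continuous_attains_inf[OF compact_ellipsoid_section[OF A] ne cont] by blast
  define \<mu> where "\<mu> = bform n B x x"
  have min': "\<mu> * bform n A y y \<le> bform n B y y"
    if y: "\<forall>i\<ge>n. y i = 0" "\<forall>l<k. bform n A (v l) y = 0" for y
  proof (cases "bform n A y y > 0")
    case True
    obtain t where t: "t > 0" "(\<lambda>i. t * y i) \<in> ?E" "t\<^sup>2 * bform n A y y = 1"
      using norm[OF True y] by auto
    have "\<mu> \<le> t\<^sup>2 * bform n B y y"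
      using min[rule_format, OF t(2)] unfolding \<mu>_def bform_scale_left bform_scale_right
      by (simp add: power2_eq_square mult.assoc)
    then have "t\<^sup>2 * (\<mu> * bform n A y y) \<le> t\<^sup>2 * bform n B y y" using t(3) by (simp add: algebra_simps)
    then show ?thesis using t(1) by simp
  next
    case False
    then have "\<forall>i<n. y i = 0" using pos[of y] by auto
    then have "bform n A y y = 0" "bform n B y y = 0" by (auto simp: bform_def)
    then show ?thesis by simp
  qed
  have "bform n B x w = \<mu> * bform n A x w \<and> \<mu> * bform n A w w \<le> bform n B w w"
    if w: "\<forall>l<k. bform n A (v l) w = 0" for w
  proof -
    define w' where "w' i = (if i < n then w i else 0)" for i
    have w': "bform n C y w' = bform n C y w" "bform n C w' y = bform n C w y" for C y
      by (simp_all add: bform_def w'_def)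
    define p where "p = bform n B x w' - \<mu> * bform n A x w'"
    define q where "q = bform n B w' w' - \<mu> * bform n A w' w'"
    \<comment> \<open>The inequality at the perturbed vectors \<open>x + t w'\<close>: its terms of order zero cancel, and \<open>p\<close> is half the first variation.\<close>
    have ineq: "0 \<le> 2 * t * p + t\<^sup>2 * q" for t
    proof -
      have "\<mu> * bform n A (\<lambda>i. x i + t * w' i) (\<lambda>i. x i + t * w' i)
          \<le> bform n B (\<lambda>i. x i + t * w' i) (\<lambda>i. x i + t * w' i)"
        using x w by (intro min') (simp_all add: bform_add_right bform_scale_right w', simp add: w'_def)
      moreover have "bform n A w' x = bform n A x w'" "bform n B w' x = bform n B x w'"
        using bform_commute sA B by blast+
      ultimately show ?thesis using x
        by (simp add: p_def q_def \<mu>_def bform_add_left bform_add_right bform_scale_left bform_scale_right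
            power2_eq_square algebra_simps)
    qed
    have "p = 0"
    proof (rule ccontr)
      assume "p \<noteq> 0"
      define m where "m = \<bar>q\<bar> + 1"
      define t where "t = - p / m"
      have m: "m > 0" "q - 2 * m < 0" by (auto simp: m_def)
      have "2 * t * p + t\<^sup>2 * q = (p / m)\<^sup>2 * (q - 2 * m)"
        using m(1) unfolding t_def by (simp add: power2_eq_square field_simps)
      moreover have "\<dots> < 0"
        using \<open>p \<noteq> 0\<close> m by (intro mult_pos_neg) auto
      ultimately show False using ineq[of t] by simp
    qed
    moreover have "\<mu> * bform n A w' w' \<le> bform n B w' w'"
      using w by (intro min') (simp_all add: w', simp add: w'_def)
    ultimately show ?thesis by (simp add: p_def w')
  qed
  with x show ?thesis by blast
qed

text \<open>In the induction step the eigenvector equation is known only on the complement of the earlier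
vectors; it extends to all \<open>w\<close> by subtracting the components of \<open>w\<close> along them, on which
both sides vanish.\<close>

lemma simultaneous_orthogonal_basis:
  assumes A: "coercive n c A" and B: "\<forall>i<n. \<forall>j<n. B i j = B j i" and "k \<le> n"
  shows "\<exists>v \<mu>. (\<forall>i<k. \<forall>j<k. bform n A (v i) (v j) = (if i = j then 1 else 0)) \<and>
    (\<forall>i<k. \<forall>w. bform n B (v i) w = \<mu> i * bform n A (v i) w)"
  using \<open>k \<le> n\<close>
proof (induction k)
  case 0
  show ?case by auto
next
  case (Suc k)
  then obtain v \<mu> where v: "\<forall>i<k. \<forall>j<k. bform n A (v i) (v j) = (if i = j then 1 else 0)"
    "\<forall>i<k. \<forall>w. bform n B (v i) w = \<mu> i * bform n A (v i) w" by auto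
  obtain x m where x: "bform n A x x = 1" "\<forall>l<k. bform n A (v l) x = 0"
    "\<And>w. (\<forall>l<k. bform n A (v l) w = 0) \<Longrightarrow> bform n B x w = m * bform n A x w"
    using next_generalized_eigenvector[OF A B, of k v] Suc.prems by (metis Suc_le_lessD)
  have sA: "\<forall>i<n. \<forall>j<n. A i j = A j i" using A by (auto simp: coercive_def)
  have x': "bform n A x (v l) = 0" "bform n B x (v l) = 0" if "l < k" for l
    using x(2) v(2) that bform_commute[OF sA] bform_commute[OF B] by (metis, metis mult_zero_right)
  have "bform n B x w = m * bform n A x w" for w
  proof -
    define w' where "w' i = w i + (\<Sum>l\<in>{..<k}. (- bform n A (v l) w) * v l i)" for i
    have "bform n A (v l) w' = 0" if "l < k" for l
    proof -
      have "bform n A (v l) w' = bform n A (v l) w + (\<Sum>i<k. - bform n A (v i) w * bform n A (v l) (v i))"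
        unfolding w'_def by (simp only: bform_add_right bform_sum_right finite_lessThan)
      also have "(\<Sum>i<k. - bform n A (v i) w * bform n A (v l) (v i)) = (\<Sum>i<k. if i = l then - bform n A (v l) w else 0)"
        using v(1) that by (intro sum.cong) auto
      finally show ?thesis using that by simp
    qed
    then have "bform n B x w' = m * bform n A x w'" using x(3) by blast
    moreover have "bform n B x w' = bform n B x w" "bform n A x w' = bform n A x w"
      unfolding w'_def by (simp_all only: bform_add_right bform_sum_right finite_lessThan) (simp_all add: x')
    ultimately show ?thesis by simp
  qed
  then show ?case using v x x'
    by (intro exI[of _ "v(k := x)"] exI[of _ "\<mu>(k := m)"]) (auto simp: less_Suc_eq)
qed

text \<open>Relative to the identity form, the minimum of the Rayleigh quotient is an eigenvalue of the matrix.\<close>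

lemma coercive_lambda_min:
  assumes n: "n \<ge> 1" and A: "\<forall>i<n. \<forall>j<n. A i j = A j i"
    and c: "c > 0" "lambda_min (mat n n (\<lambda>(i, j). A i j)) \<ge> c"
  shows "coercive n c A"
proof -
  define I where "I i j = (if i = j then 1 else 0 :: real)" for i j :: nat
  have I: "bform n I x y = (\<Sum>i<n. x i * y i)" for x y
    unfolding bform_def I_def by (simp add: if_distrib if_distribR cong: if_cong)
  have cI: "coercive n 1 I"
    unfolding coercive_def I by (auto simp: I_def power2_eq_square)
  obtain x \<mu> where x: "bform n I x x = 1" "\<And>w. bform n A x w = \<mu> * bform n I x w"
      "\<And>w. \<mu> * bform n I w w \<le> bform n A w w"
    using next_generalized_eigenvector[OF cI A, of 0] n by auto
  let ?A = "mat n n (\<lambda>(i, j). A i j)" and ?x = "Matrix.vec n x"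
  have "?A *\<^sub>v ?x = \<mu> \<cdot>\<^sub>v ?x"
  proof (intro eq_vecI)
    fix i assume "i < dim_vec (\<mu> \<cdot>\<^sub>v ?x)"
    then have i: "i < n" by simp
    have "vec_index (?A *\<^sub>v ?x) i = (\<Sum>j<n. A i j * x j)"
      using i by (simp add: scalar_prod_def atLeast0LessThan)
    also have "\<dots> = bform n A x (I i)"
    proof -
      have "bform n A x (I i) = (\<Sum>j<n. A j i * x j)"
        unfolding bform_def I_def using i by (simp add: if_distrib if_distribR cong: if_cong)
      then show ?thesis using A i by simp
    qed
    also have "\<dots> = \<mu> * x i" unfolding x(2) I using i by (simp add: I_def if_distrib cong: if_cong)
    finally show "vec_index (?A *\<^sub>v ?x) i = vec_index (\<mu> \<cdot>\<^sub>v ?x) i" using i by simp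
  qed simp
  moreover have "?x \<noteq> 0\<^sub>v n"
  proof
    assume "?x = 0\<^sub>v n"
    then have "x i = 0" if "i < n" for i using that by (metis index_vec index_zero_vec(1))
    then show False using x(1) by (simp add: I)
  qed
  ultimately have "\<mu> \<in> spectrum ?A"
    unfolding spectrum_def eigenvalue_def eigenvector_def by (auto intro!: exI[of _ ?x])
  moreover have "finite (spectrum ?A)" using card_finite_spectrum(1)[of ?A n] by simp
  ultimately have "c \<le> \<mu>" using c(2) unfolding lambda_min_def by (meson Min_le order_trans)
  have "c * (\<Sum>i<n. (w i)\<^sup>2) \<le> bform n A w w" for w
  proof -
    have "c * (\<Sum>i<n. (w i)\<^sup>2) \<le> \<mu> * (\<Sum>i<n. (w i)\<^sup>2)"
      using \<open>c \<le> \<mu>\<close> by (intro mult_right_mono sum_nonneg) auto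
    also have "\<dots> = \<mu> * bform n I w w" by (simp add: I power2_eq_square)
    also have "\<dots> \<le> bform n A w w" by (rule x(3))
    finally show ?thesis .
  qed
  then show ?thesis using A c(1) by (auto simp: coercive_def)
qed

lemma the_mat_inverse:
  fixes A :: "'a::field mat"
  assumes A: "A \<in> carrier_mat n n" and C: "C \<in> carrier_mat n n" and AC: "A * C = 1\<^sub>m n"
  shows "the (mat_inverse A) = C"
proof (cases "mat_inverse A")
  case None
  have "C * A = 1\<^sub>m n" using mat_mult_left_right_inverse[OF A C AC] .
  then have "A \<in> Units (ring_mat TYPE('a) n n)"
    using A C AC unfolding Units_def ring_mat_def by auto
  then show ?thesis using mat_inverse(1)[OF A None, of n] by simp
next
  case (Some D)
  then have D: "D * A = 1\<^sub>m n" "D \<in> carrier_mat n n" using mat_inverse(2)[OF A] by auto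
  have "D = D * (A * C)" using D AC by simp
  also have "\<dots> = C" using D A C by (simp flip: assoc_mult_mat)
  finally show ?thesis using Some by simp
qed

lemma det_mat_diag: "Determinant.det (mat_diag n d) = (\<Prod>k<n. d k)"
  by (subst det_upper_triangular[of _ n])
    (auto simp: mat_diag_def diag_mat_def prod.list_conv_set_nth atLeast0LessThan)

text \<open>The rows of \<open>p\<close> are a basis that is orthonormal for \<open>A\<close> and orthogonal for \<open>B\<close>, and \<open>q\<close> is the inverse
matrix of \<open>p\<close>.  In this basis the determinant and the quadratic form of the Gaussian
likelihoods of \<open>A\<close> and \<open>B\<close> become sums over \<open>k\<close>.\<close>

lemma whitening:
  assumes A: "coercive n c A" and B: "coercive n c' B"
  obtains p q \<mu> where
    "\<And>k. k < n \<Longrightarrow> \<mu> k > 0"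
    "\<And>k l. k < n \<Longrightarrow> l < n \<Longrightarrow> bform n A (p k) (p l) = (if k = l then 1 else 0)"
    "\<And>k l. k < n \<Longrightarrow> l < n \<Longrightarrow> bform n B (p k) (p l) = (if k = l then \<mu> k else 0)"
    "\<And>i j. i < n \<Longrightarrow> j < n \<Longrightarrow> A i j = (\<Sum>k<n. q i k * q j k)"
    "\<And>i j. i < n \<Longrightarrow> j < n \<Longrightarrow> B i j = (\<Sum>k<n. \<mu> k * q i k * q j k)"
    "ln (Determinant.det (mat n n (\<lambda>(i, j). B i j))) - ln (Determinant.det (mat n n (\<lambda>(i, j). A i j)))
       = (\<Sum>k<n. ln (\<mu> k))"
    "\<And>y. Matrix.vec n y \<bullet> (the (mat_inverse (mat n n (\<lambda>(i, j). A i j))) *\<^sub>v Matrix.vec n y)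
       = (\<Sum>k<n. (\<Sum>i<n. p k i * y i)\<^sup>2)"
    "\<And>y. Matrix.vec n y \<bullet> (the (mat_inverse (mat n n (\<lambda>(i, j). B i j))) *\<^sub>v Matrix.vec n y)
       = (\<Sum>k<n. (\<Sum>i<n. p k i * y i)\<^sup>2 / \<mu> k)"
proof -
  have sA: "\<forall>i<n. \<forall>j<n. A i j = A j i" and sB: "\<forall>i<n. \<forall>j<n. B i j = B j i"
    using A B by (auto simp: coercive_def)
  obtain v \<mu> where v: "\<forall>i<n. \<forall>j<n. bform n A (v i) (v j) = (if i = j then 1 else 0)"
    "\<forall>i<n. \<forall>w. bform n B (v i) w = \<mu> i * bform n A (v i) w"
    using simultaneous_orthogonal_basis[OF A sB, of n] by auto
  have vB: "\<forall>i<n. \<forall>j<n. bform n B (v i) (v j) = (if i = j then \<mu> i else 0)"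
    using v by simp
  have pos: "\<mu> k > 0" if k: "k < n" for k
  proof -
    have "bform n A (v k) (v k) = 1" using v k by simp
    then have "\<exists>i<n. v k i \<noteq> 0" by (rule_tac ccontr) (auto simp: bform_def)
    then have "(\<Sum>i<n. (v k i)\<^sup>2) > 0" by (auto intro!: sum_pos2)
    then have "0 < c' * (\<Sum>i<n. (v k i)\<^sup>2)" using B by (auto simp: coercive_def)
    also have "\<dots> \<le> bform n B (v k) (v k)" using B by (auto simp: coercive_def)
    finally show ?thesis using vB k by simp
  qed
  define Am where "Am = mat n n (\<lambda>(i, j). A i j)"
  define Bm where "Bm = mat n n (\<lambda>(i, j). B i j)"
  define P where "P = mat n n (\<lambda>(k, i). v k i)"
  define Q where "Q = Am * P\<^sup>T"
  have cancel: "L * (M * X) = X"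
    if "L * M = 1\<^sub>m n" "L \<in> carrier_mat n n" "M \<in> carrier_mat n n" "X \<in> carrier_mat n n"
    for L M X :: "real mat"
    using that assoc_mult_mat[of L n n M n X n] by simp
  note [simp] = assoc_mult_mat[of _ n n _ n _ n] mult_carrier_mat[of _ n n _ n]
  have cA[simp]: "Am \<in> carrier_mat n n" and cB[simp]: "Bm \<in> carrier_mat n n"
    and cP[simp]: "P \<in> carrier_mat n n" and cPT[simp]: "P\<^sup>T \<in> carrier_mat n n"
    and cD[simp]: "\<And>d. mat_diag n d \<in> carrier_mat n n"
    by (simp_all add: Am_def Bm_def P_def)
  have cQ[simp]: "Q \<in> carrier_mat n n" and cQT[simp]: "Q\<^sup>T \<in> carrier_mat n n"
    by (simp_all add: Q_def)
  have tA: "Am\<^sup>T = Am" using sA by (intro eq_matI) (auto simp: Am_def)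
  have form: "(P * (mat n n (\<lambda>(i, j). C i j) * P\<^sup>T)) $$ (k, l) = bform n C (v k) (v l)" if "k < n" "l < n" for C k l
    using that by (simp add: P_def bform_def scalar_prod_def sum_distrib_left atLeast0LessThan mult_ac)
  have PAP: "P * (Am * P\<^sup>T) = 1\<^sub>m n"
    using v(1) by (intro eq_matI) (auto simp: Am_def form, auto simp: P_def)
  have PBP: "P * (Bm * P\<^sup>T) = mat_diag n \<mu>"
    using vB by (intro eq_matI) (auto simp: Bm_def form mat_diag_def, auto simp: P_def)
  have PQ: "P * Q = 1\<^sub>m n" using PAP by (simp add: Q_def)
  have QP: "Q * P = 1\<^sub>m n" using mat_mult_left_right_inverse[OF cP cQ PQ] .
  have PQT: "P\<^sup>T * Q\<^sup>T = 1\<^sub>m n" using QP by (metis transpose_mult cQ cP transpose_one)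
  have QPT: "Q\<^sup>T * P\<^sup>T = 1\<^sub>m n" using PQ by (metis transpose_mult cQ cP transpose_one)
  have can: "Q * (P * X) = X" "P * (Q * X) = X" "P\<^sup>T * (Q\<^sup>T * X) = X" "Q\<^sup>T * (P\<^sup>T * X) = X"
    if "X \<in> carrier_mat n n" for X
    using that QP PQ PQT QPT by (simp_all add: cancel)
  have Aeq: "Am = Q * Q\<^sup>T"
  proof -
    have "Q\<^sup>T = P * Am" unfolding Q_def using tA
      by (metis transpose_mult transpose_transpose cA cPT)
    then show ?thesis by (simp add: can)
  qed
  have Beq: "Bm = Q * (mat_diag n \<mu> * Q\<^sup>T)"
  proof -
    have "Q * (mat_diag n \<mu> * Q\<^sup>T) = Q * (P * (Bm * (P\<^sup>T * Q\<^sup>T)))"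
      by (simp flip: PBP)
    also have "\<dots> = Bm" by (simp add: can PQT right_mult_one_mat[OF cB])
    finally show ?thesis by simp
  qed
  have dQ: "Determinant.det Q \<noteq> 0"
    using det_mult[OF cQ cP] QP by auto
  have detA: "Determinant.det Am = (Determinant.det Q)\<^sup>2"
    unfolding Aeq by (simp add: det_mult[OF cQ cQT] det_transpose[OF cQ] power2_eq_square)
  have detB: "Determinant.det Bm = (Determinant.det Q)\<^sup>2 * (\<Prod>k<n. \<mu> k)"
    unfolding Beq
    by (simp add: det_mult[OF cQ mult_carrier_mat[OF cD cQT]] det_mult[OF cD cQT] det_transpose[OF cQ]
        det_mat_diag power2_eq_square)
  have "ln (Determinant.det Bm) - ln (Determinant.det Am) = (\<Sum>k<n. ln (\<mu> k))"
  proof -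
    have "(\<Prod>k<n. \<mu> k) > 0" using pos by (intro prod_pos) auto
    moreover have "ln (\<Prod>k<n. \<mu> k) = (\<Sum>k<n. ln (\<mu> k))"
      using pos by (intro ln_prod) force+
    ultimately show ?thesis
      unfolding detA detB using dQ ln_mult_pos[of "(Determinant.det Q)\<^sup>2" "\<Prod>k<n. \<mu> k"] by simp
  qed
  have invA: "the (mat_inverse Am) = P\<^sup>T * P"
    by (rule the_mat_inverse[OF cA]) (simp_all add: Aeq can QP)
  have invB: "the (mat_inverse Bm) = P\<^sup>T * (mat_diag n (\<lambda>k. 1 / \<mu> k) * P)"
  proof (rule the_mat_inverse[OF cB])
    have dd: "mat_diag n \<mu> * (mat_diag n (\<lambda>k. 1 / \<mu> k) * P) = P"
    proof -
      have "mat_diag n (\<lambda>k. \<mu> k * (1 / \<mu> k)) = 1\<^sub>m n"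
        using pos by (intro eq_matI) (auto simp: mat_diag_def less_le)
      then have "mat_diag n \<mu> * mat_diag n (\<lambda>k. 1 / \<mu> k) = 1\<^sub>m n"
        by (simp only: mat_diag_diag)
      from cancel[OF this cD cD cP] show ?thesis .
    qed
    show "Bm * (P\<^sup>T * (mat_diag n (\<lambda>k. 1 / \<mu> k) * P)) = 1\<^sub>m n"
      unfolding Beq by (simp add: can QP dd)
  qed simp
  have quad: "Matrix.vec n y \<bullet> ((P\<^sup>T * (mat_diag n d * P)) *\<^sub>v Matrix.vec n y)
      = (\<Sum>k<n. (\<Sum>i<n. v k i * y i)\<^sup>2 * d k)" for y d
  proof -
    let ?y = "Matrix.vec n y"
    have cy: "?y \<in> carrier_vec n" by simp
    have Py: "P *\<^sub>v ?y = Matrix.vec n (\<lambda>k. \<Sum>i<n. v k i * y i)"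
      by (intro eq_vecI) (auto simp: P_def scalar_prod_def atLeast0LessThan)
    have "?y \<bullet> ((P\<^sup>T * (mat_diag n d * P)) *\<^sub>v ?y) = ?y \<bullet> (P\<^sup>T *\<^sub>v (mat_diag n d *\<^sub>v (P *\<^sub>v ?y)))"
      by (simp add: assoc_mult_mat_vec[of _ n n _ n])
    also have "\<dots> = (P *\<^sub>v ?y) \<bullet> (mat_diag n d *\<^sub>v (P *\<^sub>v ?y))"
      using transpose_vec_mult_scalar[OF cP, of ?y "mat_diag n d *\<^sub>v (P *\<^sub>v ?y)"]
      by (simp add: mult_mat_vec_carrier[of _ n n] comm_scalar_prod[of _ n])
    also have "mat_diag n d *\<^sub>v (P *\<^sub>v ?y) = Matrix.vec n (\<lambda>k. (\<Sum>i<n. v k i * y i) * d k)"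
      unfolding Py by (intro eq_vecI) (auto simp: mat_diag_def scalar_prod_def if_distrib if_distribR cong: if_cong)
    finally show ?thesis unfolding Py
      by (simp add: scalar_prod_def atLeast0LessThan power2_eq_square mult_ac)
  qed
  have qA: "Matrix.vec n y \<bullet> (the (mat_inverse Am) *\<^sub>v Matrix.vec n y) = (\<Sum>k<n. (\<Sum>i<n. v k i * y i)\<^sup>2)" for y
    using quad[of y "\<lambda>_. 1"] by (simp add: invA left_mult_one_mat[OF cP])
  have qB: "Matrix.vec n y \<bullet> (the (mat_inverse Bm) *\<^sub>v Matrix.vec n y) = (\<Sum>k<n. (\<Sum>i<n. v k i * y i)\<^sup>2 / \<mu> k)" for y
    using quad[of y "\<lambda>k. 1 / \<mu> k"] by (simp add: invB)
  have "A i j = (\<Sum>k<n. Q $$ (i, k) * Q $$ (j, k))" if "i < n" "j < n" for i j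
  proof -
    have "A i j = Am $$ (i, j)" using that by (simp add: Am_def)
    also have "\<dots> = (Q * Q\<^sup>T) $$ (i, j)" using Aeq by simp
    also have "\<dots> = (\<Sum>k<n. Q $$ (i, k) * Q $$ (j, k))" 
      using that carrier_matD[OF cQ] by (simp add: scalar_prod_def atLeast0LessThan)
    finally show ?thesis .
  qed
  moreover have "B i j = (\<Sum>k<n. \<mu> k * Q $$ (i, k) * Q $$ (j, k))" if "i < n" "j < n" for i j
  proof -
    have "B i j = Bm $$ (i, j)" using that by (simp add: Bm_def)
    also have "\<dots> = (Q * (mat_diag n \<mu> * Q\<^sup>T)) $$ (i, j)" using Beq by simp
    also have "\<dots> = (\<Sum>k<n. \<mu> k * Q $$ (i, k) * Q $$ (j, k))" 
      using that carrier_matD[OF cQ] by (simp add: mat_diag_mult_left[of _ n n] scalar_prod_def atLeast0LessThan mult_ac)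
    finally show ?thesis .
  qed
  ultimately show ?thesis
    using that[of \<mu> v "\<lambda>i k. Q $$ (i, k)"] pos v(1) vB qA qB 
      \<open>ln (Determinant.det Bm) - ln (Determinant.det Am) = (\<Sum>k<n. ln (\<mu> k))\<close>
    unfolding Am_def Bm_def by blast
qed

section \<open>A lower bound for the affinity exponent, and continuity of the likelihood\<close>

text \<open>With \<open>S = A + B\<close> and \<open>D = B - A\<close> in the notation of \<open>whitening\<close>, the first factor on the right is the
squared Frobenius norm of \<open>S\<^sup>-\<^sup>1\<^sup>/\<^sup>2 D S\<^sup>-\<^sup>1\<^sup>/\<^sup>2\<close>.  The inequality is the Cauchy-Schwarz inequality for the pairing of
this matrix with \<open>S\<^sup>1\<^sup>/\<^sup>2 T S\<^sup>1\<^sup>/\<^sup>2\<close>, whose squared norm is the trace of \<open>S T S T\<close> and hence at most the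
squared norm of \<open>S T\<close>.  Square roots of \<open>S\<close> are avoided by working with \<open>\<tau> = q\<^sup>T T q\<close>.\<close>

lemma frobenius_duality:
  fixes S D T q :: "nat \<Rightarrow> nat \<Rightarrow> real" and \<mu> :: "nat \<Rightarrow> real"
  assumes \<mu>: "\<And>k. k < n \<Longrightarrow> \<mu> k > 0"
    and S: "\<And>i j. i < n \<Longrightarrow> j < n \<Longrightarrow> S i j = (\<Sum>k<n. (\<mu> k + 1) * q i k * q j k)"
    and D: "\<And>i j. i < n \<Longrightarrow> j < n \<Longrightarrow> D i j = (\<Sum>k<n. (\<mu> k - 1) * q i k * q j k)"
    and T: "\<And>i j. i < n \<Longrightarrow> j < n \<Longrightarrow> T i j = T j i"
  shows "(\<Sum>i<n. \<Sum>j<n. D i j * T i j)\<^sup>2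
    \<le> (\<Sum>k<n. ((\<mu> k - 1) / (\<mu> k + 1))\<^sup>2) * (\<Sum>i<n. \<Sum>j<n. (\<Sum>l<n. S i l * T l j)\<^sup>2)"
proof -
  define u where "u k j = (\<Sum>a<n. q a k * T a j)" for k j
  define \<tau> where "\<tau> k l = (\<Sum>j<n. u k j * q j l)" for k l
  define P where "P i j = (\<Sum>l<n. S i l * T l j)" for i j
  have DT: "(\<Sum>i<n. \<Sum>j<n. D i j * T i j) = (\<Sum>k<n. (\<mu> k - 1) * \<tau> k k)"
  proof -
    have "(\<Sum>i<n. \<Sum>j<n. D i j * T i j) = (\<Sum>i<n. \<Sum>j<n. \<Sum>k<n. (\<mu> k - 1) * (q i k * T i j * q j k))"
      by (intro sum.cong refl) (simp add: D sum_distrib_right sum_distrib_left mult_ac)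
    also have "\<dots> = (\<Sum>i<n. \<Sum>k<n. \<Sum>j<n. (\<mu> k - 1) * (q i k * T i j * q j k))"
      by (intro sum.cong refl sum.swap)
    also have "\<dots> = (\<Sum>k<n. \<Sum>i<n. \<Sum>j<n. (\<mu> k - 1) * (q i k * T i j * q j k))"
      by (rule sum.swap)
    also have "\<dots> = (\<Sum>k<n. \<Sum>j<n. \<Sum>i<n. (\<mu> k - 1) * (q i k * T i j * q j k))"
      by (intro sum.cong refl sum.swap)
    also have "\<dots> = (\<Sum>k<n. (\<mu> k - 1) * \<tau> k k)"
      by (simp add: \<tau>_def u_def sum_distrib_left sum_distrib_right mult_ac)
    finally show ?thesis .
  qed
  have P: "P i j = (\<Sum>k<n. (\<mu> k + 1) * q i k * u k j)" if "i < n" for i j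
  proof -
    have "P i j = (\<Sum>l<n. \<Sum>k<n. (\<mu> k + 1) * q i k * (q l k * T l j))"
      unfolding P_def using that by (intro sum.cong refl) (simp add: S sum_distrib_right sum_distrib_left mult_ac)
    also have "\<dots> = (\<Sum>k<n. \<Sum>l<n. (\<mu> k + 1) * q i k * (q l k * T l j))" by (rule sum.swap)
    finally show ?thesis by (simp add: u_def sum_distrib_left)
  qed
  have \<tau>_sym: "\<tau> l k = \<tau> k l" for k l
  proof -
    have "\<tau> l k = (\<Sum>j<n. \<Sum>a<n. q a l * T a j * q j k)"
      by (simp add: \<tau>_def u_def sum_distrib_right)
    also have "\<dots> = (\<Sum>a<n. \<Sum>j<n. q a l * T a j * q j k)" by (rule sum.swap)
    also have "\<dots> = (\<Sum>a<n. \<Sum>j<n. q j k * T j a * q a l)"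
      by (intro sum.cong refl) (simp add: T)
    also have "\<dots> = \<tau> k l" by (simp add: \<tau>_def u_def sum_distrib_right)
    finally show ?thesis .
  qed
  \<comment> \<open>The trace of \<open>S T S T\<close> in the basis \<open>q\<close>; only its diagonal terms are kept afterwards.\<close>
  have PP: "(\<Sum>i<n. \<Sum>j<n. P i j * P j i) = (\<Sum>k<n. \<Sum>l<n. (\<mu> k + 1) * (\<mu> l + 1) * (\<tau> k l)\<^sup>2)"
  proof -
    let ?h = "\<lambda>i j k l. (\<mu> k + 1) * (\<mu> l + 1) * ((u k j * q j l) * (u l i * q i k))"
    have "(\<Sum>i<n. \<Sum>j<n. P i j * P j i) = (\<Sum>i<n. \<Sum>j<n. \<Sum>k<n. \<Sum>l<n. ?h i j k l)"
      by (intro sum.cong refl) (simp add: P sum_product mult_ac)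
    also have "\<dots> = (\<Sum>i<n. \<Sum>k<n. \<Sum>l<n. \<Sum>j<n. ?h i j k l)"
    proof (rule sum.cong[OF refl])
      fix i
      have "(\<Sum>j<n. \<Sum>k<n. \<Sum>l<n. ?h i j k l) = (\<Sum>k<n. \<Sum>j<n. \<Sum>l<n. ?h i j k l)" by (rule sum.swap)
      also have "\<dots> = (\<Sum>k<n. \<Sum>l<n. \<Sum>j<n. ?h i j k l)" by (intro sum.cong refl sum.swap)
      finally show "(\<Sum>j<n. \<Sum>k<n. \<Sum>l<n. ?h i j k l) = (\<Sum>k<n. \<Sum>l<n. \<Sum>j<n. ?h i j k l)" .
    qed
    also have "\<dots> = (\<Sum>k<n. \<Sum>i<n. \<Sum>l<n. \<Sum>j<n. ?h i j k l)" by (rule sum.swap)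
    also have "\<dots> = (\<Sum>k<n. \<Sum>l<n. \<Sum>i<n. \<Sum>j<n. ?h i j k l)" by (intro sum.cong refl sum.swap)
    also have "\<dots> = (\<Sum>k<n. \<Sum>l<n. (\<mu> k + 1) * (\<mu> l + 1) * (\<tau> k l * \<tau> l k))"
    proof (intro sum.cong refl)
      fix k l
      have "\<tau> k l * \<tau> l k = (\<Sum>j<n. \<Sum>i<n. (u k j * q j l) * (u l i * q i k))"
        unfolding \<tau>_def by (rule sum_product)
      also have "\<dots> = (\<Sum>i<n. \<Sum>j<n. (u k j * q j l) * (u l i * q i k))" by (rule sum.swap)
      finally show "(\<Sum>i<n. \<Sum>j<n. ?h i j k l) = (\<mu> k + 1) * (\<mu> l + 1) * (\<tau> k l * \<tau> l k)"
        by (simp add: sum_distrib_left)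
    qed
    finally show ?thesis by (simp add: \<tau>_sym power2_eq_square)
  qed
  have "(\<Sum>k<n. ((\<mu> k + 1) * \<tau> k k)\<^sup>2) \<le> (\<Sum>k<n. \<Sum>l<n. (\<mu> k + 1) * (\<mu> l + 1) * (\<tau> k l)\<^sup>2)"
  proof (intro sum_mono)
    fix k assume k: "k \<in> {..<n}"
    have "((\<mu> k + 1) * \<tau> k k)\<^sup>2 = (\<mu> k + 1) * (\<mu> k + 1) * (\<tau> k k)\<^sup>2"
      by (simp add: power2_eq_square mult_ac)
    also have "\<dots> \<le> (\<Sum>l<n. (\<mu> k + 1) * (\<mu> l + 1) * (\<tau> k l)\<^sup>2)"
      using k \<mu> by (intro member_le_sum[of k "{..<n}" "\<lambda>l. (\<mu> k + 1) * (\<mu> l + 1) * (\<tau> k l)\<^sup>2"]) 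
        (auto intro!: mult_nonneg_nonneg add_nonneg_nonneg simp: less_imp_le)
    finally show "((\<mu> k + 1) * \<tau> k k)\<^sup>2 \<le> (\<Sum>l<n. (\<mu> k + 1) * (\<mu> l + 1) * (\<tau> k l)\<^sup>2)" .
  qed
  also have "\<dots> = (\<Sum>i<n. \<Sum>j<n. P i j * P j i)" by (rule PP[symmetric])
  also have "\<dots> \<le> (\<Sum>i<n. \<Sum>j<n. ((P i j)\<^sup>2 + (P j i)\<^sup>2) / 2)"
  proof (intro sum_mono)
    fix i j show "P i j * P j i \<le> ((P i j)\<^sup>2 + (P j i)\<^sup>2) / 2"
      using sum_squares_bound[of "P i j" "P j i"] by simp
  qed
  also have "\<dots> = (\<Sum>i<n. \<Sum>j<n. (P i j)\<^sup>2 / 2) + (\<Sum>i<n. \<Sum>j<n. (P j i)\<^sup>2 / 2)"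
    by (simp add: add_divide_distrib sum.distrib)
  also have "(\<Sum>i<n. \<Sum>j<n. (P j i)\<^sup>2 / 2) = (\<Sum>i<n. \<Sum>j<n. (P i j)\<^sup>2 / 2)" by (rule sum.swap)
  also have "(\<Sum>i<n. \<Sum>j<n. (P i j)\<^sup>2 / 2) + (\<Sum>i<n. \<Sum>j<n. (P i j)\<^sup>2 / 2) = (\<Sum>i<n. \<Sum>j<n. (P i j)\<^sup>2)"
    by (simp flip: sum.distrib)
  finally have \<tau>P: "(\<Sum>k<n. ((\<mu> k + 1) * \<tau> k k)\<^sup>2) \<le> (\<Sum>i<n. \<Sum>j<n. (P i j)\<^sup>2)" .
  have "(\<Sum>k<n. (\<mu> k - 1) * \<tau> k k) = (\<Sum>k<n. ((\<mu> k - 1) / (\<mu> k + 1)) * ((\<mu> k + 1) * \<tau> k k))"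
  proof (intro sum.cong refl)
    fix k assume "k \<in> {..<n}"
    then have "\<mu> k + 1 \<noteq> 0" using \<mu>[of k] by auto
    then show "(\<mu> k - 1) * \<tau> k k = ((\<mu> k - 1) / (\<mu> k + 1)) * ((\<mu> k + 1) * \<tau> k k)" by simp
  qed
  then have "(\<Sum>i<n. \<Sum>j<n. D i j * T i j)\<^sup>2
      \<le> (\<Sum>k<n. ((\<mu> k - 1) / (\<mu> k + 1))\<^sup>2) * (\<Sum>k<n. ((\<mu> k + 1) * \<tau> k k)\<^sup>2)"
    unfolding DT by (simp only: Cauchy_Schwarz_ineq_sum)
  also have "\<dots> \<le> (\<Sum>k<n. ((\<mu> k - 1) / (\<mu> k + 1))\<^sup>2) * (\<Sum>i<n. \<Sum>j<n. (P i j)\<^sup>2)"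
    using \<tau>P by (intro mult_left_mono sum_nonneg) auto
  finally show ?thesis by (simp add: P_def)
qed

text \<open>For symmetric \<open>T\<close> the largest row sum of absolute values bounds the operator norm (Schur's test).\<close>

lemma frobenius_mult_row_sum:
  fixes S T :: "nat \<Rightarrow> nat \<Rightarrow> real"
  assumes row: "\<And>l. l < n \<Longrightarrow> (\<Sum>j<n. \<bar>T l j\<bar>) \<le> r" and T: "\<And>i j. i < n \<Longrightarrow> j < n \<Longrightarrow> T i j = T j i"
  shows "(\<Sum>i<n. \<Sum>j<n. (\<Sum>l<n. S i l * T l j)\<^sup>2) \<le> r\<^sup>2 * (\<Sum>i<n. \<Sum>j<n. (S i j)\<^sup>2)"
proof (cases "n = 0")
  case False
  have r: "r \<ge> 0" using row[of 0] False by (smt (verit) gr0I sum_nonneg abs_ge_zero)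
  have "(\<Sum>j<n. (\<Sum>l<n. S i l * T l j)\<^sup>2) \<le> r\<^sup>2 * (\<Sum>l<n. (S i l)\<^sup>2)" for i
  proof -
    have "(\<Sum>l<n. S i l * T l j)\<^sup>2 \<le> r * (\<Sum>l<n. (S i l)\<^sup>2 * \<bar>T l j\<bar>)" if j: "j < n" for j
    proof -
      have "(\<Sum>l<n. S i l * T l j) = (\<Sum>l<n. (sgn (T l j) * sqrt \<bar>T l j\<bar>) * (S i l * sqrt \<bar>T l j\<bar>))"
        by (intro sum.cong refl) (simp add: mult.assoc sgn_mult_abs mult.left_commute[of _ "S i _"])
      then have "(\<Sum>l<n. S i l * T l j)\<^sup>2
          \<le> (\<Sum>l<n. (sgn (T l j) * sqrt \<bar>T l j\<bar>)\<^sup>2) * (\<Sum>l<n. (S i l * sqrt \<bar>T l j\<bar>)\<^sup>2)"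
        by (simp only: Cauchy_Schwarz_ineq_sum)
      also have "(\<Sum>l<n. (sgn (T l j) * sqrt \<bar>T l j\<bar>)\<^sup>2) = (\<Sum>l<n. \<bar>T j l\<bar>)"
        using j by (intro sum.cong refl) (auto simp: power_mult_distrib sgn_if T)
      also have "(\<Sum>l<n. (S i l * sqrt \<bar>T l j\<bar>)\<^sup>2) = (\<Sum>l<n. (S i l)\<^sup>2 * \<bar>T l j\<bar>)"
        by (simp add: power_mult_distrib)
      also have "(\<Sum>l<n. \<bar>T j l\<bar>) * (\<Sum>l<n. (S i l)\<^sup>2 * \<bar>T l j\<bar>) \<le> r * (\<Sum>l<n. (S i l)\<^sup>2 * \<bar>T l j\<bar>)"
        using row[OF j] by (intro mult_right_mono sum_nonneg) auto
      finally show ?thesis .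
    qed
    then have "(\<Sum>j<n. (\<Sum>l<n. S i l * T l j)\<^sup>2) \<le> (\<Sum>j<n. r * (\<Sum>l<n. (S i l)\<^sup>2 * \<bar>T l j\<bar>))"
      by (intro sum_mono) auto
    also have "\<dots> = r * (\<Sum>l<n. (S i l)\<^sup>2 * (\<Sum>j<n. \<bar>T l j\<bar>))"
      unfolding sum_distrib_left[symmetric] by (subst sum.swap) (simp add: sum_distrib_left)
    also have "\<dots> \<le> r * (\<Sum>l<n. (S i l)\<^sup>2 * r)"
      using row r by (intro mult_left_mono sum_mono) auto
    also have "\<dots> = r\<^sup>2 * (\<Sum>l<n. (S i l)\<^sup>2)"
      by (simp add: power2_eq_square sum_distrib_left mult_ac)
    finally show ?thesis .
  qed
  then have "(\<Sum>i<n. \<Sum>j<n. (\<Sum>l<n. S i l * T l j)\<^sup>2) \<le> (\<Sum>i<n. r\<^sup>2 * (\<Sum>l<n. (S i l)\<^sup>2))"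
    by (rule sum_mono)
  then show ?thesis by (simp only: sum_distrib_left)
qed simp

text \<open>\<open>frobenius_duality\<close> for \<open>T\<close> equal to \<open>B - A\<close> restricted to the pairs of near indices: the pairing of
\<open>B - A\<close> with \<open>T\<close> is then the part of its squared norm that the far pairs do not carry.\<close>

lemma affinity_exponent_lower_bound:
  fixes A B q :: "nat \<Rightarrow> nat \<Rightarrow> real" and \<mu> :: "nat \<Rightarrow> real" and near :: "nat \<Rightarrow> nat \<Rightarrow> bool"
  assumes \<mu>: "\<And>k. k < n \<Longrightarrow> \<mu> k > 0"
    and A: "\<And>i j. i < n \<Longrightarrow> j < n \<Longrightarrow> A i j = (\<Sum>k<n. q i k * q j k)"
    and B: "\<And>i j. i < n \<Longrightarrow> j < n \<Longrightarrow> B i j = (\<Sum>k<n. \<mu> k * q i k * q j k)"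
    and near: "\<And>i j. near i j \<longleftrightarrow> near j i"
    and diff: "\<delta> * real n \<le> (\<Sum>i<n. \<Sum>j<n. (B i j - A i j)\<^sup>2)"
    and far: "(\<Sum>i<n. \<Sum>j<n. if near i j then 0 else (B i j - A i j)\<^sup>2) \<le> \<delta> / 2 * real n"
    and row: "\<And>i. i < n \<Longrightarrow> (\<Sum>j<n. if near i j then \<bar>B i j - A i j\<bar> else 0) \<le> r"
    and frob: "(\<Sum>i<n. \<Sum>j<n. (A i j + B i j)\<^sup>2) \<le> \<beta> * real n"
    and pos: "\<delta> > 0" "r > 0" "\<beta> > 0"
  shows "\<delta>\<^sup>2 / (4 * r\<^sup>2 * \<beta>) * real n \<le> (\<Sum>k<n. ((\<mu> k - 1) / (\<mu> k + 1))\<^sup>2)"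
proof (cases "n = 0")
  case False
  define T where "T i j = (if near i j then B i j - A i j else 0)" for i j
  define m where "m = (\<Sum>k<n. ((\<mu> k - 1) / (\<mu> k + 1))\<^sup>2)"
  have symA: "A i j = A j i" and symB: "B i j = B j i" if "i < n" "j < n" for i j
    using that by (simp_all add: A B mult_ac)
  have symT: "T i j = T j i" if "i < n" "j < n" for i j
    using that near symA[OF that] symB[OF that] by (simp add: T_def)
  have "(\<Sum>i<n. \<Sum>j<n. (B i j - A i j)\<^sup>2) = (\<Sum>i<n. \<Sum>j<n. (B i j - A i j) * T i j) +
      (\<Sum>i<n. \<Sum>j<n. if near i j then 0 else (B i j - A i j)\<^sup>2)"
    unfolding sum.distrib[symmetric] by (intro sum.cong refl) (simp add: T_def power2_eq_square)
  then have "\<delta> / 2 * real n \<le> (\<Sum>i<n. \<Sum>j<n. (B i j - A i j) * T i j)" using diff far by linarith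
  then have "(\<delta> / 2 * real n)\<^sup>2 \<le> (\<Sum>i<n. \<Sum>j<n. (B i j - A i j) * T i j)\<^sup>2"
    using pos by (intro power_mono) auto
  also have "\<dots> \<le> m * (\<Sum>i<n. \<Sum>j<n. (\<Sum>l<n. (A i l + B i l) * T l j)\<^sup>2)"
    unfolding m_def
    by (rule frobenius_duality[OF \<mu> _ _ symT])
      (simp_all add: A B sum.distrib sum_subtractf algebra_simps)
  also have "\<dots> \<le> m * (r\<^sup>2 * (\<Sum>i<n. \<Sum>j<n. (A i j + B i j)\<^sup>2))"
  proof (intro mult_left_mono frobenius_mult_row_sum symT)
    fix l assume "l < n"
    have "(\<Sum>j<n. \<bar>T l j\<bar>) = (\<Sum>j<n. if near l j then \<bar>B l j - A l j\<bar> else 0)"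
      by (intro sum.cong refl) (simp add: T_def)
    then show "(\<Sum>j<n. \<bar>T l j\<bar>) \<le> r" using row[OF \<open>l < n\<close>] by simp
  qed (auto simp: m_def intro!: sum_nonneg)
  also have "\<dots> \<le> m * (r\<^sup>2 * (\<beta> * real n))"
    using frob by (intro mult_left_mono) (auto simp: m_def intro!: sum_nonneg)
  finally have "(\<delta>\<^sup>2 / 4 * real n) * real n \<le> (m * r\<^sup>2 * \<beta>) * real n"
    by (simp add: power2_eq_square algebra_simps)
  then have "\<delta>\<^sup>2 / 4 * real n \<le> m * r\<^sup>2 * \<beta>" using False by simp
  then show ?thesis using pos unfolding m_def[symmetric] by (simp add: field_simps)
qed (simp add: sum_nonneg)

text \<open>The left-hand side is the value at \<open>y\<close> of the quadratic form of the inverse of \<open>A\<close>, whose eigenvalues are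
at most \<open>1 / c\<close>.\<close>

lemma whitened_norm_le:
  assumes A: "coercive n c A"
    and p: "\<And>k l. k < n \<Longrightarrow> l < n \<Longrightarrow> bform n A (p k) (p l) = (if k = l then 1 else 0)"
  shows "(\<Sum>k<n. (\<Sum>i<n. p k i * y i)\<^sup>2) \<le> (\<Sum>i<n. (y i)\<^sup>2) / c"
proof -
  define z where "z k = (\<Sum>i<n. p k i * y i)" for k
  define x where "x i = (\<Sum>k<n. z k * p k i)" for i
  define Z where "Z = (\<Sum>k<n. (z k)\<^sup>2)"
  have c: "c > 0" using A by (simp add: coercive_def)
  have Z0: "Z \<ge> 0" by (auto simp: Z_def intro!: sum_nonneg)
  have "bform n A w x = (\<Sum>k<n. z k * bform n A w (p k))" for w
    unfolding x_def by (rule bform_sum_right) simp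
  then have "bform n A x x = (\<Sum>k<n. z k * bform n A x (p k))" .
  also have "\<dots> = (\<Sum>k<n. z k * z k)"
  proof (intro sum.cong refl arg_cong[where f="(*) _"])
    fix k assume k: "k \<in> {..<n}"
    have "bform n A x (p k) = (\<Sum>l<n. z l * bform n A (p l) (p k))"
      unfolding x_def by (rule bform_sum_left) simp
    also have "\<dots> = (\<Sum>l<n. if l = k then z k else 0)"
      using p k by (intro sum.cong refl) auto
    finally show "bform n A x (p k) = z k" using k by simp
  qed
  finally have "bform n A x x = Z" by (simp add: Z_def power2_eq_square)
  then have x: "c * (\<Sum>i<n. (x i)\<^sup>2) \<le> Z" using A by (auto simp: coercive_def)
  have "Z = (\<Sum>i<n. x i * y i)"
  proof -
    have "Z = (\<Sum>k<n. \<Sum>i<n. z k * p k i * y i)"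
      by (simp add: Z_def power2_eq_square z_def sum_distrib_left mult.assoc)
    also have "\<dots> = (\<Sum>i<n. \<Sum>k<n. z k * p k i * y i)" by (rule sum.swap)
    finally show ?thesis by (simp add: x_def sum_distrib_right)
  qed
  then have "Z\<^sup>2 \<le> (\<Sum>i<n. (x i)\<^sup>2) * (\<Sum>i<n. (y i)\<^sup>2)" by (simp only: Cauchy_Schwarz_ineq_sum)
  also have "\<dots> \<le> (Z / c) * (\<Sum>i<n. (y i)\<^sup>2)"
    using x c by (intro mult_right_mono sum_nonneg) (auto simp: field_simps)
  finally have "Z * Z \<le> Z * ((\<Sum>i<n. (y i)\<^sup>2) / c)" by (simp add: power2_eq_square)
  then have "Z \<le> (\<Sum>i<n. (y i)\<^sup>2) / c"
    using Z0 c mult_left_le_imp_le[of Z Z] by (cases "Z = 0") (auto simp: sum_nonneg simp del: times_divide_eq_right)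
  then show ?thesis by (simp add: Z_def z_def)
qed

text \<open>If the entries of \<open>A\<close> and \<open>B\<close> differ by at most \<open>m\<close>, then each \<open>\<mu>\<^sub>k - 1\<close>, being the value of \<open>B - A\<close> at
an \<open>A\<close>-unit vector, is at most \<open>\<kappa>\<close> in absolute value.  So the likelihood changes little on
observations of controlled length.\<close>

lemma likelihood_increment_lower_bound:
  assumes A: "coercive n c A"
    and \<mu>: "\<And>k. k < n \<Longrightarrow> \<mu> k > 0"
    and p: "\<And>k l. k < n \<Longrightarrow> l < n \<Longrightarrow> bform n A (p k) (p l) = (if k = l then 1 else 0)"
    and pB: "\<And>k l. k < n \<Longrightarrow> l < n \<Longrightarrow> bform n B (p k) (p l) = (if k = l then \<mu> k else 0)"
    and close: "\<And>i j. i < n \<Longrightarrow> j < n \<Longrightarrow> \<bar>B i j - A i j\<bar> \<le> m"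
    and \<kappa>: "m * real n / c \<le> \<kappa>" "\<kappa> \<le> 1 / 2"
  shows "- 2 * \<kappa> * (real n + (\<Sum>i<n. (y i)\<^sup>2) / c)
    \<le> (\<Sum>k<n. ln (\<mu> k) + (\<Sum>i<n. p k i * y i)\<^sup>2 * (1 / \<mu> k - 1))"
proof (cases "n = 0")
  case False
  have c: "c > 0" using A by (simp add: coercive_def)
  have m: "m \<ge> 0" using close[of 0 0] False by (smt (verit) gr0I abs_ge_zero)
  have \<kappa>0: "\<kappa> \<ge> 0" using \<kappa>(1) m c by (smt (verit) divide_nonneg_pos mult_nonneg_nonneg of_nat_0_le_iff)
  have dev: "\<bar>\<mu> k - 1\<bar> \<le> \<kappa>" if k: "k < n" for k
  proof -
    have "\<mu> k - 1 = (\<Sum>i<n. \<Sum>j<n. (B i j - A i j) * p k i * p k j)"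
      using p[OF k k] pB[OF k k] by (simp add: bform_def sum_subtractf left_diff_distrib)
    also have "\<bar>\<dots>\<bar> \<le> (\<Sum>i<n. \<Sum>j<n. \<bar>(B i j - A i j) * p k i * p k j\<bar>)"
      by (rule order_trans[OF sum_abs sum_mono[OF sum_abs]])
    also have "\<dots> \<le> (\<Sum>i<n. \<Sum>j<n. m * (\<bar>p k i\<bar> * \<bar>p k j\<bar>))"
      using close by (intro sum_mono) (auto simp: abs_mult mult.assoc intro!: mult_right_mono)
    also have "\<dots> = m * (\<Sum>i<n. 1 * \<bar>p k i\<bar>)\<^sup>2"
      unfolding power2_eq_square sum_product mult_1 by (simp only: sum_distrib_left)
    also have "\<dots> \<le> m * ((\<Sum>i<n. 1\<^sup>2) * (\<Sum>i<n. \<bar>p k i\<bar>\<^sup>2))"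
      using m by (intro mult_left_mono Cauchy_Schwarz_ineq_sum)
    also have "\<dots> = m * (real n * (\<Sum>i<n. (p k i)\<^sup>2))" by simp
    also have "\<dots> \<le> m * (real n * (1 / c))"
    proof (intro mult_left_mono m)
      have "c * (\<Sum>i<n. (p k i)\<^sup>2) \<le> bform n A (p k) (p k)" using A by (simp add: coercive_def)
      then show "(\<Sum>i<n. (p k i)\<^sup>2) \<le> 1 / c" using c p[OF k k] by (simp add: field_simps)
    qed simp
    also have "\<dots> \<le> \<kappa>" using \<kappa>(1) by simp
    finally show ?thesis .
  qed
  have inv: "1 / \<mu> k - 1 \<ge> - 2 * \<kappa>" "ln (\<mu> k) \<ge> - 2 * \<kappa>" if k: "k < n" for k
  proof -
    have half: "\<mu> k \<ge> 1 / 2" using dev[OF k] \<kappa>(2) by linarith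
    have "\<bar>1 / \<mu> k - 1\<bar> = \<bar>\<mu> k - 1\<bar> / \<mu> k"
    proof -
      have "1 / \<mu> k - 1 = - ((\<mu> k - 1) / \<mu> k)" using \<mu>[OF k] by (simp add: diff_divide_distrib)
      then show ?thesis using \<mu>[OF k] by (simp only: abs_minus_cancel abs_divide abs_of_pos)
    qed
    also have "\<dots> \<le> \<kappa> / (1 / 2)"
      using dev[OF k] half \<kappa>0 by (intro frac_le) auto
    finally have b: "\<bar>1 / \<mu> k - 1\<bar> \<le> 2 * \<kappa>" by simp
    then show "1 / \<mu> k - 1 \<ge> - 2 * \<kappa>" by linarith
    have "ln (1 / \<mu> k) \<le> 1 / \<mu> k - 1" using \<mu>[OF k] by (intro ln_le_minus_one) simp
    then show "ln (\<mu> k) \<ge> - 2 * \<kappa>" using b \<mu>[OF k] by (simp add: ln_div)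
  qed
  define z2 where "z2 k = (\<Sum>i<n. p k i * y i)\<^sup>2" for k
  have z2: "(\<Sum>k<n. z2 k) \<le> (\<Sum>i<n. (y i)\<^sup>2) / c" unfolding z2_def by (rule whitened_norm_le[OF A p])
  have "- 2 * \<kappa> * (real n + (\<Sum>i<n. (y i)\<^sup>2) / c) \<le> - 2 * \<kappa> * (real n + (\<Sum>k<n. z2 k))"
    using z2 \<kappa>0 by (intro mult_left_mono_neg) auto
  also have "\<dots> = (\<Sum>k<n. - 2 * \<kappa> + z2 k * (- 2 * \<kappa>))"
    unfolding sum.distrib sum_distrib_right[symmetric] by (simp add: algebra_simps)
  also have "\<dots> \<le> (\<Sum>k<n. ln (\<mu> k) + z2 k * (1 / \<mu> k - 1))"
    using inv by (intro sum_mono add_mono mult_left_mono) (auto simp: z2_def)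
  finally show ?thesis by (simp add: z2_def)
qed simp

section \<open>Gaussian integrals from one-dimensional projections\<close>

lemma cos_iexp: "of_real (cos x) = (iexp x + iexp (- x)) / 2"
  using cos_exp_eq[of "of_real x :: complex"] by (simp add: cos_of_real)

lemma iexp_add: "iexp (x + y) = iexp x * iexp y"
  by (simp add: distrib_left exp_add)

text \<open>Under the probability measure with density proportional to \<open>W\<close>, the variable \<open>z\<close> has the standard
normal characteristic function; hence it is standard normal, and integrals of \<open>\<phi>\<close> can be computed
for every integrable \<open>\<phi>\<close>, bounded or not.\<close>

lemma (in prob_space) weighted_std_normal_integral:
  fixes W z :: "'a \<Rightarrow> real" and \<phi> :: "real \<Rightarrow> real"
  assumes W: "integrable M W" "\<And>\<omega>. W \<omega> \<ge> 0" and z[measurable]: "z \<in> borel_measurable M"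
    and cf: "\<And>s. (CLINT \<omega>|M. of_real (W \<omega>) * iexp (s * z \<omega>)) = of_real (m * exp (- s\<^sup>2 / 2))"
    and \<phi>: "integrable std_normal_distribution \<phi>"
  shows "integrable M (\<lambda>\<omega>. W \<omega> * \<phi> (z \<omega>))"
    and "(LINT \<omega>|M. W \<omega> * \<phi> (z \<omega>)) = m * (LINT x|std_normal_distribution. \<phi> x)"
proof -
  have [measurable]: "W \<in> borel_measurable M" "\<phi> \<in> borel_measurable borel" 
    using borel_measurable_integrable[OF W(1)] borel_measurable_integrable[OF \<phi>] by simp_all
  have "of_real (LINT \<omega>|M. W \<omega>) = (CLINT \<omega>|M. of_real (W \<omega>) * iexp (0 * z \<omega>))"
    by (simp add: integral_complex_of_real)
  then have m: "(LINT \<omega>|M. W \<omega>) = m" unfolding cf by (simp only: of_real_eq_iff) simp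
  moreover have "(LINT \<omega>|M. W \<omega>) \<ge> 0" by (simp add: W(2))
  ultimately have "m \<ge> 0" by simp
  then consider "m = 0" | "m > 0" by linarith
  then have "integrable M (\<lambda>\<omega>. W \<omega> * \<phi> (z \<omega>)) \<and>
    (LINT \<omega>|M. W \<omega> * \<phi> (z \<omega>)) = m * (LINT x|std_normal_distribution. \<phi> x)"
  proof cases
    case 1
    then have "AE \<omega> in M. W \<omega> = 0"
      using integral_nonneg_eq_0_iff_AE[OF W(1)] W(2) m by simp
    then have "AE \<omega> in M. W \<omega> * \<phi> (z \<omega>) = 0" by auto
    then show ?thesis using 1 
      by (simp add: integral_eq_zero_AE integrable_cong_AE[where g="\<lambda>_. 0"])
  next
    case 2
    define N where "N = density M (\<lambda>\<omega>. ennreal (W \<omega> / m))"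
    have [simp]: "sets N = sets M" "space N = space M" by (simp_all add: N_def)
    have [measurable]: "z \<in> borel_measurable N" using z unfolding N_def by simp
    have "emeasure N (space N) = ennreal (LINT \<omega>|M. W \<omega> / m)"
      unfolding N_def using W 2
      by (subst nn_integral_eq_integral[symmetric]) (auto simp: emeasure_density intro!: nn_integral_cong)
    also have "\<dots> = 1" using m 2 by simp
    finally have pN: "prob_space N" by (rule prob_spaceI)
    then interpret N: prob_space N .
    have "char (distr N borel z) s = char std_normal_distribution s" for s
    proof -
      have "char (distr N borel z) s = (CLINT \<omega>|N. iexp (s * z \<omega>))"
        unfolding char_def by (subst integral_distr) auto
      also have "\<dots> = (CLINT \<omega>|M. (W \<omega> / m) *\<^sub>R iexp (s * z \<omega>))"
        unfolding N_def using W(2) 2 by (subst integral_density) auto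
      also have "\<dots> = (CLINT \<omega>|M. of_real (1 / m) * (of_real (W \<omega>) * iexp (s * z \<omega>)))"
        by (simp add: scaleR_conv_of_real)
      also have "\<dots> = of_real (1 / m) * of_real (m * exp (- s\<^sup>2 / 2))"
        unfolding cf[symmetric] by simp
      also have "\<dots> = of_real (exp (- s\<^sup>2 / 2))" using 2 by simp
      finally show ?thesis by (simp add: char_std_normal_distribution)
    qed
    then have eq: "distr N borel z = std_normal_distribution"
      by (intro Levy_uniqueness N.real_distribution_distr real_dist_normal_dist) auto
    have i1: "integrable N (\<lambda>\<omega>. \<phi> (z \<omega>))"
      using \<phi> unfolding eq[symmetric] by (subst (asm) integrable_distr_eq) auto
    have "(LINT \<omega>|N. \<phi> (z \<omega>)) = (LINT x|std_normal_distribution. \<phi> x)"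
      unfolding eq[symmetric] by (subst integral_distr) auto
    moreover have "(LINT \<omega>|N. \<phi> (z \<omega>)) = (LINT \<omega>|M. (W \<omega> / m) *\<^sub>R \<phi> (z \<omega>))"
      unfolding N_def using W(2) 2 by (subst integral_density) auto
    moreover have i2: "integrable M (\<lambda>\<omega>. (W \<omega> / m) *\<^sub>R \<phi> (z \<omega>))"
      using i1 unfolding N_def using W(2) 2 by (subst (asm) integrable_density) auto
    moreover have "(\<lambda>\<omega>. W \<omega> * \<phi> (z \<omega>)) = (\<lambda>\<omega>. m * ((W \<omega> / m) *\<^sub>R \<phi> (z \<omega>)))"
      using 2 by auto
    ultimately show ?thesis by (simp only: integral_mult_right_zero integrable_mult_right)
  qed
  then show "integrable M (\<lambda>\<omega>. W \<omega> * \<phi> (z \<omega>))"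
    and "(LINT \<omega>|M. W \<omega> * \<phi> (z \<omega>)) = m * (LINT x|std_normal_distribution. \<phi> x)" by auto
qed

text \<open>A form of the statement that jointly Gaussian, uncorrelated variables are independent.  The
assumption \<open>cf\<close> speaks of the linear combinations of the \<open>z k\<close>, which is all that the definition of a Gaussian
process gives.  The functions \<open>\<phi> k\<close> are introduced one at a time.  The weights to which
\<open>weighted_std_normal_integral\<close> applies have to be nonnegative, hence the weights \<open>W (1 + cos (T + a))\<close>,
where \<open>T\<close> is a linear combination of the remaining variables; the cases \<open>a = 0\<close> and \<open>a = - \<pi> / 2\<close> give
the real and the imaginary part of the expectation of \<open>W\<close> times \<open>\<phi> k (z k)\<close> times \<open>iexp T\<close>.\<close>

lemma (in prob_space) std_normal_product_expectation:
  fixes z :: "'i \<Rightarrow> 'a \<Rightarrow> real" and \<phi> :: "'i \<Rightarrow> real \<Rightarrow> real"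
  assumes I: "finite I" and z: "\<And>k. k \<in> I \<Longrightarrow> z k \<in> borel_measurable M"
    and cf: "\<And>t. (CLINT \<omega>|M. iexp (\<Sum>k\<in>I. t k * z k \<omega>)) = of_real (exp (- (\<Sum>k\<in>I. (t k)\<^sup>2) / 2))"
    and \<phi>: "\<And>k. k \<in> I \<Longrightarrow> integrable std_normal_distribution (\<phi> k)" "\<And>k x. \<phi> k x \<ge> 0"
  shows "integrable M (\<lambda>\<omega>. \<Prod>k\<in>I. \<phi> k (z k \<omega>))"
    and "(LINT \<omega>|M. (\<Prod>k\<in>I. \<phi> k (z k \<omega>))) = (\<Prod>k\<in>I. LINT x|std_normal_distribution. \<phi> k x)"
proof -
  let ?E = "\<lambda>k. LINT x|std_normal_distribution. \<phi> k x"
  have claim: "integrable M (\<lambda>\<omega>. \<Prod>k\<in>J. \<phi> k (z k \<omega>)) \<and>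
    (\<forall>t. (\<forall>k\<in>J. t k = 0) \<longrightarrow>
      (CLINT \<omega>|M. of_real (\<Prod>k\<in>J. \<phi> k (z k \<omega>)) * iexp (\<Sum>k\<in>I. t k * z k \<omega>))
       = of_real ((\<Prod>k\<in>J. ?E k) * exp (- (\<Sum>k\<in>I. (t k)\<^sup>2) / 2)))" if "J \<subseteq> I" for J
    using finite_subset[OF that I] that
  proof (induction J rule: finite_induct)
    case empty
    show ?case using cf by simp
  next
    case (insert k J)
    define W where "W \<omega> = (\<Prod>j\<in>J. \<phi> j (z j \<omega>))" for \<omega>
    define m where "m = (\<Prod>j\<in>J. ?E j)"
    have k: "k \<in> I" using insert.prems by simp
    have W: "integrable M W" "\<And>\<omega>. W \<omega> \<ge> 0"
      using insert \<phi>(2) unfolding W_def by (auto intro!: prod_nonneg)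
    have IH: "(CLINT \<omega>|M. of_real (W \<omega>) * iexp (\<Sum>k\<in>I. t k * z k \<omega>))
        = of_real (m * exp (- (\<Sum>k\<in>I. (t k)\<^sup>2) / 2))" if "\<forall>k\<in>J. t k = 0" for t
      using insert that unfolding W_def m_def by auto
    note zk = z[OF k]
    have [measurable]: "W \<in> borel_measurable M" using W(1) by auto
    note [measurable] = z
    have upd: "(\<Sum>j\<in>I. (t(k := s)) j * z j \<omega>) = (\<Sum>j\<in>I. t j * z j \<omega>) + s * z k \<omega>"
      "(\<Sum>j\<in>I. ((t(k := s)) j)\<^sup>2) = (\<Sum>j\<in>I. (t j)\<^sup>2) + s\<^sup>2" if "t k = 0" for t s \<omega>
      using I k that by (simp_all add: sum.remove)
    \<comment> \<open>Adding \<open>z k\<close> with coefficient \<open>s\<close> to a linear combination that does not yet contain it.\<close>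
    have IH2: "(CLINT \<omega>|M. of_real (W \<omega>) * iexp ((\<Sum>j\<in>I. t j * z j \<omega>) + s * z k \<omega>))
        = of_real (m * (exp (- (\<Sum>j\<in>I. (t j)\<^sup>2) / 2) * exp (- s\<^sup>2 / 2)))"
      if "t k = 0" "\<forall>j\<in>J. t j = 0" for t s
    proof -
      have "- ((\<Sum>j\<in>I. (t j)\<^sup>2) + s\<^sup>2) / 2 = - (\<Sum>j\<in>I. (t j)\<^sup>2) / 2 + - s\<^sup>2 / 2" by (simp add: field_simps)
      moreover have "\<forall>j\<in>J. (t(k := s)) j = 0" using that(2) insert.hyps(2) by auto
      ultimately show ?thesis using IH[of "t(k := s)"] unfolding upd[of t, OF that(1)]
        by (simp only: exp_add)
    qed
    have base: "(CLINT \<omega>|M. of_real (W \<omega>) * iexp (s * z k \<omega>)) = of_real (m * exp (- s\<^sup>2 / 2))" for s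
      using IH2[of "\<lambda>_. 0" s] by simp
    note A = weighted_std_normal_integral[OF W zk base \<phi>(1)[OF k]]
    have cosine: "(LINT \<omega>|M. W \<omega> * \<phi> k (z k \<omega>) * cos ((\<Sum>j\<in>I. t j * z j \<omega>) + a))
       = m * ?E k * exp (- (\<Sum>j\<in>I. (t j)\<^sup>2) / 2) * cos a" if t: "\<forall>j\<in>insert k J. t j = 0" for t a
    proof -
      define T where "T \<omega> = (\<Sum>j\<in>I. t j * z j \<omega>)" for \<omega>
      define e where "e = exp (- (\<Sum>j\<in>I. (t j)\<^sup>2) / 2)"
      have [measurable]: "T \<in> borel_measurable M" unfolding T_def by (intro borel_measurable_sum) simp
      define W' where "W' \<omega> = W \<omega> * (1 + cos (T \<omega> + a))" for \<omega>
      have bound: "\<bar>1 + cos x\<bar> \<le> 2" "0 \<le> 1 + cos x" for x :: real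
        using cos_ge_minus_one[of x] cos_le_one[of x] by linarith+
      have W': "integrable M W'" "\<And>\<omega>. W' \<omega> \<ge> 0"
      proof -
        show "integrable M W'" unfolding W'_def
          by (rule Bochner_Integration.integrable_bound[OF integrable_mult_right[OF W(1), of 2]])
            (auto simp: abs_mult W(2) mult.commute[of 2] bound intro!: mult_left_mono)
        show "W' \<omega> \<ge> 0" for \<omega> using W(2) bound(2) by (simp add: W'_def)
      qed
      have int: "complex_integrable M (\<lambda>\<omega>. of_real (W \<omega>) * iexp (g \<omega>))"
        if [measurable]: "g \<in> borel_measurable M" for g
        by (rule Bochner_Integration.integrable_bound[OF W(1)]) (auto simp: norm_mult)
      have cf': "(CLINT \<omega>|M. of_real (W' \<omega>) * iexp (s * z k \<omega>)) = of_real ((m * (1 + e * cos a)) * exp (- s\<^sup>2 / 2))" for s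
      proof -
        have gen: "w * (1 + (p * q + r * s') / 2) * x = w * x + q / 2 * (w * (p * x)) + s' / 2 * (w * (r * x))"
          for w p q r s' x :: complex by (simp add: algebra_simps)
        have pt: "of_real (W' \<omega>) * iexp (s * z k \<omega>) = of_real (W \<omega>) * iexp (s * z k \<omega>) 
           + iexp a / 2 * (of_real (W \<omega>) * iexp (T \<omega> + s * z k \<omega>))
           + iexp (- a) / 2 * (of_real (W \<omega>) * iexp (- T \<omega> + s * z k \<omega>))" for \<omega>
        proof -
          have "of_real (W' \<omega>) = of_real (W \<omega>) * (1 + (iexp (T \<omega>) * iexp a + iexp (- T \<omega>) * iexp (- a)) / 2)"
            unfolding W'_def of_real_mult of_real_add[of 1] cos_iexp minus_add_distrib iexp_add by simp
          then show ?thesis unfolding iexp_add by (simp only: gen)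
        qed
        have c1: "(CLINT \<omega>|M. of_real (W \<omega>) * iexp (T \<omega> + s * z k \<omega>)) = of_real (m * (e * exp (- s\<^sup>2 / 2)))"
          using IH2[of t s] t unfolding T_def e_def by simp
        have c2: "(CLINT \<omega>|M. of_real (W \<omega>) * iexp (- T \<omega> + s * z k \<omega>)) = of_real (m * (e * exp (- s\<^sup>2 / 2)))"
        proof -
          have neg: "(\<Sum>j\<in>I. - t j * z j \<omega>) = - T \<omega>" for \<omega> by (simp add: T_def sum_negf)
          show ?thesis using IH2[of "\<lambda>j. - t j" s] t unfolding neg e_def by simp
        qed
        have c3: "iexp a / 2 + iexp (- a) / 2 = of_real (cos a)"
          unfolding cos_iexp by (simp add: add_divide_distrib)
        define g where "g r \<omega> = of_real (W \<omega>) * iexp (r * T \<omega> + s * z k \<omega>)" for r \<omega>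
        have gi: "complex_integrable M (g r)" for r
          unfolding g_def[abs_def] using zk by (intro int) simp
        have "g 0 = (\<lambda>\<omega>. of_real (W \<omega>) * iexp (s * z k \<omega>))"
          "g 1 = (\<lambda>\<omega>. of_real (W \<omega>) * iexp (T \<omega> + s * z k \<omega>))"
          "g (- 1) = (\<lambda>\<omega>. of_real (W \<omega>) * iexp (- T \<omega> + s * z k \<omega>))"
          unfolding g_def by simp_all
        then have g: "integral\<^sup>L M (g 0) = of_real (m * exp (- s\<^sup>2 / 2))"
          "integral\<^sup>L M (g 1) = of_real (m * (e * exp (- s\<^sup>2 / 2)))"
          "integral\<^sup>L M (g (- 1)) = of_real (m * (e * exp (- s\<^sup>2 / 2)))"
          by (simp_all only: c1 c2 base)
        have "(CLINT \<omega>|M. of_real (W' \<omega>) * iexp (s * z k \<omega>))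
            = (CLINT \<omega>|M. g 0 \<omega> + iexp a / 2 * g 1 \<omega> + iexp (- a) / 2 * g (- 1) \<omega>)"
          unfolding pt g_def by simp
        also have "\<dots> = integral\<^sup>L M (g 0) + iexp a / 2 * integral\<^sup>L M (g 1)
            + iexp (- a) / 2 * integral\<^sup>L M (g (- 1))"
          using gi by simp
        also have "\<dots> = of_real (m * exp (- s\<^sup>2 / 2)) + (iexp a / 2 + iexp (- a) / 2) * of_real (m * (e * exp (- s\<^sup>2 / 2)))"
          unfolding g by (simp only: distrib_right add.assoc)
        also have "\<dots> = of_real ((m * (1 + e * cos a)) * exp (- s\<^sup>2 / 2))"
          unfolding c3 by (simp add: algebra_simps)
        finally show ?thesis .
      qed
      note B = weighted_std_normal_integral[OF W' zk cf' \<phi>(1)[OF k]]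
      have "(\<lambda>\<omega>. W \<omega> * \<phi> k (z k \<omega>) * cos (T \<omega> + a)) = (\<lambda>\<omega>. W' \<omega> * \<phi> k (z k \<omega>) - W \<omega> * \<phi> k (z k \<omega>))"
        by (auto simp: W'_def algebra_simps)
      then have "(LINT \<omega>|M. W \<omega> * \<phi> k (z k \<omega>) * cos (T \<omega> + a))
          = m * (1 + e * cos a) * ?E k - m * ?E k"
        using A B by (simp only: Bochner_Integration.integral_diff)
      then show ?thesis by (simp add: T_def e_def algebra_simps)
    qed
    have "(CLINT \<omega>|M. of_real (\<Prod>k\<in>insert k J. \<phi> k (z k \<omega>)) * iexp (\<Sum>k\<in>I. t k * z k \<omega>))
       = of_real ((\<Prod>k\<in>insert k J. ?E k) * exp (- (\<Sum>k\<in>I. (t k)\<^sup>2) / 2))"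
      if t: "\<forall>j\<in>insert k J. t j = 0" for t
    proof -
      define T where "T \<omega> = (\<Sum>j\<in>I. t j * z j \<omega>)" for \<omega>
      define R where "R \<omega> = W \<omega> * \<phi> k (z k \<omega>)" for \<omega>
      have R: "integrable M R" using A(1) by (simp add: R_def[abs_def])
      have [measurable]: "T \<in> borel_measurable M" unfolding T_def by (intro borel_measurable_sum) simp
      have ci: "complex_integrable M (\<lambda>\<omega>. of_real (R \<omega>) * iexp (T \<omega>))"
        using R by (intro Bochner_Integration.integrable_bound[OF R]) (auto simp: norm_mult)
      have "Re (CLINT \<omega>|M. of_real (R \<omega>) * iexp (T \<omega>)) = (LINT \<omega>|M. R \<omega> * cos (T \<omega>))"
        using ci by (simp add: integral_Re[symmetric] Re_exp del: integral_Re)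
      moreover have "Im (CLINT \<omega>|M. of_real (R \<omega>) * iexp (T \<omega>)) = (LINT \<omega>|M. R \<omega> * sin (T \<omega>))"
        using ci by (simp add: integral_Im[symmetric] Im_exp del: integral_Im)
      moreover have "(LINT \<omega>|M. R \<omega> * cos (T \<omega>)) = m * ?E k * exp (- (\<Sum>j\<in>I. (t j)\<^sup>2) / 2)"
        using cosine[OF t, of 0] by (simp add: R_def T_def)
      moreover have "(LINT \<omega>|M. R \<omega> * sin (T \<omega>)) = 0"
        using cosine[OF t, of "- (pi / 2)"] by (simp add: R_def T_def cos_diff)
      ultimately have "(CLINT \<omega>|M. of_real (R \<omega>) * iexp (T \<omega>)) = of_real (m * ?E k * exp (- (\<Sum>j\<in>I. (t j)\<^sup>2) / 2))"
        by (simp add: complex_eq_iff)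
      moreover have "(\<Prod>k\<in>insert k J. \<phi> k (z k \<omega>)) = R \<omega>" for \<omega>
        using insert.hyps by (simp add: R_def W_def mult.commute)
      moreover have "(\<Prod>k\<in>insert k J. ?E k) = m * ?E k"
        using insert.hyps by (simp add: m_def mult.commute)
      ultimately show ?thesis by (simp add: T_def)
    qed
    moreover have "integrable M (\<lambda>\<omega>. \<Prod>k\<in>insert k J. \<phi> k (z k \<omega>))"
      using A(1) insert.hyps by (simp add: W_def mult.commute)
    ultimately show ?case by blast
  qed
  show "integrable M (\<lambda>\<omega>. \<Prod>k\<in>I. \<phi> k (z k \<omega>))" using claim[of I] by simp
  have "of_real (LINT \<omega>|M. (\<Prod>k\<in>I. \<phi> k (z k \<omega>))) = (CLINT \<omega>|M. of_real (\<Prod>k\<in>I. \<phi> k (z k \<omega>)))"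
    by (simp only: integral_complex_of_real)
  also have "\<dots> = of_real (\<Prod>k\<in>I. ?E k)"
    using claim[of I] by (auto dest: spec[of _ "\<lambda>_. 0"])
  finally show "(LINT \<omega>|M. (\<Prod>k\<in>I. \<phi> k (z k \<omega>))) = (\<Prod>k\<in>I. ?E k)" by (simp only: of_real_eq_iff)
qed

lemma std_normal_exp_square:
  assumes "b > -1"
  shows "integrable std_normal_distribution (\<lambda>x. exp (- b * x\<^sup>2 / 2))"
    and "(LINT x|std_normal_distribution. exp (- b * x\<^sup>2 / 2)) = 1 / sqrt (1 + b)"
proof -
  define \<sigma> where "\<sigma> = 1 / sqrt (1 + b)"
  have s: "\<sigma> > 0" "\<sigma>\<^sup>2 = 1 / (1 + b)" using assms by (auto simp: \<sigma>_def power_divide)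
  have eq: "std_normal_density x *\<^sub>R exp (- b * x\<^sup>2 / 2) = \<sigma> * normal_density 0 \<sigma> x" for x
  proof -
    have "sqrt (2 * pi * \<sigma>\<^sup>2) = sqrt (2 * pi) * \<sigma>" using s(1) by (simp add: real_sqrt_mult)
    moreover have "- (x\<^sup>2) / (2 * \<sigma>\<^sup>2) = - x\<^sup>2 / 2 + - b * x\<^sup>2 / 2"
      unfolding s(2) using assms by (simp add: field_simps)
    ultimately have "normal_density 0 \<sigma> x = 1 / (sqrt (2 * pi) * \<sigma>) * (exp (- x\<^sup>2 / 2) * exp (- b * x\<^sup>2 / 2))"
      unfolding normal_density_def by (simp only: diff_zero exp_add)
    then show ?thesis using s(1) unfolding std_normal_density_def by simp
  qed
  show "integrable std_normal_distribution (\<lambda>x. exp (- b * x\<^sup>2 / 2))"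
    by (subst integrable_density) (auto simp: eq[simplified] integrable_normal_density[OF s(1)])
  show "(LINT x|std_normal_distribution. exp (- b * x\<^sup>2 / 2)) = 1 / sqrt (1 + b)"
    by (subst integral_density) (simp_all add: eq[simplified] s(1), simp add: \<sigma>_def)
qed

lemma (in prob_space) gaussian_variable_moments:
  assumes X: "gaussian_variable M X" and mean: "expectation X = 0"
  shows "integrable M X" "integrable M (\<lambda>\<omega>. (X \<omega>)\<^sup>2)"
    "(CLINT \<omega>|M. iexp (X \<omega>)) = of_real (exp (- (expectation (\<lambda>\<omega>. (X \<omega>)\<^sup>2)) / 2))"
proof -
  have [measurable]: "X \<in> borel_measurable M" using X by (simp add: gaussian_variable_def)
  obtain \<mu> where "(AE \<omega> in M. X \<omega> = \<mu>) \<or>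
      (\<exists>\<sigma>>0. distributed M lborel X (\<lambda>x. ennreal (normal_density \<mu> \<sigma> x)))"
    using X by (auto simp: gaussian_variable_def)
  then have "integrable M X \<and> integrable M (\<lambda>\<omega>. (X \<omega>)\<^sup>2) \<and>
    (CLINT \<omega>|M. iexp (X \<omega>)) = of_real (exp (- (expectation (\<lambda>\<omega>. (X \<omega>)\<^sup>2)) / 2))"
  proof (elim disjE exE conjE)
    assume ae: "AE \<omega> in M. X \<omega> = \<mu>"
    have "expectation X = expectation (\<lambda>_. \<mu>)"
      using ae by (intro integral_cong_AE) auto
    then have "\<mu> = 0" using mean by (simp add: prob_space)
    then have ae0: "AE \<omega> in M. X \<omega> = 0" using ae by simp
    have 1: "integrable M X" using ae0 by (subst integrable_cong_AE[where g="\<lambda>_. 0"]) auto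
    have 2: "integrable M (\<lambda>\<omega>. (X \<omega>)\<^sup>2)"
      using ae0 by (subst integrable_cong_AE[where g="\<lambda>_. 0"]) auto
    have 3: "expectation (\<lambda>\<omega>. (X \<omega>)\<^sup>2) = 0"
      using ae0 by (subst integral_cong_AE[where g="\<lambda>_. 0"]) auto
    have "(CLINT \<omega>|M. iexp (X \<omega>)) = (CLINT \<omega>|M. 1)"
      using ae0 by (intro integral_cong_AE) auto
    then show ?thesis using 1 2 3 by (simp add: prob_space)
  next
    fix \<sigma> :: real assume s: "0 < \<sigma>" and d: "distributed M lborel X (\<lambda>x. ennreal (normal_density \<mu> \<sigma> x))"
    have mu: "\<mu> = 0" using normal_distributed_expectation[OF s d] mean by simp
    have 1: "integrable M X"
      using distributed_integrable[OF d, of "\<lambda>x. x"] integrable_normal_moment_nz_1[OF s, of \<mu>] by auto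
    have 2: "integrable M (\<lambda>\<omega>. (X \<omega>)\<^sup>2)"
      using distributed_integrable[OF d, of "\<lambda>x. x\<^sup>2"] integrable_normal_moment[OF s, of 0 2] mu by auto
    have 3: "expectation (\<lambda>\<omega>. (X \<omega>)\<^sup>2) = \<sigma>\<^sup>2"
      using normal_distributed_variance[OF s d] mean by simp
    have "distributed M lborel (\<lambda>x. (X x - \<mu>) / \<sigma>) std_normal_density"
      using normal_standard_normal_convert[OF s] d by blast
    then have dd: "distr M borel (\<lambda>x. X x / \<sigma>) = std_normal_distribution"
      using mu by (simp add: distributed_def cong: distr_cong)
    have "char (distr M borel (\<lambda>x. X x / \<sigma>)) \<sigma> = (CLINT \<omega>|M. iexp (X \<omega>))"
      unfolding char_def using s by (subst integral_distr) auto
    then show ?thesis using 1 2 3 unfolding dd by (simp add: char_std_normal_distribution)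
  qed
  then show "integrable M X" "integrable M (\<lambda>\<omega>. (X \<omega>)\<^sup>2)"
    "(CLINT \<omega>|M. iexp (X \<omega>)) = of_real (exp (- (expectation (\<lambda>\<omega>. (X \<omega>)\<^sup>2)) / 2))" by auto
qed

lemma (in prob_space) gaussian_process_char:
  assumes Y: "centered_gaussian_process M Y Kf" and g: "inj_on g {..<n}"
  shows "(CLINT \<omega>|M. iexp (\<Sum>i<n. b i * Y (g i) \<omega>))
    = of_real (exp (- bform n (\<lambda>i j. Kf (g i) (g j)) b b / 2))"
    and "i < n \<Longrightarrow> integrable M (Y (g i))" "i < n \<Longrightarrow> integrable M (\<lambda>\<omega>. (Y (g i) \<omega>)\<^sup>2)"
proof -
  have gv: "gaussian_variable M (\<lambda>\<omega>. \<Sum>f\<in>F. a f * Y f \<omega>)" if "finite F" for F a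
    using Y that by (simp add: centered_gaussian_process_def)
  have mean: "expectation (Y f) = 0" and cov: "expectation (\<lambda>\<omega>. Y f \<omega> * Y h \<omega>) = Kf f h" for f h
    using Y by (simp_all add: centered_gaussian_process_def)
  have gY: "gaussian_variable M (Y f)" for f using gv[of "{f}" "\<lambda>_. 1"] by simp
  note mom = gaussian_variable_moments[OF gY mean]
  show "integrable M (Y (g i))" "integrable M (\<lambda>\<omega>. (Y (g i) \<omega>)\<^sup>2)" using mom by auto
  have [measurable]: "Y f \<in> borel_measurable M" for f using mom(1) by auto
  have prod: "integrable M (\<lambda>\<omega>. Y f \<omega> * Y h \<omega>)" for f h
  proof (rule Bochner_Integration.integrable_bound)
    show "integrable M (\<lambda>\<omega>. (Y f \<omega>)\<^sup>2 + (Y h \<omega>)\<^sup>2)" using mom(2) by simp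
    show "AE \<omega> in M. norm (Y f \<omega> * Y h \<omega>) \<le> norm ((Y f \<omega>)\<^sup>2 + (Y h \<omega>)\<^sup>2)"
    proof (rule AE_I2)
      fix \<omega>
      have "2 * (\<bar>Y f \<omega>\<bar> * \<bar>Y h \<omega>\<bar>) \<le> (Y f \<omega>)\<^sup>2 + (Y h \<omega>)\<^sup>2"
        using sum_squares_bound[of "\<bar>Y f \<omega>\<bar>" "\<bar>Y h \<omega>\<bar>"] by (simp add: mult.assoc)
      moreover have "\<bar>Y f \<omega>\<bar> * \<bar>Y h \<omega>\<bar> \<ge> 0" by simp
      ultimately show "norm (Y f \<omega> * Y h \<omega>) \<le> norm ((Y f \<omega>)\<^sup>2 + (Y h \<omega>)\<^sup>2)"
        unfolding real_norm_def abs_mult abs_of_nonneg[OF sum_power2_ge_zero] by linarith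
    qed
  qed simp
  define X where "X \<omega> = (\<Sum>i<n. b i * Y (g i) \<omega>)" for \<omega>
  have "X = (\<lambda>\<omega>. \<Sum>f\<in>g ` {..<n}. b (inv_into {..<n} g f) * Y f \<omega>)"
    unfolding X_def using g by (intro ext) (simp add: sum.reindex)
  then have "gaussian_variable M X" using gv[of "g ` {..<n}"] by simp
  moreover have "expectation X = 0"
    unfolding X_def[abs_def] using mom(1) by (simp add: mean)
  ultimately have "(CLINT \<omega>|M. iexp (X \<omega>)) = of_real (exp (- (expectation (\<lambda>\<omega>. (X \<omega>)\<^sup>2)) / 2))"
    by (rule gaussian_variable_moments)
  moreover have "expectation (\<lambda>\<omega>. (X \<omega>)\<^sup>2) = bform n (\<lambda>i j. Kf (g i) (g j)) b b"
  proof -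
    have "(X \<omega>)\<^sup>2 = (\<Sum>i<n. \<Sum>j<n. b i * b j * (Y (g i) \<omega> * Y (g j) \<omega>))" for \<omega>
      unfolding X_def power2_eq_square sum_product by (simp add: mult_ac)
    then show ?thesis using prod
      by (simp add: bform_def Bochner_Integration.integral_sum cov mult_ac)
  qed
  ultimately show "(CLINT \<omega>|M. iexp (\<Sum>i<n. b i * Y (g i) \<omega>))
    = of_real (exp (- bform n (\<lambda>i j. Kf (g i) (g j)) b b / 2))" by (simp add: X_def)
qed

text \<open>The coefficients \<open>b k\<close> may have either sign; the bound \<open>b k > -1\<close> is what makes the integral finite.\<close>

lemma (in prob_space) whitened_exp_square_expectation:
  assumes Y: "centered_gaussian_process M Y Kf" and g: "inj_on g {..<n}"
    and p: "\<And>k l. k < n \<Longrightarrow> l < n \<Longrightarrow> bform n (\<lambda>i j. Kf (g i) (g j)) (p k) (p l) = (if k = l then 1 else 0)"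
    and b: "\<And>k. k < n \<Longrightarrow> b k > -1"
  shows "integrable M (\<lambda>\<omega>. exp (- (\<Sum>k<n. b k * (\<Sum>i<n. p k i * Y (g i) \<omega>)\<^sup>2) / 2))"
    "expectation (\<lambda>\<omega>. exp (- (\<Sum>k<n. b k * (\<Sum>i<n. p k i * Y (g i) \<omega>)\<^sup>2) / 2))
      = (\<Prod>k<n. 1 / sqrt (1 + b k))"
proof -
  define z where "z k \<omega> = (\<Sum>i<n. p k i * Y (g i) \<omega>)" for k \<omega>
  have [measurable]: "Y (g i) \<in> borel_measurable M" if "i < n" for i
    using gaussian_process_char(2)[OF Y g that] by auto
  have z: "z k \<in> borel_measurable M" for k
    unfolding z_def by (intro borel_measurable_sum) auto
  have cf: "(CLINT \<omega>|M. iexp (\<Sum>k<n. t k * z k \<omega>)) = of_real (exp (- (\<Sum>k<n. (t k)\<^sup>2) / 2))" for t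
  proof -
    define w where "w i = (\<Sum>k<n. t k * p k i)" for i
    have "(\<Sum>k<n. t k * z k \<omega>) = (\<Sum>i<n. w i * Y (g i) \<omega>)" for \<omega>
      unfolding z_def w_def sum_distrib_left sum_distrib_right
      by (subst sum.swap) (simp add: mult_ac)
    moreover have "bform n (\<lambda>i j. Kf (g i) (g j)) w w = (\<Sum>k<n. (t k)\<^sup>2)"
    proof -
      have "bform n (\<lambda>i j. Kf (g i) (g j)) w w
          = (\<Sum>k<n. t k * (\<Sum>l<n. t l * bform n (\<lambda>i j. Kf (g i) (g j)) (p l) (p k)))"
      proof -
        have "bform n (\<lambda>i j. Kf (g i) (g j)) w x
          = (\<Sum>l<n. t l * bform n (\<lambda>i j. Kf (g i) (g j)) (p l) x)" for x
          unfolding w_def by (rule bform_sum_left) simp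
        moreover have "bform n (\<lambda>i j. Kf (g i) (g j)) x w
          = (\<Sum>l<n. t l * bform n (\<lambda>i j. Kf (g i) (g j)) x (p l))" for x
          unfolding w_def by (rule bform_sum_right) simp
        ultimately show ?thesis by simp
      qed
      also have "\<dots> = (\<Sum>k<n. t k * t k)"
      proof (intro sum.cong refl)
        fix k assume "k \<in> {..<n}"
        then have "(\<Sum>l<n. t l * bform n (\<lambda>i j. Kf (g i) (g j)) (p l) (p k)) = (\<Sum>l<n. if l = k then t k else 0)"
          using p by (intro sum.cong refl) auto
        also have "\<dots> = t k" using \<open>k \<in> {..<n}\<close> by simp
        finally show "t k * (\<Sum>l<n. t l * bform n (\<lambda>i j. Kf (g i) (g j)) (p l) (p k)) = t k * t k" by simp
      qed
      finally show ?thesis by (simp add: power2_eq_square)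
    qed
    ultimately show ?thesis using gaussian_process_char(1)[OF Y g, of w] by simp
  qed
  define \<phi> where "\<phi> k x = exp (- (if k < n then b k else 0) * x\<^sup>2 / 2)" for k and x :: real
  have \<phi>: "integrable std_normal_distribution (\<phi> k)" 
    "(LINT x|std_normal_distribution. \<phi> k x) = 1 / sqrt (1 + b k)" if "k < n" for k
    using std_normal_exp_square[OF b[OF that]] that by (simp_all add: \<phi>_def[abs_def])
  have eq: "exp (- (\<Sum>k<n. b k * (\<Sum>i<n. p k i * Y (g i) \<omega>)\<^sup>2) / 2) = (\<Prod>k<n. \<phi> k (z k \<omega>))" for \<omega>
    unfolding \<phi>_def z_def[symmetric]
    by (subst exp_sum[symmetric]) (simp_all add: sum_negf sum_divide_distrib)
  note * = std_normal_product_expectation[of "{..<n}" z \<phi>, OF finite_lessThan z cf]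
  show "integrable M (\<lambda>\<omega>. exp (- (\<Sum>k<n. b k * (\<Sum>i<n. p k i * Y (g i) \<omega>)\<^sup>2) / 2))"
    unfolding eq using *(1) \<phi> by (simp add: \<phi>_def)
  have "expectation (\<lambda>\<omega>. \<Prod>k<n. \<phi> k (z k \<omega>)) = (\<Prod>k<n. LINT x|std_normal_distribution. \<phi> k x)"
    using \<phi>(1) by (intro *(2)) (auto simp: \<phi>_def)
  then show "expectation (\<lambda>\<omega>. exp (- (\<Sum>k<n. b k * (\<Sum>i<n. p k i * Y (g i) \<omega>)\<^sup>2) / 2))
      = (\<Prod>k<n. 1 / sqrt (1 + b k))"
    unfolding eq using \<phi>(2) by simp
qed

text \<open>The left-hand side is the fourth root of \<open>4 \<mu> / (1 + \<mu>)\<^sup>2 = 1 - ((\<mu> - 1) / (\<mu> + 1))\<^sup>2\<close>, the affinity of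
the centred normal laws with variances \<open>1\<close> and \<open>\<mu>\<close>.\<close>

lemma hellinger_factor_le:
  fixes \<mu> :: real
  assumes "\<mu> > 0"
  shows "exp (- ln \<mu> / 4) * (1 / sqrt (1 + (1 / \<mu> - 1) / 2)) \<le> exp (- ((\<mu> - 1) / (\<mu> + 1))\<^sup>2 / 4)"
proof -
  define r where "r = 4 * \<mu> / (1 + \<mu>)\<^sup>2"
  have r: "r > 0" using assms by (simp add: r_def)
  have r1: "r = 1 + - ((\<mu> - 1) / (\<mu> + 1))\<^sup>2"
  proof -
    have "r = ((1 + \<mu>)\<^sup>2 - (\<mu> - 1)\<^sup>2) / (1 + \<mu>)\<^sup>2"
      unfolding r_def by (simp add: power2_eq_square algebra_simps)
    then show ?thesis using assms by (simp add: diff_divide_distrib[of "(1 + \<mu>)\<^sup>2"] power_divide add.commute)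
  qed
  have s: "1 + (1 / \<mu> - 1) / 2 = (1 + \<mu>) / (2 * \<mu>)" using assms by (simp add: field_simps)
  have "1 / sqrt ((1 + \<mu>) / (2 * \<mu>)) = exp (- ln ((1 + \<mu>) / (2 * \<mu>)) / 2)"
    using assms by (simp add: exp_minus ln_sqrt[symmetric] field_simps)
  then have "exp (- ln \<mu> / 4) * (1 / sqrt (1 + (1 / \<mu> - 1) / 2)) = exp (- ln \<mu> / 4 + - ln ((1 + \<mu>) / (2 * \<mu>)) / 2)"
    unfolding s exp_add by simp
  also have "- ln \<mu> / 4 + - ln ((1 + \<mu>) / (2 * \<mu>)) / 2 = ln r / 4"
  proof -
    have "ln r = ln 4 + ln \<mu> - 2 * ln (1 + \<mu>)"
      unfolding r_def using assms by (simp add: ln_div ln_mult ln_realpow)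
    moreover have "ln ((1 + \<mu>) / (2 * \<mu>)) = ln (1 + \<mu>) - ln 2 - ln \<mu>"
      using assms by (simp add: ln_div ln_mult)
    moreover have "ln (4::real) = 2 * ln 2" using ln_realpow[of 2 2] by simp
    ultimately show ?thesis by simp
  qed
  also have "exp (ln r / 4) \<le> exp (- ((\<mu> - 1) / (\<mu> + 1))\<^sup>2 / 4)"
    using ln_le_minus_one[OF r] r1 by simp
  finally show ?thesis .
qed

text \<open>Chernoff's bound at exponent \<open>1 / 4\<close>: since \<open>X\<close> is minus twice a log-likelihood ratio, the expectation of
\<open>exp (- X / 4)\<close> is the Hellinger affinity.\<close>

lemma (in prob_space) likelihood_ratio_tail:
  assumes Y: "centered_gaussian_process M Y Kf" and g: "inj_on g {..<n}"
    and p: "\<And>k l. k < n \<Longrightarrow> l < n \<Longrightarrow> bform n (\<lambda>i j. Kf (g i) (g j)) (p k) (p l) = (if k = l then 1 else 0)"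
    and \<mu>: "\<And>k. k < n \<Longrightarrow> \<mu> k > 0"
  defines "X \<equiv> (\<lambda>\<omega>. \<Sum>k<n. ln (\<mu> k) + (\<Sum>i<n. p k i * Y (g i) \<omega>)\<^sup>2 * (1 / \<mu> k - 1))"
  shows "X \<in> borel_measurable M"
    and "prob {\<omega> \<in> space M. X \<omega> \<le> t} \<le> exp (t / 4 - (\<Sum>k<n. ((\<mu> k - 1) / (\<mu> k + 1))\<^sup>2) / 4)"
proof -
  have [measurable]: "Y (g i) \<in> borel_measurable M" if "i < n" for i
    using gaussian_process_char(2)[OF Y g that] by auto
  show [measurable]: "X \<in> borel_measurable M"
    unfolding X_def
    by (intro borel_measurable_sum borel_measurable_add borel_measurable_times borel_measurable_power) auto
  define b where "b k = (1 / \<mu> k - 1) / 2" for k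
  have b: "b k > -1" if "k < n" for k using \<mu>[OF that] by (simp add: b_def field_simps)
  note w = whitened_exp_square_expectation[OF Y g p b]
  have eq: "exp (- X \<omega> / 4) = exp (- (\<Sum>k<n. ln (\<mu> k)) / 4) *
      exp (- (\<Sum>k<n. b k * (\<Sum>i<n. p k i * Y (g i) \<omega>)\<^sup>2) / 2)" for \<omega>
  proof -
    have "(\<Sum>k<n. (\<Sum>i<n. p k i * Y (g i) \<omega>)\<^sup>2 * (1 / \<mu> k - 1)) / 4
        = (\<Sum>k<n. b k * (\<Sum>i<n. p k i * Y (g i) \<omega>)\<^sup>2) / 2"
      by (simp add: b_def sum_divide_distrib mult_ac)
    then show ?thesis
      unfolding X_def sum.distrib exp_add[symmetric] by simp
  qed
  have int: "integrable M (\<lambda>\<omega>. exp (- X \<omega> / 4))" unfolding eq using w(1) by simp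
  have "expectation (\<lambda>\<omega>. exp (- X \<omega> / 4)) = exp (- (\<Sum>k<n. ln (\<mu> k)) / 4) * (\<Prod>k<n. 1 / sqrt (1 + b k))"
    unfolding eq using w(2) by simp
  also have "exp (- (\<Sum>k<n. ln (\<mu> k)) / 4) = (\<Prod>k<n. exp (- ln (\<mu> k) / 4))"
    by (subst exp_sum[symmetric]) (simp_all add: sum_negf sum_divide_distrib)
  also have "(\<Prod>k<n. exp (- ln (\<mu> k) / 4)) * (\<Prod>k<n. 1 / sqrt (1 + b k))
      = (\<Prod>k<n. exp (- ln (\<mu> k) / 4) * (1 / sqrt (1 + b k)))" by (rule prod.distrib[symmetric])
  also have "\<dots> \<le> (\<Prod>k<n. exp (- ((\<mu> k - 1) / (\<mu> k + 1))\<^sup>2 / 4))"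
  proof (intro prod_mono conjI)
    fix k assume "k \<in> {..<n}"
    then have k: "k < n" by simp
    show "0 \<le> exp (- ln (\<mu> k) / 4) * (1 / sqrt (1 + b k))" using b[OF k] by simp
    show "exp (- ln (\<mu> k) / 4) * (1 / sqrt (1 + b k)) \<le> exp (- ((\<mu> k - 1) / (\<mu> k + 1))\<^sup>2 / 4)"
      unfolding b_def by (rule hellinger_factor_le[OF \<mu>[OF k]])
  qed
  also have "\<dots> = exp (- (\<Sum>k<n. ((\<mu> k - 1) / (\<mu> k + 1))\<^sup>2) / 4)"
    by (subst exp_sum[symmetric]) (simp_all add: sum_negf sum_divide_distrib)
  finally have E: "expectation (\<lambda>\<omega>. exp (- X \<omega> / 4)) \<le> exp (- (\<Sum>k<n. ((\<mu> k - 1) / (\<mu> k + 1))\<^sup>2) / 4)" .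
  have "{\<omega> \<in> space M. X \<omega> \<le> t} = {\<omega> \<in> space M. exp (- t / 4) \<le> exp (- X \<omega> / 4)}" by auto
  then have "prob {\<omega> \<in> space M. X \<omega> \<le> t} \<le> expectation (\<lambda>\<omega>. exp (- X \<omega> / 4)) / exp (- t / 4)"
    using integral_Markov_inequality_measure[OF int, of "{}" "exp (- t / 4)"] by simp
  also have "\<dots> \<le> exp (- (\<Sum>k<n. ((\<mu> k - 1) / (\<mu> k + 1))\<^sup>2) / 4) / exp (- t / 4)"
    using E by (intro divide_right_mono) auto
  also have "\<dots> = exp (t / 4 - (\<Sum>k<n. ((\<mu> k - 1) / (\<mu> k + 1))\<^sup>2) / 4)"
    by (simp add: exp_diff[symmetric])
  finally show "prob {\<omega> \<in> space M. X \<omega> \<le> t} \<le> exp (t / 4 - (\<Sum>k<n. ((\<mu> k - 1) / (\<mu> k + 1))\<^sup>2) / 4)" .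
qed

lemma (in prob_space) square_sum_tail:
  assumes Y: "centered_gaussian_process M Y Kf" and g: "inj_on g {..<n}"
    and C: "\<And>i. i < n \<Longrightarrow> Kf (g i) (g i) \<le> C" and r: "r > 0"
  shows "(\<lambda>\<omega>. \<Sum>i<n. (Y (g i) \<omega>)\<^sup>2) \<in> borel_measurable M"
    and "prob {\<omega> \<in> space M. r \<le> (\<Sum>i<n. (Y (g i) \<omega>)\<^sup>2)} \<le> real n * C / r"
proof -
  note int = gaussian_process_char(3)[OF Y g]
  have i: "integrable M (\<lambda>\<omega>. \<Sum>i<n. (Y (g i) \<omega>)\<^sup>2)" using int by (intro Bochner_Integration.integrable_sum) auto
  then show "(\<lambda>\<omega>. \<Sum>i<n. (Y (g i) \<omega>)\<^sup>2) \<in> borel_measurable M" by auto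
  have "expectation (\<lambda>\<omega>. \<Sum>i<n. (Y (g i) \<omega>)\<^sup>2) = (\<Sum>i<n. Kf (g i) (g i))"
    using int Y by (simp add: centered_gaussian_process_def power2_eq_square)
  also have "\<dots> \<le> real n * C" using sum_mono[of "{..<n}" "\<lambda>i. Kf (g i) (g i)" "\<lambda>_. C"] C by simp
  finally have E: "expectation (\<lambda>\<omega>. \<Sum>i<n. (Y (g i) \<omega>)\<^sup>2) \<le> real n * C" .
  have "prob {\<omega> \<in> space M. r \<le> (\<Sum>i<n. (Y (g i) \<omega>)\<^sup>2)} \<le> expectation (\<lambda>\<omega>. \<Sum>i<n. (Y (g i) \<omega>)\<^sup>2) / r"
    using integral_Markov_inequality_measure[OF i, of "{}" r] r by (simp add: sum_nonneg)
  also have "\<dots> \<le> real n * C / r" using E r by (intro divide_right_mono) auto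
  finally show "prob {\<omega> \<in> space M. r \<le> (\<Sum>i<n. (Y (g i) \<omega>)\<^sup>2)} \<le> real n * C / r" .
qed

section \<open>Counting by grid cells\<close>

text \<open>The cube of side \<open>h\<close> that contains the point with coordinates \<open>\<xi> x\<close>; restriction to \<open>Q\<close> makes the
cells near a given point a finite product set.\<close>

definition grid_cell :: "real \<Rightarrow> 'q set \<Rightarrow> ('x \<Rightarrow> 'q \<Rightarrow> real) \<Rightarrow> 'x \<Rightarrow> 'q \<Rightarrow> int"
  where "grid_cell h Q \<xi> x = restrict (\<lambda>q. \<lfloor>\<xi> x q / h\<rfloor>) Q"

lemma grid_cell_eqD:
  assumes "grid_cell h Q \<xi> x = grid_cell h Q \<xi> y" "q \<in> Q" "h > 0"
  shows "\<bar>\<xi> x q - \<xi> y q\<bar> < h"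
proof -
  have "\<lfloor>\<xi> x q / h\<rfloor> = \<lfloor>\<xi> y q / h\<rfloor>"
    using assms(1,2) unfolding grid_cell_def by (metis restrict_apply')
  then have "\<bar>\<xi> x q / h - \<xi> y q / h\<bar> < 1" by linarith
  then have "\<bar>(\<xi> x q - \<xi> y q) / h\<bar> < 1" by (simp only: diff_divide_distrib)
  then show ?thesis using assms(3) by (simp add: abs_divide)
qed

lemma card_grid_cells:
  assumes Q: "finite Q" and h: "h > 0" and \<rho>: "\<rho> \<ge> 0"
    and near: "\<And>x q. x \<in> X \<Longrightarrow> q \<in> Q \<Longrightarrow> \<bar>\<xi> x q - a q\<bar> \<le> \<rho>"
  shows "finite (grid_cell h Q \<xi> ` X)"
    and "real (card (grid_cell h Q \<xi> ` X)) \<le> (2 * \<rho> / h + 3) ^ card Q"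
proof -
  define b where "b = \<lfloor>\<rho> / h\<rfloor> + 1"
  define P where "P = PiE Q (\<lambda>q. {\<lfloor>a q / h\<rfloor> - b .. \<lfloor>a q / h\<rfloor> + b})"
  have fP: "finite P" unfolding P_def using Q by (intro finite_PiE) auto
  have b0: "b \<ge> 0" using \<rho> h by (simp add: b_def)
  have sub: "grid_cell h Q \<xi> ` X \<subseteq> P"
  proof (intro image_subsetI)
    fix x assume x: "x \<in> X"
    show "grid_cell h Q \<xi> x \<in> P" unfolding P_def grid_cell_def
    proof (intro restrict_PiE_iff[THEN iffD2] ballI)
      fix q assume "q \<in> Q"
      then have "\<bar>(\<xi> x q - a q) / h\<bar> \<le> \<rho> / h"
        using near[OF x] h by (simp add: abs_divide divide_right_mono)
      then have "\<bar>\<xi> x q / h - a q / h\<bar> \<le> \<rho> / h" by (simp only: diff_divide_distrib)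
      then show "\<lfloor>\<xi> x q / h\<rfloor> \<in> {\<lfloor>a q / h\<rfloor> - b..\<lfloor>a q / h\<rfloor> + b}"
        unfolding b_def by (simp, linarith)
    qed
  qed
  show "finite (grid_cell h Q \<xi> ` X)" using finite_subset[OF sub fP] .
  have "real (card (grid_cell h Q \<xi> ` X)) \<le> real (card P)"
    using card_mono[OF fP sub] by simp
  also have "card P = nat (2 * b + 1) ^ card Q"
    unfolding P_def using Q b0 by (simp add: card_PiE)
  also have "real (nat (2 * b + 1) ^ card Q) \<le> (2 * \<rho> / h + 3) ^ card Q"
  proof -
    have "real_of_int b \<le> \<rho> / h + 1" unfolding b_def by simp
    then have "real (nat (2 * b + 1)) \<le> 2 * \<rho> / h + 3" using b0 by simp
    then show ?thesis by (simp add: power_mono)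
  qed
  finally show "real (card (grid_cell h Q \<xi> ` X)) \<le> (2 * \<rho> / h + 3) ^ card Q" .
qed

text \<open>One point is chosen from each grid cell of side \<open>\<eta> / CARD('p)\<close> that meets \<open>X\<close>.\<close>

lemma polynomial_net:
  fixes X :: "(real ^ 'p) set"
  assumes X: "bounded X"
  obtains A where "A \<ge> 0" "\<And>\<eta>. 0 < \<eta> \<Longrightarrow> \<eta> \<le> 1 \<Longrightarrow>
    \<exists>N. finite N \<and> N \<subseteq> X \<and> real (card N) \<le> (A / \<eta>) ^ CARD('p) \<and> (\<forall>x\<in>X. \<exists>y\<in>N. dist x y \<le> \<eta>)"
proof -
  obtain R where R: "R > 0" "\<And>x. x \<in> X \<Longrightarrow> norm x \<le> R" using X by (auto simp: bounded_pos)
  define A where "A = 2 * R * real CARD('p) + 3"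
  have "\<exists>N. finite N \<and> N \<subseteq> X \<and> real (card N) \<le> (A / \<eta>) ^ CARD('p) \<and> (\<forall>x\<in>X. \<exists>y\<in>N. dist x y \<le> \<eta>)"
    if \<eta>: "0 < \<eta>" "\<eta> \<le> 1" for \<eta>
  proof -
    define h where "h = \<eta> / real CARD('p)"
    have h: "h > 0" using \<eta> by (simp add: h_def)
    define cell where "cell = grid_cell h UNIV (\<lambda>x::real^'p. vec_nth x)"
    define N where "N = inv_into X cell ` cell ` X"
    note cc = card_grid_cells[of "UNIV :: 'p set" h R X "\<lambda>x. vec_nth x" "\<lambda>_. 0", OF finite h less_imp_le[OF R(1)]]
    have near: "\<bar>vec_nth x q - 0\<bar> \<le> R" if "x \<in> X" for x q
      using component_le_norm_cart[of x q] R(2)[OF that] by simp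
    have fin: "finite (cell ` X)" and card: "real (card (cell ` X)) \<le> (2 * R / h + 3) ^ CARD('p)"
      using cc near unfolding cell_def by auto
    have "card N \<le> card (cell ` X)" unfolding N_def by (rule card_image_le[OF fin])
    then have "real (card N) \<le> (2 * R / h + 3) ^ CARD('p)" using card by simp
    also have "\<dots> \<le> (A / \<eta>) ^ CARD('p)"
    proof (rule power_mono)
      have "3 \<le> 3 / \<eta>" using \<eta> by (simp add: field_simps)
      then show "2 * R / h + 3 \<le> A / \<eta>" unfolding A_def h_def by (simp add: add_divide_distrib)
    qed (use R h in simp)
    finally have 1: "real (card N) \<le> (A / \<eta>) ^ CARD('p)" .
    have 2: "N \<subseteq> X" unfolding N_def by (auto intro: inv_into_into)
    have 3: "\<exists>y\<in>N. dist x y \<le> \<eta>" if "x \<in> X" for x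
    proof
      let ?y = "inv_into X cell (cell x)"
      show "?y \<in> N" using that by (auto simp: N_def)
      have "cell x = cell ?y" using that by (simp add: f_inv_into_f)
      then have "\<bar>vec_nth x q - vec_nth ?y q\<bar> < h" for q
        unfolding cell_def using grid_cell_eqD[OF _ UNIV_I h] by metis
      then have "norm (x - ?y) \<le> (\<Sum>q\<in>(UNIV::'p set). h)"
        by (intro order_trans[OF norm_le_l1_cart] sum_mono) (simp add: less_imp_le)
      then show "dist x ?y \<le> \<eta>" by (simp add: dist_norm h_def)
    qed
    show ?thesis using 1 2 3 fin by (intro exI[of _ N]) (auto simp: N_def)
  qed
  then show ?thesis using that[of A] R(1) by (simp add: A_def)
qed

lemma (in hilbert_space) ip_diff_left: "ip (x - y) z = ip x z - ip y z"
proof -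
  have "ip (x - y + y) z = ip (x - y) z + ip y z" by (rule ip_add_left)
  then show ?thesis by simp
qed

lemma (in hilbert_space) ip_diff_right: "ip z (x - y) = ip z x - ip z y"
  by (metis complex_cnj_diff ip_cnj ip_diff_left)

lemma (in hilbert_space) ip_smul_right: "a \<in> S \<Longrightarrow> ip x (smul a y) = cnj a * ip x y"
  by (metis complex_cnj_mult ip_cnj ip_smul_left)

lemma (in hilbert_space) ip_zero_right: "ip x 0 = 0"
  using ip_diff_right[of x 0 0] by simp

lemma (in hilbert_space) norm_smul:
  assumes "a \<in> S" shows "norm (smul a x) = cmod a * norm x"
proof -
  have "of_real ((norm (smul a x))\<^sup>2) = a * (cnj a * ip x x)"
    unfolding ip_self[symmetric] using assms by (simp add: ip_smul_left ip_smul_right)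
  also have "\<dots> = of_real ((cmod a * norm x)\<^sup>2)"
    unfolding ip_self by (simp add: power_mult_distrib mult.assoc flip: complex_norm_square)
  finally have "(norm (smul a x))\<^sup>2 = (cmod a * norm x)\<^sup>2" by (simp only: of_real_eq_iff)
  then show ?thesis by (simp add: power2_eq_iff_nonneg)
qed

lemma (in hilbert_space) cmod_ip_unit_le:
  assumes "norm u = 1"
  shows "cmod (ip x u) \<le> norm x"
proof -
  let ?a = "ip x u"
  have a: "?a \<in> S" by (rule ip_scalar)
  have uu: "ip u u = 1" using ip_self[of u] assms by simp
  have ux: "ip u x = cnj ?a" by (rule ip_cnj)
  have "of_real ((norm (x - smul ?a u))\<^sup>2) = ip x x - cnj ?a * ?a"
    unfolding ip_self[symmetric] ip_diff_left ip_diff_right using a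
    by (simp add: ip_smul_left ip_smul_right uu ux)
  also have "\<dots> = of_real ((norm x)\<^sup>2 - (cmod ?a)\<^sup>2)"
    unfolding ip_self by (simp add: mult.commute flip: complex_norm_square)
  finally have "(norm (x - smul ?a u))\<^sup>2 = (norm x)\<^sup>2 - (cmod ?a)\<^sup>2" by (simp only: of_real_eq_iff)
  then have "(cmod ?a)\<^sup>2 \<le> (norm x)\<^sup>2" by (metis diff_ge_0_iff_ge zero_le_power2)
  then show ?thesis by (rule power2_le_imp_le) simp
qed

lemma (in hilbert_space) smul_diff_left:
  assumes "a \<in> S" "b \<in> S" "a - b \<in> S"
  shows "smul a x - smul b x = smul (a - b) x"
  using smul_add_left[of "a - b" b x] assms by simp

lemma (in hilbert_space) basis_vector_cases:
  assumes "orthonormal_basis smul ip e" "j \<ge> 1"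
  shows "norm (e j) = 1 \<or> e j = 0"
proof -
  obtain D :: enat where
    D: "\<forall>i\<ge>1. \<forall>j\<ge>1. enat i \<le> D \<longrightarrow> enat j \<le> D \<longrightarrow> ip (e i) (e j) = (if i = j then 1 else 0)"
      "\<forall>j\<ge>1. D < enat j \<longrightarrow> e j = 0"
    using assms(1) unfolding orthonormal_basis_def by blast
  show ?thesis
  proof (cases "enat j \<le> D")
    case True
    then have "ip (e j) (e j) = 1" using D(1) assms(2) by simp
    then have "(norm (e j))\<^sup>2 = 1" unfolding ip_self by (metis of_real_eq_1_iff)
    then show ?thesis using power2_eq_imp_eq[of "norm (e j)" 1] by simp
  next
    case False
    then show ?thesis using D(2) assms(2) by simp
  qed
qed

text \<open>The real and imaginary parts of the first \<open>d\<close> coefficients are \<open>2 d\<close> real coordinates.  Cells of side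
\<open>\<Delta> / (4 d)\<close> separate the inputs, because two inputs in one cell have partial sums at distance at
most \<open>\<Delta> / 2\<close>; and coefficients do not increase distances, so the inputs in a ball lie in few cells.\<close>

lemma (in hilbert_space) card_inputs_in_ball:
  assumes e: "orthonormal_basis smul ip e" and d: "d \<ge> 1" and \<Delta>: "\<Delta> > 0"
    and sep: "\<And>i j. i \<in> I \<Longrightarrow> j \<in> I \<Longrightarrow> i \<noteq> j \<Longrightarrow>
       norm (partial_sum smul ip e d (g i) - partial_sum smul ip e d (g j)) \<ge> \<Delta>"
    and I: "finite I" and \<rho>: "\<rho> \<ge> 0"
  shows "real (card {j \<in> I. norm (x - g j) \<le> \<rho>}) \<le> (8 * real d * \<rho> / \<Delta> + 3) ^ (2 * d)"
proof -
  define Q where "Q = {1..d} \<times> (UNIV :: bool set)"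
  define h where "h = \<Delta> / (4 * real d)"
  define \<xi>0 where "\<xi>0 y = (\<lambda>(l, b). if b then Re (ip y (e l)) else Im (ip y (e l)))" for y
  define \<xi> where "\<xi> j = \<xi>0 (g j)" for j
  define J where "J = {j \<in> I. norm (x - g j) \<le> \<rho>}"
  have h: "h > 0" using d \<Delta> by (simp add: h_def)
  have Q: "finite Q" "card Q = 2 * d" by (auto simp: Q_def card_UNIV_bool)
  have e1: "norm (e l) \<le> 1" "cmod (ip y (e l)) \<le> norm y" if "l \<in> {1..d}" for l y
    using basis_vector_cases[OF e, of l] that cmod_ip_unit_le[of "e l" y] by (auto simp: ip_zero_right)
  have inj: "inj_on (grid_cell h Q \<xi>) J"
  proof (rule inj_onI, rule ccontr)
    fix i j assume ij: "i \<in> J" "j \<in> J" "grid_cell h Q \<xi> i = grid_cell h Q \<xi> j" "i \<noteq> j"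
    have "norm (partial_sum smul ip e d (g i) - partial_sum smul ip e d (g j))
        = norm (\<Sum>l = 1..d. smul (ip (g i - g j) (e l)) (e l))"
    proof -
      have "smul (ip (g i) (e l)) (e l) - smul (ip (g j) (e l)) (e l) = smul (ip (g i - g j) (e l)) (e l)" for l
        unfolding ip_diff_left by (rule smul_diff_left) (metis ip_scalar ip_diff_left)+
      then show ?thesis by (simp add: partial_sum_def flip: sum_subtractf)
    qed
    also have "\<dots> \<le> (\<Sum>l = 1..d. 2 * h)"
    proof (rule order_trans[OF norm_sum sum_mono])
      fix l assume l: "l \<in> {1..d}"
      let ?c = "ip (g i - g j) (e l)"
      have "\<bar>Re ?c\<bar> < h" "\<bar>Im ?c\<bar> < h"
        using grid_cell_eqD[OF ij(3) _ h, of "(l, True)"] grid_cell_eqD[OF ij(3) _ h, of "(l, False)"] l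
        by (auto simp: Q_def \<xi>_def \<xi>0_def ip_diff_left)
      then have "cmod ?c \<le> 2 * h" using cmod_le[of ?c] by linarith
      then have "cmod ?c * norm (e l) \<le> 2 * h"
        using e1(1)[OF l] by (smt (verit) mult_left_le norm_ge_zero)
      then show "norm (smul ?c (e l)) \<le> 2 * h" by (simp add: norm_smul ip_scalar)
    qed
    also have "\<dots> = \<Delta> / 2" using d by (simp add: h_def)
    finally show False using sep[of i j] ij \<Delta> by (auto simp: J_def)
  qed
  have near: "\<bar>\<xi> j q - \<xi>0 x q\<bar> \<le> \<rho>" if "j \<in> J" "q \<in> Q" for j q
  proof -
    obtain l b where q: "q = (l, b)" by (cases q)
    have l: "l \<in> {1..d}" using that q by (auto simp: Q_def)
    have "\<bar>\<xi> j q - \<xi>0 x q\<bar> \<le> cmod (ip (g j - x) (e l))"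
      using abs_Re_le_cmod[of "ip (g j - x) (e l)"] abs_Im_le_cmod[of "ip (g j - x) (e l)"]
      by (simp add: q \<xi>_def \<xi>0_def ip_diff_left)
    also have "\<dots> \<le> norm (g j - x)" by (rule e1(2)[OF l])
    also have "\<dots> \<le> \<rho>" using that by (simp add: J_def norm_minus_commute)
    finally show ?thesis .
  qed
  have "real (card J) = real (card (grid_cell h Q \<xi> ` J))" using card_image[OF inj] by simp
  also have "\<dots> \<le> (2 * \<rho> / h + 3) ^ (2 * d)"
    using card_grid_cells(2)[OF Q(1) h \<rho> near] Q(2) by simp
  also have "2 * \<rho> / h = 8 * real d * \<rho> / \<Delta>" by (simp add: h_def)
  finally show ?thesis by (simp add: J_def)
qed

section \<open>Square sums of the kernel along the inputs\<close>

text \<open>The points at distance between \<open>2 ^ k\<close> and \<open>2 ^ (k + 1)\<close> number at most a constant times \<open>2 ^ (k q)\<close> and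
contribute at most \<open>2 powr (- 2 k \<gamma>)\<close> each, which leaves a geometric series.\<close>

lemma tail_sum_dyadic:
  fixes r :: "'j \<Rightarrow> real"
  assumes J: "finite J" and count: "\<And>\<rho>. \<rho> \<ge> 0 \<Longrightarrow> real (card {j \<in> J. r j \<le> \<rho>}) \<le> (A * (1 + \<rho>)) ^ q"
    and A: "A \<ge> 0" and \<gamma>: "real q < 2 * \<gamma>" 
  shows "(\<Sum>j\<in>{j \<in> J. r j > 2 ^ m}. (1 / (1 + r j powr \<gamma>))\<^sup>2)
    \<le> (4 * A) ^ q * (2 powr (real q - 2 * \<gamma>)) ^ m / (1 - 2 powr (real q - 2 * \<gamma>))"
proof -
  define t where "t = 2 powr (real q - 2 * \<gamma>)"
  have t: "0 < t" "t < 1" using \<gamma> by (auto simp: t_def powr_less_one)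
  define F where "F = {j \<in> J. r j > 2 ^ m}"
  have fF: "finite F" using J by (simp add: F_def)
  obtain M where M: "\<And>j. j \<in> F \<Longrightarrow> r j \<le> 2 ^ M"
  proof -
    obtain R where R: "\<And>j. j \<in> F \<Longrightarrow> r j \<le> R"
      using fF by (metis Max_ge finite_imageI imageI)
    obtain M where "R < 2 ^ M" using real_arch_pow[of 2 R] by auto
    then show ?thesis using that[of M] R by force
  qed
  have shell: "(1 / (1 + r j powr \<gamma>))\<^sup>2
      \<le> (\<Sum>k\<in>{m..<M}. (2 powr (- 2 * \<gamma>)) ^ k * (if r j \<le> 2 ^ Suc k then 1 else 0))" if j: "j \<in> F" for j
  proof -
    define k where "k = (LEAST k. r j \<le> 2 ^ Suc k)"
    have rj: "r j > 2 ^ m" using j by (simp add: F_def)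
    have "m < M" using M[OF j] rj by (metis linorder_not_le order_less_le_trans order_less_irrefl power_increasing one_le_numeral dual_order.trans)
    then have "r j \<le> 2 ^ Suc (M - 1)" using M[OF j] by simp
    then have k1: "r j \<le> 2 ^ Suc k" and k3: "k \<le> M - 1" unfolding k_def by (rule LeastI, rule Least_le)
    have k2: "m \<le> k"
    proof (rule ccontr)
      assume "\<not> m \<le> k"
      then have "(2::real) ^ Suc k \<le> 2 ^ m" by (intro power_increasing) auto
      then show False using k1 rj by linarith
    qed
    have k4: "r j > 2 ^ k"
    proof (cases "k = 0")
      case True
      have "(2::real) ^ k \<le> 2 ^ m" using True by simp
      also note rj
      finally show ?thesis .
    next
      case False
      then have "\<not> r j \<le> 2 ^ Suc (k - 1)" using not_less_Least[of "k - 1" "\<lambda>k. r j \<le> 2 ^ Suc k"] by (simp add: k_def)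
      then show ?thesis using False by simp
    qed
    have r0: "r j > 0" using k4 by (smt (verit) zero_less_power)
    have \<gamma>0: "\<gamma> > 0" using \<gamma> by linarith
    have "(1 / (1 + r j powr \<gamma>))\<^sup>2 \<le> (1 / (2 ^ k) powr \<gamma>)\<^sup>2"
    proof (intro power_mono divide_left_mono)
      have "(2 ^ k) powr \<gamma> \<le> r j powr \<gamma>" using k4 \<gamma>0 by (intro powr_mono2) auto
      then show "(2 ^ k) powr \<gamma> \<le> 1 + r j powr \<gamma>" by simp
    qed (use r0 in \<open>auto intro!: mult_pos_pos add_pos_pos\<close>)
    also have "\<dots> = (2 powr (- 2 * \<gamma>)) ^ k"
      by (simp add: powr_realpow[symmetric] powr_powr powr_minus power2_eq_square field_simps
          flip: powr_add)
    also have "\<dots> = (2 powr (- 2 * \<gamma>)) ^ k * (if r j \<le> 2 ^ Suc k then 1 else 0)" using k1 by simp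
    also have "\<dots> \<le> (\<Sum>k\<in>{m..<M}. (2 powr (- 2 * \<gamma>)) ^ k * (if r j \<le> 2 ^ Suc k then 1 else 0))"
      using k2 k3 \<open>m < M\<close> 
      by (intro member_le_sum[of k "{m..<M}" "\<lambda>k. (2 powr (- 2 * \<gamma>)) ^ k * (if r j \<le> 2 ^ Suc k then 1 else 0)"]) auto
    finally show ?thesis .
  qed
  have "(\<Sum>j\<in>F. (1 / (1 + r j powr \<gamma>))\<^sup>2)
      \<le> (\<Sum>j\<in>F. \<Sum>k\<in>{m..<M}. (2 powr (- 2 * \<gamma>)) ^ k * (if r j \<le> 2 ^ Suc k then 1 else 0))"
    using shell by (rule sum_mono)
  also have "\<dots> = (\<Sum>k\<in>{m..<M}. \<Sum>j\<in>F. (2 powr (- 2 * \<gamma>)) ^ k * (if r j \<le> 2 ^ Suc k then 1 else 0))"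
    by (rule sum.swap)
  also have "\<dots> = (\<Sum>k\<in>{m..<M}. (2 powr (- 2 * \<gamma>)) ^ k * real (card {j \<in> F. r j \<le> 2 ^ Suc k}))"
    using fF by (simp add: sum_distrib_left[symmetric] sum.If_cases Int_def)
  also have "\<dots> \<le> (\<Sum>k\<in>{m..<M}. (4 * A) ^ q * t ^ k)"
  proof (rule sum_mono)
    fix k
    have "real (card {j \<in> F. r j \<le> 2 ^ Suc k}) \<le> real (card {j \<in> J. r j \<le> 2 ^ Suc k})"
      using J by (intro of_nat_mono card_mono) (auto simp: F_def)
    also have "\<dots> \<le> (A * (1 + 2 ^ Suc k)) ^ q" by (rule count) simp
    also have "\<dots> \<le> (A * (4 * 2 ^ k)) ^ q"
    proof (intro power_mono mult_left_mono A)
      have "(1::real) \<le> 2 ^ k" by simp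
      then show "1 + 2 ^ Suc k \<le> (4 * 2 ^ k :: real)" unfolding power_Suc by linarith
    qed (use A in simp)
    also have "\<dots> = (4 * A) ^ q * (2 powr real q) ^ k"
      by (simp add: power_mult_distrib powr_realpow mult_ac flip: power_mult)
    finally have "(2 powr (- 2 * \<gamma>)) ^ k * real (card {j \<in> F. r j \<le> 2 ^ Suc k})
        \<le> (2 powr (- 2 * \<gamma>)) ^ k * ((4 * A) ^ q * (2 powr real q) ^ k)"
      by (intro mult_left_mono) auto
    also have "\<dots> = (4 * A) ^ q * ((2 powr (- 2 * \<gamma>)) * (2 powr real q)) ^ k"
      by (simp only: power_mult_distrib mult_ac)
    also have "(2 powr (- 2 * \<gamma>)) * (2 powr real q) = t"
      unfolding t_def powr_add[symmetric] by simp
    finally show "(2 powr (- 2 * \<gamma>)) ^ k * real (card {j \<in> F. r j \<le> 2 ^ Suc k}) \<le> (4 * A) ^ q * t ^ k" .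
  qed
  also have "\<dots> = (4 * A) ^ q * (\<Sum>k\<in>{m..<M}. t ^ k)" by (rule sum_distrib_left[symmetric])
  also have "\<dots> \<le> (4 * A) ^ q * (t ^ m / (1 - t))"
  proof (intro mult_left_mono)
    have "(1 - t) * (\<Sum>k\<in>{m..<M}. t ^ k) \<le> t ^ m"
    proof (cases "m \<le> M")
      case True
      have "(1 - t) * (\<Sum>k\<in>{m..<M}. t ^ k) = - (\<Sum>k\<in>{m..<M}. t ^ Suc k - t ^ k)"
        unfolding sum_distrib_left sum_negf[symmetric] by (intro sum.cong refl) (simp add: algebra_simps)
      also have "\<dots> = t ^ m - t ^ M" using sum_Suc_diff'[OF True, of "\<lambda>k. t ^ k"] by simp
      finally show ?thesis using t by simp
    qed (use t in simp)
    then show "(\<Sum>k\<in>{m..<M}. t ^ k) \<le> t ^ m / (1 - t)" using t by (simp add: field_simps)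
  qed (use A in simp)
  finally show ?thesis by (simp add: F_def t_def)
qed

text \<open>The point of this form is that \<open>\<beta>\<close> and \<open>m\<close> depend on the configuration of points only through the
growth constants \<open>A\<close> and \<open>q\<close>, so they serve all sample sizes at once.\<close>

lemma envelope_square_sums:
  fixes A C \<gamma> :: real and q :: nat
  assumes A: "A \<ge> 0" and \<gamma>: "real q < 2 * \<gamma>"
  obtains \<beta> where "\<beta> > 0"
    "\<And>I (g :: nat \<Rightarrow> 'h::real_normed_vector) x. finite I \<Longrightarrow>
       (\<And>\<rho>. \<rho> \<ge> 0 \<Longrightarrow> real (card {j \<in> I. norm (x - g j) \<le> \<rho>}) \<le> (A * (1 + \<rho>)) ^ q) \<Longrightarrow>
       (\<Sum>j\<in>I. (C / (1 + norm (x - g j) powr \<gamma>))\<^sup>2) \<le> \<beta>"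
    "\<And>\<epsilon>. \<epsilon> > 0 \<Longrightarrow> \<exists>m. \<forall>I (g :: nat \<Rightarrow> 'h::real_normed_vector) x. finite I \<longrightarrow>
       (\<forall>\<rho>\<ge>0. real (card {j \<in> I. norm (x - g j) \<le> \<rho>}) \<le> (A * (1 + \<rho>)) ^ q) \<longrightarrow>
       (\<Sum>j\<in>I. if norm (x - g j) \<le> 2 ^ m then 0 else (C / (1 + norm (x - g j) powr \<gamma>))\<^sup>2) \<le> \<epsilon>"
proof -
  define t where "t = 2 powr (real q - 2 * \<gamma>)"
  have t: "0 < t" "t < 1" using \<gamma> by (auto simp: t_def powr_less_one)
  define T where "T m = C\<^sup>2 * ((4 * A) ^ q * t ^ m / (1 - t))" for m :: nat
  have T0: "T m \<ge> 0" for m using t A by (auto simp: T_def intro!: mult_nonneg_nonneg divide_nonneg_pos)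
  have tail: "(\<Sum>j\<in>I. if norm (x - g j) \<le> 2 ^ m then 0 else (C / (1 + norm (x - g j) powr \<gamma>))\<^sup>2) \<le> T m"
    if I: "finite I" and count: "\<And>\<rho>. \<rho> \<ge> 0 \<Longrightarrow> real (card {j \<in> I. norm (x - g j) \<le> \<rho>}) \<le> (A * (1 + \<rho>)) ^ q"
    for I m and g :: "nat \<Rightarrow> 'h" and x
  proof -
    have "(\<Sum>j\<in>I. if norm (x - g j) \<le> 2 ^ m then 0 else (C / (1 + norm (x - g j) powr \<gamma>))\<^sup>2)
        = (\<Sum>j\<in>{j \<in> I. norm (x - g j) > 2 ^ m}. C\<^sup>2 * (1 / (1 + norm (x - g j) powr \<gamma>))\<^sup>2)"
      using I by (intro sum.mono_neutral_cong_right) (auto simp: power_divide)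
    also have "\<dots> = C\<^sup>2 * (\<Sum>j\<in>{j \<in> I. norm (x - g j) > 2 ^ m}. (1 / (1 + norm (x - g j) powr \<gamma>))\<^sup>2)"
      by (rule sum_distrib_left[symmetric])
    also have "\<dots> \<le> T m"
      unfolding T_def t_def by (intro mult_left_mono tail_sum_dyadic[OF I count A \<gamma>]) auto
    finally show ?thesis .
  qed
  define \<beta> where "\<beta> = C\<^sup>2 * (2 * A) ^ q + T 0 + 1"
  have 1: "\<beta> > 0" unfolding \<beta>_def using T0[of 0] A by (intro add_nonneg_pos add_nonneg_nonneg) auto
  have 2: "(\<Sum>j\<in>I. (C / (1 + norm (x - g j) powr \<gamma>))\<^sup>2) \<le> \<beta>"
    if I: "finite I" and count: "\<And>\<rho>. \<rho> \<ge> 0 \<Longrightarrow> real (card {j \<in> I. norm (x - g j) \<le> \<rho>}) \<le> (A * (1 + \<rho>)) ^ q"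
    for I and g :: "nat \<Rightarrow> 'h" and x
  proof -
    have "(\<Sum>j\<in>I. (C / (1 + norm (x - g j) powr \<gamma>))\<^sup>2)
        = (\<Sum>j\<in>I. if norm (x - g j) \<le> 1 then (C / (1 + norm (x - g j) powr \<gamma>))\<^sup>2 else 0) +
          (\<Sum>j\<in>I. if norm (x - g j) \<le> 2 ^ 0 then 0 else (C / (1 + norm (x - g j) powr \<gamma>))\<^sup>2)"
      unfolding sum.distrib[symmetric] by (intro sum.cong) auto
    also have "\<dots> \<le> (\<Sum>j\<in>I. if norm (x - g j) \<le> 1 then C\<^sup>2 else 0) + T 0"
    proof (intro add_mono tail[OF that] sum_mono)
      fix j
      have "(C / (1 + norm (x - g j) powr \<gamma>))\<^sup>2 \<le> C\<^sup>2"
      proof -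
        have "\<bar>C / (1 + norm (x - g j) powr \<gamma>)\<bar> \<le> \<bar>C\<bar>"
          by (simp add: divide_le_eq mult_le_cancel_left1 add_nonneg_nonneg abs_of_nonneg add_pos_nonneg)
        then show ?thesis by (simp only: abs_le_square_iff)
      qed
      then show "(if norm (x - g j) \<le> 1 then (C / (1 + norm (x - g j) powr \<gamma>))\<^sup>2 else 0)
          \<le> (if norm (x - g j) \<le> 1 then C\<^sup>2 else 0)" by simp
    qed
    also have "(\<Sum>j\<in>I. if norm (x - g j) \<le> 1 then C\<^sup>2 else 0) = C\<^sup>2 * real (card {j \<in> I. norm (x - g j) \<le> 1})"
      using I by (simp add: sum.If_cases Int_def)
    also have "\<dots> \<le> C\<^sup>2 * (2 * A) ^ q"
      using count[of 1] by (intro mult_left_mono) (auto simp: mult.commute)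
    finally show ?thesis by (simp add: \<beta>_def)
  qed
  have 3: "\<exists>m. T m \<le> \<epsilon>" if "\<epsilon> > 0" for \<epsilon>
  proof -
    have "(\<lambda>m. t ^ m) \<longlonglongrightarrow> 0" using t by (intro LIMSEQ_realpow_zero) auto
    then have "(\<lambda>m. (C\<^sup>2 * (4 * A) ^ q / (1 - t)) * t ^ m) \<longlonglongrightarrow> (C\<^sup>2 * (4 * A) ^ q / (1 - t)) * 0"
      by (intro tendsto_mult_left)
    then have "T \<longlonglongrightarrow> 0" by (simp add: T_def[abs_def] mult.assoc)
    then have "eventually (\<lambda>m. T m < \<epsilon>) sequentially" using that by (rule order_tendstoD(2))
    then obtain m where "T m < \<epsilon>" by (auto simp: eventually_sequentially)
    then show ?thesis by (intro exI[of _ m]) simp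
  qed
  show ?thesis
  proof (rule that[OF 1 2])
    fix \<epsilon> :: real assume "\<epsilon> > 0"
    then obtain m where m: "T m \<le> \<epsilon>" using 3 by blast
    show "\<exists>m. \<forall>I (g :: nat \<Rightarrow> 'h) x. finite I \<longrightarrow>
       (\<forall>\<rho>\<ge>0. real (card {j \<in> I. norm (x - g j) \<le> \<rho>}) \<le> (A * (1 + \<rho>)) ^ q) \<longrightarrow>
       (\<Sum>j\<in>I. if norm (x - g j) \<le> 2 ^ m then 0 else (C / (1 + norm (x - g j) powr \<gamma>))\<^sup>2) \<le> \<epsilon>"
      by (intro exI[of _ m] allI impI order_trans[OF tail m]) auto
  qed
qed

text \<open>Here near means at distance at most \<open>2 ^ m\<close>, with \<open>m\<close> so large that the far pairs carry at most half of
the squared norm \<open>\<delta> n\<close>.\<close>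

lemma uniform_affinity_exponent:
  fixes A C \<gamma> \<delta> :: real and q :: nat
  assumes A: "A \<ge> 0" and \<gamma>: "real q < 2 * \<gamma>" and C: "C > 0" and \<delta>: "\<delta> > 0"
  obtains a where "a > 0"
    "\<And>n (g :: nat \<Rightarrow> 'h::real_normed_vector) (K0 :: 'h \<Rightarrow> 'h \<Rightarrow> real) (K1 :: 'h \<Rightarrow> 'h \<Rightarrow> real) \<mu> Q.
      (\<And>\<rho> x. \<rho> \<ge> 0 \<Longrightarrow> real (card {j \<in> {..<n}. norm (x - g j) \<le> \<rho>}) \<le> (A * (1 + \<rho>)) ^ q) \<Longrightarrow>
      (\<And>x y. \<bar>K0 x y\<bar> \<le> C / (1 + norm (x - y) powr \<gamma>)) \<Longrightarrow>
      (\<And>x y. \<bar>K1 x y\<bar> \<le> C / (1 + norm (x - y) powr \<gamma>)) \<Longrightarrow>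
      \<delta> * real n \<le> (\<Sum>i<n. \<Sum>j<n. (K1 (g i) (g j) - K0 (g i) (g j))\<^sup>2) \<Longrightarrow>
      (\<And>k. k < n \<Longrightarrow> \<mu> k > 0) \<Longrightarrow>
      (\<And>i j. i < n \<Longrightarrow> j < n \<Longrightarrow> K0 (g i) (g j) = (\<Sum>k<n. Q i k * Q j k)) \<Longrightarrow>
      (\<And>i j. i < n \<Longrightarrow> j < n \<Longrightarrow> K1 (g i) (g j) = (\<Sum>k<n. \<mu> k * Q i k * Q j k)) \<Longrightarrow>
      a * real n \<le> (\<Sum>k<n. ((\<mu> k - 1) / (\<mu> k + 1))\<^sup>2)"
proof -
  obtain \<beta> where \<beta>: "\<beta> > 0"
    "\<And>I (g :: nat \<Rightarrow> 'h) x. finite I \<Longrightarrow>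
       (\<And>\<rho>. \<rho> \<ge> 0 \<Longrightarrow> real (card {j \<in> I. norm (x - g j) \<le> \<rho>}) \<le> (A * (1 + \<rho>)) ^ q) \<Longrightarrow>
       (\<Sum>j\<in>I. (C / (1 + norm (x - g j) powr \<gamma>))\<^sup>2) \<le> \<beta>"
    and tail: "\<And>\<epsilon>. \<epsilon> > 0 \<Longrightarrow> \<exists>m. \<forall>I (g :: nat \<Rightarrow> 'h) x. finite I \<longrightarrow>
       (\<forall>\<rho>\<ge>0. real (card {j \<in> I. norm (x - g j) \<le> \<rho>}) \<le> (A * (1 + \<rho>)) ^ q) \<longrightarrow>
       (\<Sum>j\<in>I. if norm (x - g j) \<le> 2 ^ m then 0 else (C / (1 + norm (x - g j) powr \<gamma>))\<^sup>2) \<le> \<epsilon>"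
    by (rule envelope_square_sums[OF A \<gamma>, of C]) blast
  have "0 < \<delta> / 8" using \<delta> by simp
  from tail[OF this] obtain m where m: "\<forall>I (g :: nat \<Rightarrow> 'h) x. finite I \<longrightarrow>
       (\<forall>\<rho>\<ge>0. real (card {j \<in> I. norm (x - g j) \<le> \<rho>}) \<le> (A * (1 + \<rho>)) ^ q) \<longrightarrow>
       (\<Sum>j\<in>I. if norm (x - g j) \<le> 2 ^ m then 0 else (C / (1 + norm (x - g j) powr \<gamma>))\<^sup>2) \<le> \<delta> / 8"
    by (rule exE)
  define r where "r = 2 * C * (A * (1 + 2 ^ m)) ^ q + 1"
  have r: "r > 0" unfolding r_def using A C by (intro add_nonneg_pos mult_nonneg_nonneg) auto
  \<comment> \<open>The row sum bound \<open>r\<close> counts the near inputs; the factor \<open>4\<close> at \<open>\<beta>\<close> comes from \<open>(x + y)\<^sup>2 \<le> 4 w\<^sup>2\<close> for \<open>\<bar>x\<bar>, \<bar>y\<bar> \<le> w\<close>.\<close>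
  define a where "a = \<delta>\<^sup>2 / (4 * r\<^sup>2 * (4 * \<beta>))"
  show ?thesis
  proof (rule that[of a])
    show "a > 0" using \<delta> r \<beta>(1) by (simp add: a_def)
    fix n :: nat and g :: "nat \<Rightarrow> 'h" and K0 K1 :: "'h \<Rightarrow> 'h \<Rightarrow> real" and \<mu> Q
    assume count: "\<And>\<rho> x. \<rho> \<ge> 0 \<Longrightarrow> real (card {j \<in> {..<n}. norm (x - g j) \<le> \<rho>}) \<le> (A * (1 + \<rho>)) ^ q"
      and K0: "\<And>x y. \<bar>K0 x y\<bar> \<le> C / (1 + norm (x - y) powr \<gamma>)"
      and K1: "\<And>x y. \<bar>K1 x y\<bar> \<le> C / (1 + norm (x - y) powr \<gamma>)"
      and diff: "\<delta> * real n \<le> (\<Sum>i<n. \<Sum>j<n. (K1 (g i) (g j) - K0 (g i) (g j))\<^sup>2)"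
      and \<mu>: "\<And>k. k < n \<Longrightarrow> \<mu> k > 0"
      and A0: "\<And>i j. i < n \<Longrightarrow> j < n \<Longrightarrow> K0 (g i) (g j) = (\<Sum>k<n. Q i k * Q j k)"
      and A1: "\<And>i j. i < n \<Longrightarrow> j < n \<Longrightarrow> K1 (g i) (g j) = (\<Sum>k<n. \<mu> k * Q i k * Q j k)"
    define w where "w x = C / (1 + norm x powr \<gamma>)" for x :: 'h
    have w: "0 \<le> w x" "w x \<le> C" for x
      using C by (simp_all add: w_def divide_le_eq mult_le_cancel_left1 add_pos_nonneg)
    have D: "\<bar>K1 x y - K0 x y\<bar> \<le> 2 * w (x - y)" "\<bar>K0 x y + K1 x y\<bar> \<le> 2 * w (x - y)" for x y
      using K0[of x y] K1[of x y] unfolding w_def by linarith+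
    have D2: "(K1 x y - K0 x y)\<^sup>2 \<le> 4 * (w (x - y))\<^sup>2" "(K0 x y + K1 x y)\<^sup>2 \<le> 4 * (w (x - y))\<^sup>2" for x y
      using power_mono[OF D(1), of x y 2] power_mono[OF D(2), of x y 2] by (simp_all add: power_mult_distrib)
    have far: "(\<Sum>i<n. \<Sum>j<n. if norm (g i - g j) \<le> 2 ^ m then 0 else (K1 (g i) (g j) - K0 (g i) (g j))\<^sup>2) \<le> \<delta> / 2 * real n"
    proof -
      have "(\<Sum>j<n. if norm (g i - g j) \<le> 2 ^ m then 0 else (K1 (g i) (g j) - K0 (g i) (g j))\<^sup>2) \<le> \<delta> / 2" for i
      proof -
        have "(\<Sum>j<n. if norm (g i - g j) \<le> 2 ^ m then 0 else (K1 (g i) (g j) - K0 (g i) (g j))\<^sup>2)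
          \<le> (\<Sum>j<n. 4 * (if norm (g i - g j) \<le> 2 ^ m then 0 else (w (g i - g j))\<^sup>2))"
          using D2 by (intro sum_mono) auto
        also have "\<dots> \<le> 4 * (\<delta> / 8)"
          unfolding sum_distrib_left[symmetric] w_def using count by (intro mult_left_mono m[rule_format, of "{..<n}" "g i" g]) auto
        finally show ?thesis by simp
      qed
      then have "(\<Sum>i<n. \<Sum>j<n. if norm (g i - g j) \<le> 2 ^ m then 0 else (K1 (g i) (g j) - K0 (g i) (g j))\<^sup>2)
          \<le> (\<Sum>i<n. \<delta> / 2)" by (rule sum_mono)
      then show ?thesis by (simp add: mult.commute)
    qed
    have row: "(\<Sum>j<n. if norm (g i - g j) \<le> 2 ^ m then \<bar>K1 (g i) (g j) - K0 (g i) (g j)\<bar> else 0) \<le> r" for i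
    proof -
      have "(\<Sum>j<n. if norm (g i - g j) \<le> 2 ^ m then \<bar>K1 (g i) (g j) - K0 (g i) (g j)\<bar> else 0)
          \<le> (\<Sum>j<n. if norm (g i - g j) \<le> 2 ^ m then 2 * C else 0)"
      proof (intro sum_mono)
        fix j
        have "\<bar>K1 (g i) (g j) - K0 (g i) (g j)\<bar> \<le> 2 * C"
          using D(1)[of "g i" "g j"] w(2)[of "g i - g j"] by linarith
        then show "(if norm (g i - g j) \<le> 2 ^ m then \<bar>K1 (g i) (g j) - K0 (g i) (g j)\<bar> else 0)
            \<le> (if norm (g i - g j) \<le> 2 ^ m then 2 * C else 0)" by simp
      qed
      also have "\<dots> = 2 * C * real (card {j \<in> {..<n}. norm (g i - g j) \<le> 2 ^ m})"
        by (simp add: sum.If_cases Int_def)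
      also have "\<dots> \<le> 2 * C * (A * (1 + 2 ^ m)) ^ q"
        using C by (intro mult_left_mono count) auto
      finally show ?thesis by (simp add: r_def)
    qed
    have frob: "(\<Sum>i<n. \<Sum>j<n. (K0 (g i) (g j) + K1 (g i) (g j))\<^sup>2) \<le> 4 * \<beta> * real n"
    proof -
      have "(\<Sum>j<n. (K0 (g i) (g j) + K1 (g i) (g j))\<^sup>2) \<le> 4 * \<beta>" for i
      proof -
        have "(\<Sum>j<n. (K0 (g i) (g j) + K1 (g i) (g j))\<^sup>2) \<le> (\<Sum>j<n. 4 * (w (g i - g j))\<^sup>2)"
          using D2 by (intro sum_mono) auto
        also have "\<dots> \<le> 4 * \<beta>"
          unfolding sum_distrib_left[symmetric] w_def using count by (intro mult_left_mono \<beta>(2)[of "{..<n}" "g i" g]) auto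
        finally show ?thesis .
      qed
      then have "(\<Sum>i<n. \<Sum>j<n. (K0 (g i) (g j) + K1 (g i) (g j))\<^sup>2) \<le> (\<Sum>i<n. 4 * \<beta>)" by (rule sum_mono)
      then show ?thesis by (simp add: mult.commute)
    qed
    show "a * real n \<le> (\<Sum>k<n. ((\<mu> k - 1) / (\<mu> k + 1))\<^sup>2)"
      unfolding a_def
      by (rule affinity_exponent_lower_bound[OF \<mu> A0 A1 _ diff far row frob])
        (use \<delta> r \<beta>(1) in \<open>auto simp: norm_minus_commute\<close>)
  qed
qed

section \<open>Consistency of the maximum likelihood estimator\<close>

lemma parameter_lipschitz:
  fixes k :: "real ^ 'p \<Rightarrow> real" and G :: "real ^ 'p \<Rightarrow> real ^ 'p"
  assumes seg: "closed_segment \<theta> \<theta>' \<subseteq> V"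
    and der: "\<And>\<theta>. \<theta> \<in> V \<Longrightarrow> (k has_derivative (\<lambda>h. inner (G \<theta>) h)) (at \<theta> within V)"
    and bound: "\<And>\<theta> i. \<theta> \<in> V \<Longrightarrow> \<bar>vec_nth (G \<theta>) i\<bar> \<le> b"
  shows "\<bar>k \<theta> - k \<theta>'\<bar> \<le> real CARD('p) * b * dist \<theta> \<theta>'"
proof -
  have "norm (k \<theta> - k \<theta>') \<le> (real CARD('p) * b) * norm (\<theta> - \<theta>')"
  proof (rule differentiable_bound[OF convex_closed_segment[of \<theta> \<theta>']])
    fix x assume "x \<in> closed_segment \<theta> \<theta>'"
    then have x: "x \<in> V" using seg by blast
    show "(k has_derivative (\<lambda>h. inner (G x) h)) (at x within closed_segment \<theta> \<theta>')"
      using der[OF x] seg by (rule has_derivative_subset)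
    have nG: "norm (G x) \<le> real CARD('p) * b"
    proof -
      have "norm (G x) \<le> (\<Sum>i\<in>UNIV. \<bar>vec_nth (G x) i\<bar>)" by (rule norm_le_l1_cart)
      also have "\<dots> \<le> (\<Sum>i\<in>(UNIV::'p set). b)" using bound[OF x] by (intro sum_mono)
      finally show ?thesis by simp
    qed
    show "onorm (\<lambda>h. inner (G x) h) \<le> real CARD('p) * b"
    proof (rule onorm_le)
      fix h
      have "norm (inner (G x) h) \<le> norm (G x) * norm h" using Cauchy_Schwarz_ineq2 by simp
      also have "\<dots> \<le> real CARD('p) * b * norm h" using nG by (intro mult_right_mono) auto
      finally show "norm (inner (G x) h) \<le> real CARD('p) * b * norm h" .
    qed
  qed auto
  then show ?thesis by (simp add: dist_norm)
qed

text \<open>Up to a constant factor this is \<open>x ^ (m l) / exp x\<close> at \<open>x = a n\<close>.\<close>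

lemma polynomial_exp_decay:
  fixes a b A :: real
  assumes a: "a > 0"
  shows "(\<lambda>n. (A * real n ^ m) ^ l * exp (b - a * real n)) \<longlonglongrightarrow> 0"
proof -
  have "filterlim (\<lambda>n. a * real n) at_top sequentially"
    using a by (intro filterlim_tendsto_pos_mult_at_top[OF tendsto_const _ filterlim_real_sequentially])
  then have "(\<lambda>n. (a * real n) ^ (m * l) / exp (a * real n)) \<longlonglongrightarrow> 0"
    by (rule filterlim_compose[OF tendsto_power_div_exp_0])
  then have "(\<lambda>n. (A ^ l * exp b / a ^ (m * l)) * ((a * real n) ^ (m * l) / exp (a * real n))) \<longlonglongrightarrow> 0"
    by (rule tendsto_mult_right_zero)
  moreover have "(A ^ l * exp b / a ^ (m * l)) * ((a * real n) ^ (m * l) / exp (a * real n))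
      = (A * real n ^ m) ^ l * exp (b - a * real n)" for n
    using a by (simp add: power_mult_distrib power_mult[symmetric] exp_diff)
  ultimately show ?thesis by (simp only:)
qed

theorem theorem4p6:
  fixes S :: "complex set"
    and smul :: "complex \<Rightarrow> 'h::banach \<Rightarrow> 'h"
    and ip :: "'h \<Rightarrow> 'h \<Rightarrow> complex"
    and e :: "nat \<Rightarrow> 'h"
    and \<Theta> :: "(real ^ 'p) set" and \<theta>\<^sub>0 :: "real ^ 'p"
    and K :: "real ^ 'p \<Rightarrow> 'h \<Rightarrow> 'h \<Rightarrow> real"
    and k :: "real ^ 'p \<Rightarrow> 'h \<Rightarrow> real"
    and M :: "'w measure" and Y :: "'h \<Rightarrow> 'w \<Rightarrow> real"
    and f :: "nat \<Rightarrow> nat \<Rightarrow> 'h"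
    and \<Delta> C \<gamma>\<^sub>0 c C\<^sub>1 \<gamma>\<^sub>1 :: real
    and J\<^sub>0 d\<^sub>0 :: nat and s :: "nat \<Rightarrow> real"
    and V :: "(real ^ 'p) set"
    and G :: "real ^ 'p \<Rightarrow> 'h \<Rightarrow> real ^ 'p"
    and est :: "nat \<Rightarrow> 'w \<Rightarrow> real ^ 'p"
  assumes hilbert: "hilbert_space S smul ip"
    and basis: "orthonormal_basis smul ip e"
    and compact: "compact \<Theta>"
    and interior: "\<theta>\<^sub>0 \<in> interior \<Theta>"
    and covariance: "\<And>\<theta>. \<theta> \<in> \<Theta> \<Longrightarrow> covariance_function (K \<theta>)"
    and prob: "prob_space M"
    and process: "centered_gaussian_process M Y (K \<theta>\<^sub>0)"
    and separation: "\<Delta> > 0"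
      "\<And>n i j. i \<in> {1..n} \<Longrightarrow> j \<in> {1..n} \<Longrightarrow> i \<noteq> j \<Longrightarrow> norm (f n i - f n j) \<ge> 2 * \<Delta>"
    and projection: "J\<^sub>0 \<ge> 1"
      "\<And>j. j \<ge> J\<^sub>0 \<Longrightarrow> s j \<ge> 0"
      "(\<lambda>j. (s j)\<^sup>2) summable_on {J\<^sub>0..}"
      "\<And>n i j. i \<in> {1..n} \<Longrightarrow> j \<ge> J\<^sub>0 \<Longrightarrow> cmod (ip (f n i) (e j)) \<le> s j"
    and d0: "d\<^sub>0 \<ge> J\<^sub>0"
      "\<And>n i j. 1 \<le> i \<Longrightarrow> i < j \<Longrightarrow> j \<le> n \<Longrightarrow>
         norm (partial_sum smul ip e d\<^sub>0 (f n i) - partial_sum smul ip e d\<^sub>0 (f n j)) \<ge> \<Delta>"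
      "(\<Sum>\<^sub>\<infinity>j\<in>{d\<^sub>0 + 1..}. (s j)\<^sup>2) < \<Delta>\<^sup>2 / 16"
    and stationary: "\<And>\<theta> g h. \<theta> \<in> \<Theta> \<Longrightarrow> K \<theta> g h = k \<theta> (g - h)"
    and decay: "\<gamma>\<^sub>0 > real d\<^sub>0" "C > 0"
      "\<And>\<theta> g. \<theta> \<in> \<Theta> \<Longrightarrow> \<bar>k \<theta> g\<bar> \<le> C / (1 + norm g powr \<gamma>\<^sub>0)"
    and eigenvalues: "c > 0"
      "\<And>n \<theta>. n \<ge> 1 \<Longrightarrow> \<theta> \<in> \<Theta> \<Longrightarrow> lambda_min (cov_matrix (K \<theta>) f n) \<ge> c"
    and identifiability: "\<And>\<alpha>::real. \<alpha> > 0 \<Longrightarrow>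
      liminf (\<lambda>n. INF \<theta>\<in>{\<theta> \<in> \<Theta>. norm (\<theta> - \<theta>\<^sub>0) \<ge> \<alpha>}.
        ereal (1 / real n * (\<Sum>i = 1..n. \<Sum>j = 1..n.
          (K \<theta> (f n i) (f n j) - K \<theta>\<^sub>0 (f n i) (f n j))\<^sup>2))) > 0"
    and domain: "differentiability_domain \<Theta> V"
    and derivative:
      "\<And>\<theta> g. \<theta> \<in> V \<Longrightarrow> ((\<lambda>\<theta>. k \<theta> g) has_derivative (\<lambda>h. inner (G \<theta> g) h)) (at \<theta> within V)"
      "\<And>g. continuous_on V (\<lambda>\<theta>. G \<theta> g)"
    and derivative_decay: "\<gamma>\<^sub>1 > real d\<^sub>0" "C\<^sub>1 > 0"
      "\<And>\<theta> g i. \<theta> \<in> V \<Longrightarrow> \<bar>vec_nth (G \<theta> g) i\<bar> \<le> C\<^sub>1 / (1 + norm g powr \<gamma>\<^sub>1)"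
    and estimator_measurable: "\<And>n. n \<ge> 1 \<Longrightarrow> est n \<in> borel_measurable M"
    and estimator: "\<And>n \<omega>. n \<ge> 1 \<Longrightarrow> \<omega> \<in> space M \<Longrightarrow>
      is_arg_min (neg_log_lik K f Y n \<omega>) (\<lambda>\<theta>. \<theta> \<in> \<Theta>) (est n \<omega>)"
  shows "\<forall>\<epsilon>::real. \<epsilon> > 0 \<longrightarrow>
    (\<lambda>n. measure M {\<omega> \<in> space M. norm (est n \<omega> - \<theta>\<^sub>0) > \<epsilon>}) \<longlonglongrightarrow> 0"
proof (intro allI impI)
  fix \<epsilon> :: real assume \<epsilon>: "\<epsilon> > 0"
  interpret H: hilbert_space S smul ip by (rule hilbert)
  interpret prob_space M by (rule prob)
  define \<Theta>' where "\<Theta>' = {\<theta> \<in> \<Theta>. norm (\<theta> - \<theta>\<^sub>0) \<ge> \<epsilon>}"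
  define g where "g n i = f n (Suc i)" for n i
  have \<theta>0: "\<theta>\<^sub>0 \<in> \<Theta>" using interior interior_subset by blast
  have d1: "d\<^sub>0 \<ge> 1" using d0(1) projection(1) by simp
  have shift: "(\<Sum>i = 1..n. F i) = (\<Sum>i<n. F (Suc i))" for F :: "nat \<Rightarrow> real" and n
    by (simp add: sum.atLeast1_atMost_eq)

  have K_bound: "\<bar>K \<theta> x y\<bar> \<le> C / (1 + norm (x - y) powr \<gamma>\<^sub>0)" if "\<theta> \<in> \<Theta>" for \<theta> x y
    using decay(3)[OF that] stationary[OF that] by simp
  \<comment> \<open>Matrix indices start at 0, inputs at 1; \<open>g\<close> absorbs the shift.\<close>
  have coer: "coercive n c (\<lambda>i j. K \<theta> (g n i) (g n j))" if "n \<ge> 1" "\<theta> \<in> \<Theta>" for n \<theta>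
  proof (rule coercive_lambda_min[OF that(1) _ eigenvalues(1)])
    show "\<forall>i<n. \<forall>j<n. K \<theta> (g n i) (g n j) = K \<theta> (g n j) (g n i)"
      using covariance[OF that(2)] unfolding covariance_function_def by blast
    show "c \<le> lambda_min (mat n n (\<lambda>(i, j). K \<theta> (g n i) (g n j)))"
      using eigenvalues(2)[OF that] by (simp add: cov_matrix_def g_def)
  qed
  have inj: "inj_on (g n) {..<n}" for n
  proof (rule inj_onI, rule ccontr)
    fix i j assume ij: "i \<in> {..<n}" "j \<in> {..<n}" "g n i = g n j" "i \<noteq> j"
    have "norm (f n (Suc i) - f n (Suc j)) \<ge> 2 * \<Delta>" using ij by (intro separation(2)) auto
    then show False using ij(3) separation(1) by (simp add: g_def)
  qed
  define A where "A = 8 * real d\<^sub>0 / \<Delta> + 3"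
  have A: "A \<ge> 0" using separation(1) by (simp add: A_def)
  have count: "real (card {j \<in> {..<n}. norm (x - g n j) \<le> \<rho>}) \<le> (A * (1 + \<rho>)) ^ (2 * d\<^sub>0)"
    if \<rho>: "\<rho> \<ge> 0" for n x \<rho>
  proof -
    have "real (card {j \<in> {..<n}. norm (x - g n j) \<le> \<rho>}) \<le> (8 * real d\<^sub>0 * \<rho> / \<Delta> + 3) ^ (2 * d\<^sub>0)"
    proof (rule H.card_inputs_in_ball[OF basis d1 separation(1) _ finite_lessThan \<rho>])
      fix i j assume ij: "i \<in> {..<n}" "j \<in> {..<n}" "i \<noteq> j"
      show "\<Delta> \<le> norm (partial_sum smul ip e d\<^sub>0 (g n i) - partial_sum smul ip e d\<^sub>0 (g n j))"
        using d0(2)[of "Suc i" "Suc j" n] d0(2)[of "Suc j" "Suc i" n] ij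
        by (cases i j rule: linorder_cases) (auto simp: g_def norm_minus_commute)
    qed
    also have "\<dots> \<le> (A * (1 + \<rho>)) ^ (2 * d\<^sub>0)"
    proof (rule power_mono)
      have "A * (1 + \<rho>) = (8 * real d\<^sub>0 * \<rho> / \<Delta> + 3) + (8 * real d\<^sub>0 / \<Delta> + 3 * \<rho>)"
        by (simp add: A_def algebra_simps add_divide_distrib)
      then show "8 * real d\<^sub>0 * \<rho> / \<Delta> + 3 \<le> A * (1 + \<rho>)" using separation(1) \<rho> by simp
    qed (use separation(1) \<rho> in simp)
    finally show ?thesis .
  qed

  obtain \<delta> n1 where \<delta>: "\<delta> > 0" and ident: "\<And>n \<theta>. n \<ge> n1 \<Longrightarrow> \<theta> \<in> \<Theta>' \<Longrightarrow>
      \<delta> * real n \<le> (\<Sum>i<n. \<Sum>j<n. (K \<theta> (g n i) (g n j) - K \<theta>\<^sub>0 (g n i) (g n j))\<^sup>2)"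
  proof -
    define D where "D n \<theta> = 1 / real n * (\<Sum>i = 1..n. \<Sum>j = 1..n. (K \<theta> (f n i) (f n j) - K \<theta>\<^sub>0 (f n i) (f n j))\<^sup>2)" for n \<theta>
    have "liminf (\<lambda>n. INF \<theta>\<in>\<Theta>'. ereal (D n \<theta>)) > 0"
      using identifiability[OF \<epsilon>] by (simp add: D_def \<Theta>'_def)
    then obtain \<delta> where \<delta>: "0 < ereal \<delta>" "ereal \<delta> < liminf (\<lambda>n. INF \<theta>\<in>\<Theta>'. ereal (D n \<theta>))"
      using ereal_dense2 by blast
    from less_LiminfD[OF \<delta>(2)] obtain n1 where n1: "\<And>n. n \<ge> n1 \<Longrightarrow> ereal \<delta> < (INF \<theta>\<in>\<Theta>'. ereal (D n \<theta>))"
      by (auto simp: eventually_sequentially)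
    have "\<delta> * real n \<le> (\<Sum>i<n. \<Sum>j<n. (K \<theta> (g n i) (g n j) - K \<theta>\<^sub>0 (g n i) (g n j))\<^sup>2)"
      if "n \<ge> n1" "\<theta> \<in> \<Theta>'" for n \<theta>
    proof (cases "n = 0")
      case False
      have "ereal \<delta> \<le> ereal (D n \<theta>)"
        using n1[OF that(1)] INF_lower[OF that(2), of "\<lambda>\<theta>. ereal (D n \<theta>)"] by order
      then have "\<delta> * real n \<le> D n \<theta> * real n" by (simp add: mult_right_mono)
      also have "\<dots> = (\<Sum>i<n. \<Sum>j<n. (K \<theta> (g n i) (g n j) - K \<theta>\<^sub>0 (g n i) (g n j))\<^sup>2)"
        unfolding D_def shift g_def using False by simp
      finally show ?thesis .
    qed simp
    then show ?thesis using that[of \<delta> n1] \<delta>(1) by simp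
  qed

  have decay2: "real (2 * d\<^sub>0) < 2 * \<gamma>\<^sub>0" using decay(1) by simp
  obtain a where a: "a > 0"
    and affinity: "\<And>n (g :: nat \<Rightarrow> 'h) (K0 :: 'h \<Rightarrow> 'h \<Rightarrow> real) (K1 :: 'h \<Rightarrow> 'h \<Rightarrow> real) \<mu> Q.
      (\<And>\<rho> x. \<rho> \<ge> 0 \<Longrightarrow> real (card {j \<in> {..<n}. norm (x - g j) \<le> \<rho>}) \<le> (A * (1 + \<rho>)) ^ (2 * d\<^sub>0)) \<Longrightarrow>
      (\<And>x y. \<bar>K0 x y\<bar> \<le> C / (1 + norm (x - y) powr \<gamma>\<^sub>0)) \<Longrightarrow>
      (\<And>x y. \<bar>K1 x y\<bar> \<le> C / (1 + norm (x - y) powr \<gamma>\<^sub>0)) \<Longrightarrow>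
      \<delta> * real n \<le> (\<Sum>i<n. \<Sum>j<n. (K1 (g i) (g j) - K0 (g i) (g j))\<^sup>2) \<Longrightarrow>
      (\<And>k. k < n \<Longrightarrow> \<mu> k > 0) \<Longrightarrow>
      (\<And>i j. i < n \<Longrightarrow> j < n \<Longrightarrow> K0 (g i) (g j) = (\<Sum>k<n. Q i k * Q j k)) \<Longrightarrow>
      (\<And>i j. i < n \<Longrightarrow> j < n \<Longrightarrow> K1 (g i) (g j) = (\<Sum>k<n. \<mu> k * Q i k * Q j k)) \<Longrightarrow>
      a * real n \<le> (\<Sum>k<n. ((\<mu> k - 1) / (\<mu> k + 1))\<^sup>2)"
    by (rule uniform_affinity_exponent[OF A decay2 decay(2) \<delta>]) blast

  \<comment> \<open>Differences of \<open>L n \<omega>\<close> are the random variables of \<open>likelihood_ratio_tail\<close>.\<close>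
  define L where "L n \<omega> \<theta> = real n * neg_log_lik K f Y n \<omega> \<theta>" for n \<omega> \<theta>
  define ysq where "ysq n \<omega> = (\<Sum>i<n. (Y (g n i) \<omega>)\<^sup>2)" for n \<omega>
  have lik: "\<exists>p q \<mu>. (\<forall>k<n. \<mu> k > 0) \<and>
      (\<forall>k<n. \<forall>l<n. bform n (\<lambda>i j. K \<theta> (g n i) (g n j)) (p k) (p l) = (if k = l then 1 else 0)) \<and>
      (\<forall>k<n. \<forall>l<n. bform n (\<lambda>i j. K \<theta>' (g n i) (g n j)) (p k) (p l) = (if k = l then \<mu> k else 0)) \<and>
      (\<forall>i<n. \<forall>j<n. K \<theta> (g n i) (g n j) = (\<Sum>k<n. q i k * q j k)) \<and>
      (\<forall>i<n. \<forall>j<n. K \<theta>' (g n i) (g n j) = (\<Sum>k<n. \<mu> k * q i k * q j k)) \<and>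
      (\<forall>\<omega>. L n \<omega> \<theta>' - L n \<omega> \<theta> = (\<Sum>k<n. ln (\<mu> k) + (\<Sum>i<n. p k i * Y (g n i) \<omega>)\<^sup>2 * (1 / \<mu> k - 1)))"
    if n: "n \<ge> 1" and \<theta>: "\<theta> \<in> \<Theta>" "\<theta>' \<in> \<Theta>" for n \<theta> \<theta>'
  proof -
    have Lq: "L n \<omega> \<theta> = ln (Determinant.det (mat n n (\<lambda>(i, j). K \<theta> (g n i) (g n j)))) +
        Matrix.vec n (\<lambda>i. Y (g n i) \<omega>) \<bullet> (the (mat_inverse (mat n n (\<lambda>(i, j). K \<theta> (g n i) (g n j))))
           *\<^sub>v Matrix.vec n (\<lambda>i. Y (g n i) \<omega>))" for \<omega> \<theta>
      using n by (simp add: L_def neg_log_lik_def cov_matrix_def obs_vec_def g_def Let_def field_simps)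
    show ?thesis
    proof (rule whitening[OF coer[OF n \<theta>(1)] coer[OF n \<theta>(2)]], goal_cases)
      case (1 p q \<mu>)
      have "L n \<omega> \<theta>' - L n \<omega> \<theta> = (\<Sum>k<n. ln (\<mu> k) + (\<Sum>i<n. p k i * Y (g n i) \<omega>)\<^sup>2 * (1 / \<mu> k - 1))" for \<omega>
        unfolding Lq 1(7,8) using 1(6) by (simp add: sum.distrib sum_subtractf right_diff_distrib)
      then show ?case using 1(1-5) by (intro exI[of _ p] exI[of _ q] exI[of _ \<mu>]) simp
    qed
  qed

  have far: "(\<lambda>\<omega>. L n \<omega> \<theta> - L n \<omega> \<theta>\<^sub>0) \<in> borel_measurable M \<and>
      prob {\<omega> \<in> space M. L n \<omega> \<theta> - L n \<omega> \<theta>\<^sub>0 \<le> t} \<le> exp (t / 4 - a * real n / 4)"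
    if n: "n \<ge> 1" "n \<ge> n1" and \<theta>: "\<theta> \<in> \<Theta>'" for n \<theta> t
  proof -
    have \<theta>': "\<theta> \<in> \<Theta>" using \<theta> by (simp add: \<Theta>'_def)
    obtain p q \<mu> where w: "\<forall>k<n. \<mu> k > 0"
      "\<forall>k<n. \<forall>l<n. bform n (\<lambda>i j. K \<theta>\<^sub>0 (g n i) (g n j)) (p k) (p l) = (if k = l then 1 else 0)"
      "\<forall>i<n. \<forall>j<n. K \<theta>\<^sub>0 (g n i) (g n j) = (\<Sum>k<n. q i k * q j k)"
      "\<forall>i<n. \<forall>j<n. K \<theta> (g n i) (g n j) = (\<Sum>k<n. \<mu> k * q i k * q j k)"
      "\<forall>\<omega>. L n \<omega> \<theta> - L n \<omega> \<theta>\<^sub>0 = (\<Sum>k<n. ln (\<mu> k) + (\<Sum>i<n. p k i * Y (g n i) \<omega>)\<^sup>2 * (1 / \<mu> k - 1))"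
      using lik[OF n(1) \<theta>0 \<theta>'] by blast
    have "a * real n \<le> (\<Sum>k<n. ((\<mu> k - 1) / (\<mu> k + 1))\<^sup>2)"
      by (rule affinity[of n "g n" "K \<theta>\<^sub>0" "K \<theta>" \<mu> q])
        (use count K_bound[OF \<theta>0] K_bound[OF \<theta>'] ident[OF n(2) \<theta>] w in auto)
    then have le: "exp (t / 4 - (\<Sum>k<n. ((\<mu> k - 1) / (\<mu> k + 1))\<^sup>2) / 4) \<le> exp (t / 4 - a * real n / 4)" by simp
    note tail = likelihood_ratio_tail[OF process inj, of n p \<mu>]
    have "(\<lambda>\<omega>. L n \<omega> \<theta> - L n \<omega> \<theta>\<^sub>0) \<in> borel_measurable M"
      unfolding w(5)[rule_format] using w(1,2) by (intro tail(1)) auto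
    moreover have "prob {\<omega> \<in> space M. L n \<omega> \<theta> - L n \<omega> \<theta>\<^sub>0 \<le> t} \<le> exp (t / 4 - a * real n / 4)"
      unfolding w(5)[rule_format] using w(1,2) by (intro order_trans[OF tail(2) le]) auto
    ultimately show ?thesis by blast
  qed

  obtain r0 where r0: "r0 > 0" "\<And>\<theta> \<theta>'. \<theta> \<in> \<Theta> \<Longrightarrow> \<theta>' \<in> \<Theta> \<Longrightarrow> dist \<theta> \<theta>' < r0 \<Longrightarrow> closed_segment \<theta> \<theta>' \<subseteq> V"
    using domain unfolding differentiability_domain_def by blast
  define B where "B = real CARD('p) * C\<^sub>1"
  have B: "B > 0" using derivative_decay(2) by (simp add: B_def)
  have lip: "\<bar>K \<theta> x y - K \<theta>' x y\<bar> \<le> B * dist \<theta> \<theta>'"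
    if "\<theta> \<in> \<Theta>" "\<theta>' \<in> \<Theta>" "dist \<theta> \<theta>' < r0" for \<theta> \<theta>' x y
    unfolding stationary[OF that(1)] stationary[OF that(2)] B_def
  proof (rule parameter_lipschitz[OF r0(2)[OF that] derivative(1)])
    fix \<theta> i assume "\<theta> \<in> V"
    have "C\<^sub>1 / (1 + norm (x - y) powr \<gamma>\<^sub>1) \<le> C\<^sub>1"
      using derivative_decay(2) by (simp add: divide_le_eq mult_le_cancel_left1 add_pos_nonneg)
    then show "\<bar>vec_nth (G \<theta> (x - y)) i\<bar> \<le> C\<^sub>1" using derivative_decay(3)[OF \<open>\<theta> \<in> V\<close>, of "x - y" i] by linarith
  qed
  \<comment> \<open>Mesh \<open>n\<^sup>-\<^sup>3\<close> makes \<open>\<kappa> = B / (c n\<^sup>2)\<close>, and the increment bound \<open>2 \<kappa> (n + n\<^sup>2 / c)\<close> is at most \<open>\<tau>\<close>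
    whenever the observation vector has length at most \<open>n\<close>.\<close>
  define \<tau> where "\<tau> = 2 * B / c * (1 + 1 / c)"
  have close: "L n \<omega> \<theta>' - L n \<omega> \<theta> \<ge> - \<tau>"
    if n: "n \<ge> 1" "1 / real n ^ 3 < r0" "B / (c * (real n)\<^sup>2) \<le> 1 / 2" and \<theta>: "\<theta> \<in> \<Theta>" "\<theta>' \<in> \<Theta>"
      and d: "dist \<theta>' \<theta> \<le> 1 / real n ^ 3" and y: "ysq n \<omega> \<le> (real n)\<^sup>2" for n \<omega> \<theta> \<theta>'
  proof -
    obtain p q \<mu> where w: "\<forall>k<n. \<mu> k > 0"
      "\<forall>k<n. \<forall>l<n. bform n (\<lambda>i j. K \<theta> (g n i) (g n j)) (p k) (p l) = (if k = l then 1 else 0)"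
      "\<forall>k<n. \<forall>l<n. bform n (\<lambda>i j. K \<theta>' (g n i) (g n j)) (p k) (p l) = (if k = l then \<mu> k else 0)"
      "\<forall>\<omega>. L n \<omega> \<theta>' - L n \<omega> \<theta> = (\<Sum>k<n. ln (\<mu> k) + (\<Sum>i<n. p k i * Y (g n i) \<omega>)\<^sup>2 * (1 / \<mu> k - 1))"
      using lik[OF n(1) \<theta>] by blast
    have np: "real n \<ge> 1" "real n > 0" using n(1) by auto
    define \<kappa> where "\<kappa> = B / (c * (real n)\<^sup>2)"
    have c: "c > 0" by (rule eigenvalues(1))
    have \<kappa>: "\<kappa> \<ge> 0" using B c by (simp add: \<kappa>_def)
    have m: "\<bar>K \<theta>' (g n i) (g n j) - K \<theta> (g n i) (g n j)\<bar> \<le> B / real n ^ 3" for i j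
    proof -
      have "\<bar>K \<theta>' (g n i) (g n j) - K \<theta> (g n i) (g n j)\<bar> \<le> B * dist \<theta>' \<theta>"
        using n(2) d by (intro lip \<theta>) auto
      also have "\<dots> \<le> B * (1 / real n ^ 3)" using d B by (intro mult_left_mono) auto
      finally show ?thesis by simp
    qed
    have "- 2 * \<kappa> * (real n + ysq n \<omega> / c) \<le> L n \<omega> \<theta>' - L n \<omega> \<theta>"
      unfolding ysq_def w(4)[rule_format]
    proof (rule likelihood_increment_lower_bound[OF coer[OF n(1) \<theta>(1)]
          w(1)[rule_format] w(2)[rule_format] w(3)[rule_format] m])
      show "B / real n ^ 3 * real n / c \<le> \<kappa>"
        using np by (simp add: \<kappa>_def power2_eq_square power3_eq_cube mult_ac)
    qed (use n(3) in \<open>auto simp: \<kappa>_def\<close>)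
    moreover have "\<kappa> * (real n + ysq n \<omega> / c) \<le> \<kappa> * ((real n)\<^sup>2 + (real n)\<^sup>2 / c)"
      using y np c \<kappa> by (intro mult_left_mono add_mono divide_right_mono) (auto simp: power2_eq_square)
    moreover have "2 * (\<kappa> * ((real n)\<^sup>2 + (real n)\<^sup>2 / c)) = \<tau>"
      using np c by (simp add: \<kappa>_def \<tau>_def distrib_left add_divide_distrib power2_eq_square mult_ac)
    ultimately show ?thesis by simp
  qed

  have "bounded \<Theta>'" using compact_imp_bounded[OF compact] by (rule bounded_subset) (auto simp: \<Theta>'_def)
  then obtain A' where A': "A' \<ge> 0" "\<And>\<eta>. 0 < \<eta> \<Longrightarrow> \<eta> \<le> 1 \<Longrightarrow>
    \<exists>N. finite N \<and> N \<subseteq> \<Theta>' \<and> real (card N) \<le> (A' / \<eta>) ^ CARD('p) \<and> (\<forall>x\<in>\<Theta>'. \<exists>y\<in>N. dist x y \<le> \<eta>)"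
    by (rule polynomial_net) blast

  define P where "P = CARD('p)"
  define bnd where "bnd n = C / real n + (A' * real n ^ 3) ^ P * exp (\<tau> / 4 - a * real n / 4)" for n
  have main: "prob {\<omega> \<in> space M. norm (est n \<omega> - \<theta>\<^sub>0) > \<epsilon>} \<le> bnd n"
    if n: "n \<ge> 1" "n \<ge> n1" "1 / real n ^ 3 < r0" "B / (c * (real n)\<^sup>2) \<le> 1 / 2" for n
  proof -
    have np: "real n \<ge> 1" "real n > 0" using n(1) by auto
    obtain N where N: "finite N" "N \<subseteq> \<Theta>'" "real (card N) \<le> (A' / (1 / real n ^ 3)) ^ P"
        "\<forall>x\<in>\<Theta>'. \<exists>y\<in>N. dist x y \<le> 1 / real n ^ 3"
      using A'(2)[of "1 / real n ^ 3"] np unfolding P_def by (auto simp: field_simps)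
    \<comment> \<open>\<open>E0\<close> is the event of a long observation vector, \<open>E \<theta>\<close> that of a likelihood at \<open>\<theta>\<close> competing with the one at \<open>\<theta>\<^sub>0\<close>.\<close>
    define E0 where "E0 = {\<omega> \<in> space M. (real n)\<^sup>2 \<le> ysq n \<omega>}"
    define E where "E \<theta> = {\<omega> \<in> space M. L n \<omega> \<theta> - L n \<omega> \<theta>\<^sub>0 \<le> \<tau>}" for \<theta>
    have K0: "K \<theta>\<^sub>0 x x \<le> C" for x using K_bound[OF \<theta>0, of x x] by (simp add: abs_le_iff)
    note yt = square_sum_tail[OF process inj[of n], of C "(real n)\<^sup>2"]
    have [measurable]: "ysq n \<in> borel_measurable M" using yt(1) K0 np unfolding ysq_def by simp
    have E0: "E0 \<in> events" unfolding E0_def by measurable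
    have pE0: "prob E0 \<le> C / real n"
    proof -
      have "prob E0 \<le> real n * C / (real n)\<^sup>2" using yt(2) K0 np unfolding E0_def ysq_def by simp
      then show ?thesis using np by (simp add: power2_eq_square)
    qed
    have E: "E \<theta> \<in> events" "prob (E \<theta>) \<le> exp (\<tau> / 4 - a * real n / 4)" if "\<theta> \<in> N" for \<theta>
    proof -
      have \<theta>: "\<theta> \<in> \<Theta>'" using that N(2) by blast
      have [measurable]: "(\<lambda>\<omega>. L n \<omega> \<theta> - L n \<omega> \<theta>\<^sub>0) \<in> borel_measurable M" using far[OF n(1,2) \<theta>] by blast
      show "E \<theta> \<in> events" unfolding E_def by measurable
      show "prob (E \<theta>) \<le> exp (\<tau> / 4 - a * real n / 4)" using far[OF n(1,2) \<theta>] unfolding E_def by blast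
    qed
    have "{\<omega> \<in> space M. norm (est n \<omega> - \<theta>\<^sub>0) > \<epsilon>} \<subseteq> E0 \<union> (\<Union>\<theta>\<in>N. E \<theta>)"
    proof
      fix \<omega> assume "\<omega> \<in> {\<omega> \<in> space M. norm (est n \<omega> - \<theta>\<^sub>0) > \<epsilon>}"
      then have \<omega>: "\<omega> \<in> space M" "norm (est n \<omega> - \<theta>\<^sub>0) > \<epsilon>" by auto
      have min: "est n \<omega> \<in> \<Theta>" "neg_log_lik K f Y n \<omega> (est n \<omega>) \<le> neg_log_lik K f Y n \<omega> \<theta>\<^sub>0"
        using estimator[OF n(1) \<omega>(1)] \<theta>0 unfolding is_arg_min_def by (auto simp: not_less)
      have min': "L n \<omega> (est n \<omega>) \<le> L n \<omega> \<theta>\<^sub>0" using min(2) unfolding L_def by (intro mult_left_mono) auto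
      have "est n \<omega> \<in> \<Theta>'" using min(1) \<omega>(2) by (simp add: \<Theta>'_def)
      then obtain \<theta> where \<theta>: "\<theta> \<in> N" "dist (est n \<omega>) \<theta> \<le> 1 / real n ^ 3" using N(4) by blast
      show "\<omega> \<in> E0 \<union> (\<Union>\<theta>\<in>N. E \<theta>)"
      proof (cases "ysq n \<omega> \<le> (real n)\<^sup>2")
        case True
        have "\<theta> \<in> \<Theta>" using \<theta>(1) N(2) by (auto simp: \<Theta>'_def)
        from close[OF n(1,3,4) this min(1) \<theta>(2) True] have "L n \<omega> \<theta> - L n \<omega> \<theta>\<^sub>0 \<le> \<tau>" using min' by linarith
        then show ?thesis using \<theta>(1) \<omega>(1) by (auto simp: E_def)
      qed (use \<omega>(1) in \<open>auto simp: E0_def\<close>)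
    qed
    moreover have "E0 \<union> (\<Union>\<theta>\<in>N. E \<theta>) \<in> events" using E0 E(1) N(1) by auto
    ultimately have "prob {\<omega> \<in> space M. norm (est n \<omega> - \<theta>\<^sub>0) > \<epsilon>} \<le> prob (E0 \<union> (\<Union>\<theta>\<in>N. E \<theta>))"
      by (rule finite_measure_mono)
    also have "\<dots> \<le> prob E0 + prob (\<Union>\<theta>\<in>N. E \<theta>)"
      using E0 E(1) N(1) by (intro measure_Un_le) auto
    also have "prob (\<Union>\<theta>\<in>N. E \<theta>) \<le> (\<Sum>\<theta>\<in>N. prob (E \<theta>))"
      using E(1) N(1) by (intro measure_UNION_le) auto
    also have "(\<Sum>\<theta>\<in>N. prob (E \<theta>)) \<le> real (card N) * exp (\<tau> / 4 - a * real n / 4)"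
      using sum_mono[of N "\<lambda>\<theta>. prob (E \<theta>)" "\<lambda>_. exp (\<tau> / 4 - a * real n / 4)"] E(2) by simp
    also have "\<dots> \<le> (A' * real n ^ 3) ^ P * exp (\<tau> / 4 - a * real n / 4)"
      using N(3) by (intro mult_right_mono) auto
    finally show ?thesis using pE0 by (simp add: bnd_def)
  qed
  have bnd: "bnd \<longlonglongrightarrow> 0"
  proof -
    have "(\<lambda>n. (A' * real n ^ 3) ^ P * exp (\<tau> / 4 - a * real n / 4)) \<longlonglongrightarrow> 0"
      using polynomial_exp_decay[of "a / 4" A' 3 P "\<tau> / 4"] a by simp
    moreover have "(\<lambda>n. C / real n) \<longlonglongrightarrow> 0" by (rule lim_const_over_n)
    ultimately show ?thesis unfolding bnd_def[abs_def] using tendsto_add[of _ 0 sequentially _ 0] by fastforce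
  qed
  have "eventually (\<lambda>n. prob {\<omega> \<in> space M. norm (est n \<omega> - \<theta>\<^sub>0) > \<epsilon>} \<le> bnd n) sequentially"
  proof -
    have "(\<lambda>n. 1 / real n ^ 3) \<longlonglongrightarrow> 0" by real_asymp
    then have e1: "eventually (\<lambda>n. 1 / real n ^ 3 < r0) sequentially" using r0(1) by (rule order_tendstoD)
    have "(\<lambda>n. B / c * (1 / (real n)\<^sup>2)) \<longlonglongrightarrow> B / c * 0" by (intro tendsto_mult_left) real_asymp
    then have "(\<lambda>n. B / (c * (real n)\<^sup>2)) \<longlonglongrightarrow> 0" by simp
    then have e2: "eventually (\<lambda>n. B / (c * (real n)\<^sup>2) < 1 / 2) sequentially" by (rule order_tendstoD) simp
    show ?thesis
      using e1 e2 eventually_ge_at_top[of 1] eventually_ge_at_top[of n1]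
      by eventually_elim (intro main, auto)
  qed
  then show "(\<lambda>n. prob {\<omega> \<in> space M. norm (est n \<omega> - \<theta>\<^sub>0) > \<epsilon>}) \<longlonglongrightarrow> 0"
    by (rule tendsto_sandwich[OF always_eventually[OF allI[OF measure_nonneg]] _ tendsto_const bnd])
qed

end
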